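(* Let $T>0$, let $\phi:\mathbb{R}^n\to[0,+\infty)$ be differentiable, and let $F:[0,T]\times\mathbb{R}^n\to\mathbb{R}$ be such that $F(\cdot,x)$ is measurable for every $x\in\mathbb{R}^n$. Assume: (1) $\phi$ is a strictly convex $G$-function, and both $\phi$ and its conjugate $\phi^\star$ satisfy the $\Delta_2$-condition. (2) For a.e. $t\in[0,T]$, the function $F(t,\cdot)$ is locally Lipschitz and regular on $\mathbb{R}^n$. (3) There exist $b\in L^1([0,T];[0,\infty))$ and $c:\mathbb{R}^n\to\mathbb{R}$, with $c$ bounded on bounded subsets, such that for every $x\in\mathbb{R}^n$, for a.e. $t\in[0,T]$ and for every $\xi_t\in\partial F(t,x)$, $$|F(t,x)|+|\xi_t|\le c(x)\,b(t).$$ (4) There exist a function $d\in L^1([0,T],\mathbb{R})$, with $d(t)\neq 0$ for a.e. $t$, and a $G$-function $\phi_0\ll\phi$ such that for every $x\in\mathbb{R}^n$, for a.e. $t\in[0,T]$ and every $\xi_t\in\partial F(t,x)$, $$\phi^\star\left(\frac{\xi_t}{d(t)}\right)\le\phi_0(x)+1.$$ (5) With the same $\phi_0$, $$\lim_{|x|\to\infty}\frac{1}{\phi_0(2x)}\int_0^TF(t,x)\,dt=\infty.$$ Then the functional $$\mathcal{I}(u)=\int_0^T\phi(u'(t))\,dt+\int_0^TF(t,u(t))\,dt$$ admits a minimizer $u$ on $W^1L^\phi_T$, and $u$ solves the problem $$\frac{d}{dt}\nabla\phi(u'(t))\in\partial F(t,u(t))\ \text{ for a.e. } t\in(0,T),\qquad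 u(0)-u(T)=u'(0)-u'(T)=0.$$
   Context: $|\cdot|$ is the Euclidean norm on $\mathbb{R}^n$. A function $\phi:\mathbb{R}^n\to[0,+\infty]$ is a $G$-function if it is convex, lower semicontinuous, bounded in some neighborhood of $0$, $\phi(0)=0$, $\phi(-x)=\phi(x)$, and $\lim_{|x|\to\infty}\phi(x)=\infty$. Its conjugate (complementary function) is $\phi^\star(\xi)=\sup_{x\in\mathbb{R}^n}\big(\langle\xi,x\rangle-\phi(x)\big)$. A $G$-function $\phi:\mathbb{R}^n\to[0,+\infty)$ satisfies the $\Delta_2$-condition if there is $C>0$ with $\phi(2x)\le C\phi(x)+1$ for all $x$ (in particular, to say that $\phi^\star$ satisfies it includes that $\phi^\star$ is finite-valued). We write $\phi_1\ll\phi_2$ if for every $k>0$ there exists $C>0$ such that $\phi_1(x)\le C+\phi_2(kx)$ for all $x$. For a locally Lipschitz $f:\mathbb{R}^n\to\mathbb{R}$, $f^0(x;v)=\limsup_{y\to x,\ \lambda\searrow0}\frac{f(y+\lambda v)-f(y)}{\lambda}$ and the Clarke generalized gradient is $\partial f(x)=\{\xi: f^0(x;v)\ge\langle\xi,v\rangle\ \forall v\}$. $f$ is regular if the usual (one-sided) directional derivative exists and equals $f^0(x;v)$ for all $x,v$. $\partial F(t,x)$ denotes the Clarke generalized gradient of $F(t,\cdot)$ at $x$. $L^\phi=L^\phi([0,T],\mathbb{R}^n)$ is the set of measurable $u:[0,T]\to\mathbb{R}^n$ with $\int_0^T\phi(\lambda u)\,dt<\infty$ for some $\lambda>0$, with Luxemburg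 norm $\|u\|_{L^\phi}=\inf\{\lambda>0:\int_0^T\phi(u/\lambda)\,dt\le1\}$. $W^1L^\phi$ is the space of absolutely continuous $u:[0,T]\to\mathbb{R}^n$ with $u'\in L^\phi$, normed by $\|u\|_{L^\phi}+\|u'\|_{L^\phi}$, and $W^1L^\phi_T=\{u\in W^1L^\phi:u(0)=u(T)\}$. Solving the problem means: after modification of $u'$ on a null set, $t\mapsto\nabla\phi(u'(t))$ is absolutely continuous on $[0,T]$, the inclusion holds a.e., and the boundary conditions hold (for this representative of $u'$). *)

theory Defs
  imports "HOL-Analysis.Analysis"
begin

section \<open>G-functions\<close>

definition G_function :: "('a::euclidean_space \<Rightarrow> ereal) \<Rightarrow> bool" where
  "G_function \<phi> \<longleftrightarrow>
     (\<forall>x. 0 \<le> \<phi> x) \<and>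
     (\<forall>x y. \<forall>s::real. 0 < s \<and> s < 1 \<longrightarrow>
        \<phi> ((1 - s) *\<^sub>R x + s *\<^sub>R y) \<le> ereal (1 - s) * \<phi> x + ereal s * \<phi> y) \<and>
     (\<forall>x. \<phi> x \<le> Liminf (at x) \<phi>) \<and>
     (\<exists>r>0. \<exists>M::real. \<forall>x\<in>ball 0 r. \<phi> x \<le> ereal M) \<and>
     \<phi> 0 = 0 \<and>
     (\<forall>x. \<phi> (- x) = \<phi> x) \<and>
     (\<phi> \<longlongrightarrow> \<infinity>) at_infinity"

definition conjugate :: "('a::euclidean_space \<Rightarrow> ereal) \<Rightarrow> 'a \<Rightarrow> ereal" where
  "conjugate \<phi> \<xi> = (SUP x. ereal (\<xi> \<bullet> x) - \<phi> x)"

text \<open>The condition is only defined for finite-valued functions, so finiteness is part of it.\<close>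

definition Delta2 :: "('a::euclidean_space \<Rightarrow> ereal) \<Rightarrow> bool" where
  "Delta2 \<phi> \<longleftrightarrow>
     (\<forall>x. \<phi> x < \<infinity>) \<and>
     (\<exists>C::real. 0 < C \<and> (\<forall>x. \<phi> (2 *\<^sub>R x) \<le> ereal C * \<phi> x + 1))"

definition much_less :: "('a::euclidean_space \<Rightarrow> ereal) \<Rightarrow> ('a \<Rightarrow> ereal) \<Rightarrow> bool"
    (infix \<open>\<lless>\<close> 50) where
  "\<phi>\<^sub>1 \<lless> \<phi>\<^sub>2 \<longleftrightarrow>
     (\<forall>k::real. 0 < k \<longrightarrow> (\<exists>C::real. 0 < C \<and> (\<forall>x. \<phi>\<^sub>1 x \<le> ereal C + \<phi>\<^sub>2 (k *\<^sub>R x))))"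

definition strictly_convex :: "('a::real_vector \<Rightarrow> real) \<Rightarrow> bool" where
  "strictly_convex f \<longleftrightarrow>
     (\<forall>x y s. x \<noteq> y \<and> 0 < s \<and> s < 1 \<longrightarrow>
        f ((1 - s) *\<^sub>R x + s *\<^sub>R y) < (1 - s) * f x + s * f y)"

text \<open>Meaningful only where \<open>f\<close> is differentiable.\<close>

definition grad :: "('a::euclidean_space \<Rightarrow> real) \<Rightarrow> 'a \<Rightarrow> 'a" where
  "grad f x = (THE D. GDERIV f x :> D)"

section \<open>Clarke generalized gradient\<close>

definition locally_Lipschitz :: "('a::metric_space \<Rightarrow> 'b::metric_space) \<Rightarrow> bool" where
  "locally_Lipschitz f \<longleftrightarrow> (\<forall>x. \<exists>r>0. \<exists>L. L-lipschitz_on (ball x r) f)"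

text \<open>The base point may equal \<open>x\<close> along the limit, hence \<open>nhds x\<close> and not \<open>at x\<close>.\<close>

definition clarke_derivative :: "('a::euclidean_space \<Rightarrow> real) \<Rightarrow> 'a \<Rightarrow> 'a \<Rightarrow> ereal" where
  "clarke_derivative f x v =
     Limsup (nhds x \<times>\<^sub>F at_right 0)
       (\<lambda>(y, l). ereal ((f (y + l *\<^sub>R v) - f y) / l))"

definition clarke_gradient :: "('a::euclidean_space \<Rightarrow> real) \<Rightarrow> 'a \<Rightarrow> 'a set" where
  "clarke_gradient f x = {\<xi>. \<forall>v. clarke_derivative f x v \<ge> ereal (\<xi> \<bullet> v)}"

definition clarke_regular :: "('a::euclidean_space \<Rightarrow> real) \<Rightarrow> bool" where
  "clarke_regular f \<longleftrightarrow>
     (\<forall>x v. \<exists>D::real.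
        ((\<lambda>l. (f (x + l *\<^sub>R v) - f x) / l) \<longlongrightarrow> D) (at_right 0) \<and>
        clarke_derivative f x v = ereal D)"

section \<open>Orlicz-Sobolev spaces on an interval\<close>

text \<open>The usual \<open>\<epsilon>\<close>-\<open>\<delta>\<close> definition: \<open>d\<close> is a finite family of non-overlapping
  closed subintervals \<open>k = [Inf k, Sup k]\<close> of \<open>[a, b]\<close>, not necessarily covering it.\<close>

definition absolutely_continuous_on ::
    "real \<Rightarrow> real \<Rightarrow> (real \<Rightarrow> 'a::real_normed_vector) \<Rightarrow> bool" where
  "absolutely_continuous_on a b f \<longleftrightarrow>
     (\<forall>e>0. \<exists>\<delta>>0. \<forall>d s. d division_of s \<and> s \<subseteq> {a..b} \<and> (\<Sum>k\<in>d. Sup k - Inf k) < \<delta>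
        \<longrightarrow> (\<Sum>k\<in>d. norm (f (Sup k) - f (Inf k))) < e)"

definition Orlicz_space :: "real \<Rightarrow> ('a::euclidean_space \<Rightarrow> ereal) \<Rightarrow> (real \<Rightarrow> 'a) set" where
  "Orlicz_space T \<phi> =
     {u. u \<in> borel_measurable (lebesgue_on {0..T}) \<and>
         (\<exists>l::real. 0 < l \<and> (\<integral>\<^sup>+t. e2ennreal (\<phi> (l *\<^sub>R u t)) \<partial>lebesgue_on {0..T}) < \<infinity>)}"

text \<open>The derivative is taken within \<open>[0, T]\<close>, so that only the values of \<open>u\<close> on \<open>[0, T]\<close>
  matter. Where \<open>u\<close> is not differentiable its value is arbitrary; for absolutely continuous
  \<open>u\<close> this is a null set.\<close>

abbreviation weak_deriv :: "real \<Rightarrow> (real \<Rightarrow> 'a::euclidean_space) \<Rightarrow> real \<Rightarrow> 'a" where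
  "weak_deriv T u t \<equiv> vector_derivative u (at t within {0..T})"

definition Orlicz_Sobolev_space ::
    "real \<Rightarrow> ('a::euclidean_space \<Rightarrow> ereal) \<Rightarrow> (real \<Rightarrow> 'a) set" where
  "Orlicz_Sobolev_space T \<phi> =
     {u. absolutely_continuous_on 0 T u \<and> weak_deriv T u \<in> Orlicz_space T \<phi>}"

definition periodic_Orlicz_Sobolev_space ::
    "real \<Rightarrow> ('a::euclidean_space \<Rightarrow> ereal) \<Rightarrow> (real \<Rightarrow> 'a) set" where
  "periodic_Orlicz_Sobolev_space T \<phi> = {u \<in> Orlicz_Sobolev_space T \<phi>. u 0 = u T}"

section \<open>The variational problem\<close>

definition action ::
    "real \<Rightarrow> ('a::euclidean_space \<Rightarrow> real) \<Rightarrow> (real \<Rightarrow> 'a \<Rightarrow> real) \<Rightarrow> (real \<Rightarrow> 'a) \<Rightarrow> real" where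
  "action T \<phi> F u =
     (LINT t|lebesgue_on {0..T}. \<phi> (weak_deriv T u t)) + (LINT t|lebesgue_on {0..T}. F t (u t))"

text \<open>\<open>w\<close> is the representative of \<open>u'\<close> for which \<open>\<nabla>\<phi> \<circ> w\<close> is absolutely continuous.\<close>

definition solves_inclusion ::
    "real \<Rightarrow> ('a::euclidean_space \<Rightarrow> real) \<Rightarrow> (real \<Rightarrow> 'a \<Rightarrow> real) \<Rightarrow> (real \<Rightarrow> 'a) \<Rightarrow> bool" where
  "solves_inclusion T \<phi> F u \<longleftrightarrow>
     (\<exists>w. (AE t in lebesgue_on {0..T}. (u has_vector_derivative w t) (at t within {0..T})) \<and>
          absolutely_continuous_on 0 T (\<lambda>t. grad \<phi> (w t)) \<and>
          (AE t in lebesgue_on {0..T}. \<exists>p \<in> clarke_gradient (F t) (u t).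
             ((\<lambda>t. grad \<phi> (w t)) has_vector_derivative p) (at t within {0..T})) \<and>
          u 0 - u T = 0 \<and> w 0 - w T = 0)"

end

theory Submission
  imports Defs "HOL-Complex_Analysis.Great_Picard"
begin

text \<open>A minimizer is found by the direct method. With \<open>v = u - u 0\<close>, the growth condition on the
  gradients bounds the action from below by half the energy of \<open>u\<close> plus
  \<open>(\<integral>F t (u 0) dt) - C * \<phi>\<^sub>0 (2 * u 0)\<close> up to a constant: the dual form of the \<open>\<Delta>\<^sub>2\<close>-condition on the
  conjugate makes \<open>K * \<phi> (v / K)\<close> a small multiple of \<open>\<phi> v\<close>. A minimizing sequence is therefore
  bounded and, since \<open>\<phi>\<close> is superlinear, equi-absolutely continuous, so a subsequence converges
  uniformly. Lower semicontinuity of the energy needs no weak topology: Jensen's inequality on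
  uniform partitions passes to the limit, and Fatou's lemma refines the partition.

  The bounds on gradients hold, for each \<open>x\<close>, off a null set depending on \<open>x\<close>. By regularity they bound
  one-sided derivatives along segments, hence increments of \<open>F t\<close>, and by continuity the null set may
  then be chosen independently of \<open>x\<close>.

  For the inclusion let \<open>p t = \<nabla>\<phi> (u' t)\<close>. Varying a minimizer by a trapezoid times a vector \<open>w\<close> and letting
  the ramps shrink gives \<open>(p t - p s) \<bullet> w \<le> \<integral>\<close> of the Clarke derivative of \<open>F\<close> in direction \<open>w\<close> over
  \<open>[s, t]\<close>, for almost all \<open>s < t\<close>. Hence \<open>p\<close> has an absolutely continuous extension whose derivative
  lies in the Clarke gradient. The complementary trapezoids, supported around the endpoints, give
  equal values at \<open>0\<close> and \<open>T\<close>, and \<open>u'\<close> is recovered because \<open>\<nabla>\<phi>\<close> is a bijection.\<close>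

section \<open>Absolutely continuous functions\<close>

text \<open>The Clarke derivative is only positively homogeneous and subadditive in its direction.
  Trapezoids and their complements are nonnegative, agree at both endpoints, and have derivatives
  concentrated on two short ramps, so they compare \<open>p\<close> at two times. Each comparison
  holds off a null set that depends on \<open>w\<close>; hence \<open>w\<close> runs through a
  countable dense set until continuity in \<open>w\<close> can take over. The two gradient bounds do
  different work. The one with \<open>c\<close> and \<open>b\<close> makes \<open>F t\<close>
  Lipschitz on balls with an integrable constant and so justifies the limits under the integral of
  F; the one with the conjugate serves coercivity. The definition of absolute continuity by interval
  families supplies no derivative. A density is built from the total variation, Stieltjes measures
  and Radon-Nikodym, and Lebesgue differentiation then identifies it with
  \<open>weak_deriv\<close>.\<close>

text \<open>Extension by zero reduces this to Lebesgue differentiation over intervals with left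
  endpoint t. The error is kept as a remainder \<open>e * h\<close>, the form that
  \<open>has_derivative_within_alt\<close> asks for.\<close>

lemma integral_right_quotient:
  fixes f :: "real \<Rightarrow> 'a::euclidean_space"
  assumes "f integrable_on {a..b}"
  obtains N where "negligible N"
    "\<And>t e. t \<in> {a..b} - N \<Longrightarrow> 0 < e \<Longrightarrow>
       \<exists>d>0. \<forall>h. 0 < h \<and> h < d \<and> t + h \<le> b \<longrightarrow> norm (integral {t..t+h} f - h *\<^sub>R f t) \<le> e * h"
proof -
  define g where "g x = (if x \<in> {a..b} then f x else 0)" for x
  have "g integrable_on UNIV"
    using assms unfolding g_def by (simp only: integrable_restrict_UNIV)
  then have "g integrable_on cbox c d" for c d
    by (rule integrable_on_subcbox) auto
  then obtain N where N: "negligible N"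
    "\<And>x e. \<lbrakk>x \<notin> N; 0 < e\<rbrakk> \<Longrightarrow> \<exists>d>0. \<forall>h. 0 < h \<and> h < d \<longrightarrow>
        norm(integral (cbox x (x + h *\<^sub>R One)) g /\<^sub>R h ^ DIM(real) - g x) < e"
    by (rule integrable_ccontinuous_explicit) blast
  show thesis
  proof
    show "negligible N" by fact
    fix t e :: real assume t: "t \<in> {a..b} - N" and e: "0 < e"
    obtain d where d: "d > 0" "\<And>h. 0 < h \<Longrightarrow> h < d \<Longrightarrow>
        norm(integral {t..t+h} g /\<^sub>R h - g t) < e"
      using N(2)[of t e] t e by auto
    have "norm (integral {t..t+h} f - h *\<^sub>R f t) \<le> e * h" if h: "0 < h" "h < d" "t + h \<le> b" for h
    proof -
      have eq: "integral {t..t+h} g = integral {t..t+h} f"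
        using t h by (intro integral_cong) (auto simp: g_def)
      have "norm (integral {t..t+h} f - h *\<^sub>R f t) = norm (h *\<^sub>R (integral {t..t+h} f /\<^sub>R h - f t))"
        using h by (simp add: algebra_simps)
      also have "\<dots> = h * norm (integral {t..t+h} g /\<^sub>R h - g t)"
        using t h by (simp add: eq g_def)
      also have "\<dots> \<le> h * e"
        using d(2)[of h] h by (intro mult_left_mono) auto
      finally show ?thesis by (simp add: mult.commute)
    qed
    with d(1) show "\<exists>d>0. \<forall>h. 0 < h \<and> h < d \<and> t + h \<le> b \<longrightarrow> norm (integral {t..t+h} f - h *\<^sub>R f t) \<le> e * h"
      by blast
  qed
qed

text \<open>Reflection turns left quotients into right ones. The exceptional set becomes a mirror
  image, negligible as the image of a null set under a differentiable map.\<close>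

lemma integral_left_quotient:
  fixes f :: "real \<Rightarrow> 'a::euclidean_space"
  assumes "f integrable_on {a..b}"
  obtains N where "negligible N"
    "\<And>t e. t \<in> {a..b} - N \<Longrightarrow> 0 < e \<Longrightarrow>
       \<exists>d>0. \<forall>h. 0 < h \<and> h < d \<and> a \<le> t - h \<longrightarrow> norm (integral {t-h..t} f - h *\<^sub>R f t) \<le> e * h"
proof -
  have "(\<lambda>x. f (- x)) integrable_on {-b..-a}"
    using assms integrable_reflect[of f b a] by (simp add: cbox_interval)
  then obtain N where N: "negligible N"
    "\<And>t e. t \<in> {-b..-a} - N \<Longrightarrow> 0 < e \<Longrightarrow>
       \<exists>d>0. \<forall>h. 0 < h \<and> h < d \<and> t + h \<le> -a \<longrightarrow> norm (integral {t..t+h} (\<lambda>x. f (-x)) - h *\<^sub>R f (-t)) \<le> e * h"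
    using integral_right_quotient[of "\<lambda>x. f (-x)" "-b" "-a"] by blast
  show thesis
  proof
    show "negligible (uminus ` N)"
      using N(1) by (intro negligible_differentiable_image_negligible)
        (auto intro!: differentiable_on_minus differentiable_on_ident)
    fix t e :: real assume t: "t \<in> {a..b} - uminus ` N" and e: "0 < e"
    then have "-t \<in> {-b..-a} - N" by (auto simp: image_iff)
    from N(2)[OF this e] obtain d where d: "d > 0"
      "\<And>h. 0 < h \<Longrightarrow> h < d \<Longrightarrow> -t + h \<le> -a \<Longrightarrow> norm (integral {-t..-t+h} (\<lambda>x. f (-x)) - h *\<^sub>R f t) \<le> e * h"
      by auto
    have "integral {-t..-t+h} (\<lambda>x. f (-x)) = integral {t-h..t} f" for h
      using integral_reflect[of t "t-h" f] by (simp add: cbox_interval algebra_simps)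
    then show "\<exists>d>0. \<forall>h. 0 < h \<and> h < d \<and> a \<le> t - h \<longrightarrow> norm (integral {t-h..t} f - h *\<^sub>R f t) \<le> e * h"
      using d by (intro exI[of _ d]) (auto simp: algebra_simps)
  qed
qed

text \<open>The two one-sided remainder estimates combine into the derivative within the interval;
  at an endpoint one of them is vacuous.\<close>

theorem integral_has_vector_derivative_AE:
  fixes f :: "real \<Rightarrow> 'a::euclidean_space"
  assumes f: "f integrable_on {a..b}"
  obtains N where "negligible N"
    "\<And>t. t \<in> {a..b} - N \<Longrightarrow> ((\<lambda>u. integral {a..u} f) has_vector_derivative f t) (at t within {a..b})"
proof -
  obtain N1 where N1: "negligible N1"
    "\<And>t e. t \<in> {a..b} - N1 \<Longrightarrow> 0 < e \<Longrightarrow>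
       \<exists>d>0. \<forall>h. 0 < h \<and> h < d \<and> t + h \<le> b \<longrightarrow> norm (integral {t..t+h} f - h *\<^sub>R f t) \<le> e * h"
    by (rule integral_right_quotient[OF f]) blast
  obtain N2 where N2: "negligible N2"
    "\<And>t e. t \<in> {a..b} - N2 \<Longrightarrow> 0 < e \<Longrightarrow>
       \<exists>d>0. \<forall>h. 0 < h \<and> h < d \<and> a \<le> t - h \<longrightarrow> norm (integral {t-h..t} f - h *\<^sub>R f t) \<le> e * h"
    by (rule integral_left_quotient[OF f]) blast
  show thesis
  proof
    show "negligible (N1 \<union> N2)" using N1(1) N2(1) by simp
    fix t assume t: "t \<in> {a..b} - (N1 \<union> N2)"
    have comb: "integral {a..y} f - integral {a..x} f = integral {x..y} f" if "a \<le> x" "x \<le> y" "y \<le> b" for x y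
    proof -
      have "f integrable_on {a..y}"
        using integrable_on_subinterval[OF f] that by auto
      then have "integral {a..x} f + integral {x..y} f = integral {a..y} f"
        using that by (intro Henstock_Kurzweil_Integration.integral_combine) auto
      then show ?thesis by (simp add: algebra_simps)
    qed
    show "((\<lambda>u. integral {a..u} f) has_vector_derivative f t) (at t within {a..b})"
      unfolding has_vector_derivative_def has_derivative_within_alt
    proof (intro conjI allI impI)
      show "bounded_linear (\<lambda>x. x *\<^sub>R f t)" by (rule bounded_linear_scaleR_left)
      fix e :: real assume e: "0 < e"
      obtain d1 where d1: "d1 > 0" "\<And>h. 0 < h \<Longrightarrow> h < d1 \<Longrightarrow> t + h \<le> b \<Longrightarrow> norm (integral {t..t+h} f - h *\<^sub>R f t) \<le> e * h"
        using N1(2)[of t e] t e by auto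
      obtain d2 where d2: "d2 > 0" "\<And>h. 0 < h \<Longrightarrow> h < d2 \<Longrightarrow> a \<le> t - h \<Longrightarrow> norm (integral {t-h..t} f - h *\<^sub>R f t) \<le> e * h"
        using N2(2)[of t e] t e by auto
      show "\<exists>d>0. \<forall>y\<in>{a..b}. norm (y - t) < d \<longrightarrow>
          norm (integral {a..y} f - integral {a..t} f - (y - t) *\<^sub>R f t) \<le> e * norm (y - t)"
      proof (intro exI[of _ "min d1 d2"] conjI ballI impI)
        show "0 < min d1 d2" using d1 d2 by simp
        fix y assume y: "y \<in> {a..b}" "norm (y - t) < min d1 d2"
        consider "y = t" | "y > t" | "y < t" by linarith
        then show "norm (integral {a..y} f - integral {a..t} f - (y - t) *\<^sub>R f t) \<le> e * norm (y - t)"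
        proof cases
          case 2
          then show ?thesis using d1(2)[of "y - t"] y t comb[of t y] by auto
        next
          case 3
          have "norm (integral {a..y} f - integral {a..t} f - (y - t) *\<^sub>R f t)
              = norm (integral {a..t} f - integral {a..y} f - (t - y) *\<^sub>R f t)"
            by (subst norm_minus_cancel[symmetric]) (simp add: algebra_simps)
          then show ?thesis using 3 d2(2)[of "t - y"] y t comb[of y t] by auto
        qed auto
      qed
    qed
  qed
qed


section \<open>Absolute continuity for indexed families of intervals\<close>

text \<open>Indexed families, unlike the sets of \<open>division_of\<close>, may contain the same
  degenerate interval several times. Such families arise when endpoints are clamped or partitions
  are refined.\<close>

definition nonoverlapping :: "real \<Rightarrow> real \<Rightarrow> 'i set \<Rightarrow> ('i \<Rightarrow> real) \<Rightarrow> ('i \<Rightarrow> real) \<Rightarrow> bool" where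
  "nonoverlapping a b I l r \<longleftrightarrow> finite I \<and> (\<forall>i\<in>I. a \<le> l i \<and> l i \<le> r i \<and> r i \<le> b) \<and>
     (\<forall>i\<in>I. \<forall>j\<in>I. i \<noteq> j \<longrightarrow> {l i<..<r i} \<inter> {l j<..<r j} = {})"

text \<open>Degenerate intervals contribute nothing and are dropped. The remaining ones are pairwise
  distinct, since equal nondegenerate intervals would overlap, so they form a division. The index
  type is left free because refinements are indexed by pairs.\<close>

lemma absolutely_continuous_onD:
  fixes f :: "real \<Rightarrow> 'a::real_normed_vector"
  assumes "absolutely_continuous_on a b f" "0 < e"
  shows "\<exists>\<delta>>0. \<forall>(I::'i set) l r. nonoverlapping a b I l r \<and> (\<Sum>i\<in>I. r i - l i) < \<delta> \<longrightarrow>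
           (\<Sum>i\<in>I. norm (f (r i) - f (l i))) < e"
proof -
  obtain \<delta> where \<delta>: "\<delta> > 0" "\<And>d s. d division_of s \<Longrightarrow> s \<subseteq> {a..b} \<Longrightarrow> (\<Sum>k\<in>d. Sup k - Inf k) < \<delta>
        \<Longrightarrow> (\<Sum>k\<in>d. norm (f (Sup k) - f (Inf k))) < e"
    using assms unfolding absolutely_continuous_on_def by meson
  have "(\<Sum>i\<in>I. norm (f (r i) - f (l i))) < e"
    if I: "nonoverlapping a b I l r" and len: "(\<Sum>i\<in>I. r i - l i) < \<delta>" for I :: "'i set" and l r
  proof -
    define J where "J = {i\<in>I. l i < r i}"
    let ?k = "\<lambda>i. {l i..r i}"
    have finI: "finite I" and I1: "\<And>i. i \<in> I \<Longrightarrow> a \<le> l i \<and> l i \<le> r i \<and> r i \<le> b"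
      and I2: "\<And>i j. i \<in> I \<Longrightarrow> j \<in> I \<Longrightarrow> i \<noteq> j \<Longrightarrow> {l i<..<r i} \<inter> {l j<..<r j} = {}"
      using I unfolding nonoverlapping_def by auto
    have finJ: "finite J" using finI J_def by simp
    have inj: "inj_on ?k J"
    proof (rule inj_onI, rule ccontr)
      fix i j assume ij: "i \<in> J" "j \<in> J" "?k i = ?k j" "i \<noteq> j"
      then have "l i = l j" "r i = r j" by (auto simp: J_def Icc_eq_Icc)
      then show False using I2[of i j] ij by (auto simp: J_def)
    qed
    have J0: "r i = l i" if "i \<in> I - J" for i
      using that I1[of i] by (auto simp: J_def)
    have Sup: "Sup (?k i) = r i" "Inf (?k i) = l i" if "i \<in> J" for i
      using that by (auto simp: J_def)
    have div: "(?k ` J) division_of (\<Union>(?k ` J))"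
      unfolding division_of_def
    proof (intro conjI ballI impI)
      show "finite (?k ` J)" using finJ by simp
    next
      fix K assume K: "K \<in> ?k ` J"
      show "K \<subseteq> \<Union>(?k ` J)" "K \<noteq> {}" "\<exists>a b. K = cbox a b"
        using K by (auto simp: J_def)
    next
      fix K1 K2 assume "K1 \<in> ?k ` J" "K2 \<in> ?k ` J" "K1 \<noteq> K2"
      then obtain i j where "i \<in> J" "j \<in> J" "K1 = ?k i" "K2 = ?k j" "i \<noteq> j" by auto
      then show "interior K1 \<inter> interior K2 = {}"
        using I2[of i j] by (auto simp: J_def interior_atLeastAtMost_real)
    qed auto
    have "(\<Sum>k\<in>?k ` J. Sup k - Inf k) = (\<Sum>i\<in>J. r i - l i)"
      by (subst sum.reindex[OF inj]) (auto simp: Sup intro!: sum.cong)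
    also have "\<dots> = (\<Sum>i\<in>I. r i - l i)"
      using J0 J_def by (intro sum.mono_neutral_left[OF finI]) force+
    finally have len': "(\<Sum>k\<in>?k ` J. Sup k - Inf k) < \<delta>" using len by simp
    have sub: "\<Union>(?k ` J) \<subseteq> {a..b}"
    proof
      fix x assume "x \<in> \<Union>(?k ` J)"
      then obtain i where "i \<in> I" "x \<in> ?k i" by (auto simp: J_def)
      then show "x \<in> {a..b}" using I1[of i] by auto
    qed
    have "(\<Sum>i\<in>I. norm (f (r i) - f (l i))) = (\<Sum>i\<in>J. norm (f (r i) - f (l i)))"
      using J0 J_def by (intro sum.mono_neutral_right[OF finI]) force+
    also have "\<dots> = (\<Sum>k\<in>?k ` J. norm (f (Sup k) - f (Inf k)))"
      by (subst sum.reindex[OF inj]) (auto simp: Sup intro!: sum.cong)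
    also have "\<dots> < e" by (rule \<delta>(2)[OF div sub len'])
    finally show ?thesis .
  qed
  with \<delta>(1) show ?thesis by blast
qed

lemma nonoverlapping_division:
  assumes "d division_of s" "s \<subseteq> {a..b::real}"
  shows "nonoverlapping a b d Inf Sup" "\<And>k. k \<in> d \<Longrightarrow> k = {Inf k..Sup k}"
proof -
  have k: "k = {Inf k..Sup k} \<and> a \<le> Inf k \<and> Inf k \<le> Sup k \<and> Sup k \<le> b" if kd: "k \<in> d" for k
  proof -
    obtain u v where uv: "k = cbox u v" using division_ofD(4)[OF assms(1) kd] by blast
    have "k \<noteq> {}" "k \<subseteq> {a..b}" using division_ofD(2,3)[OF assms(1) kd] assms(2) by auto
    then have "u \<le> v" "a \<le> u" "v \<le> b" using uv by (auto simp: cbox_interval)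
    then have "Inf k = u" "Sup k = v" using uv by (auto simp: cbox_interval)
    then show ?thesis using uv \<open>u \<le> v\<close> \<open>a \<le> u\<close> \<open>v \<le> b\<close> by (simp add: cbox_interval)
  qed
  then show "\<And>k. k \<in> d \<Longrightarrow> k = {Inf k..Sup k}" by blast
  show "nonoverlapping a b d Inf Sup" unfolding nonoverlapping_def
  proof (intro conjI ballI impI)
    show "finite d" using assms by blast
    fix i j assume ij: "i \<in> d" "j \<in> d" "i \<noteq> j"
    have "interior i \<inter> interior j = {}" using division_ofD(5)[OF assms(1) ij] .
    moreover have "interior i = {Inf i<..<Sup i}" "interior j = {Inf j<..<Sup j}"
      by (metis ij k interior_atLeastAtMost_real)+
    ultimately show "{Inf i<..<Sup i} \<inter> {Inf j<..<Sup j} = {}" by simp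
  next
    fix i assume "i \<in> d"
    then show "a \<le> Inf i" "Inf i \<le> Sup i" "Sup i \<le> b" using k by blast+
  qed
qed

text \<open>A division indexes itself through \<open>Inf\<close> and \<open>Sup\<close>, so families
  indexed by sets of reals are enough.\<close>

lemma absolutely_continuous_onI:
  fixes f :: "real \<Rightarrow> 'a::real_normed_vector"
  assumes "\<And>e. 0 < e \<Longrightarrow> \<exists>\<delta>>0. \<forall>(I::real set set) l r. nonoverlapping a b I l r \<and> (\<Sum>i\<in>I. r i - l i) < \<delta> \<longrightarrow>
           (\<Sum>i\<in>I. norm (f (r i) - f (l i))) < e"
  shows "absolutely_continuous_on a b f"
  unfolding absolutely_continuous_on_def
  using assms nonoverlapping_division(1) by meson

lemma absolutely_continuous_on_le:
  fixes f :: "real \<Rightarrow> 'a::real_normed_vector" and g :: "real \<Rightarrow> 'b::real_normed_vector"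
  assumes g: "absolutely_continuous_on a b g"
    and le: "\<And>s t. a \<le> s \<Longrightarrow> s \<le> t \<Longrightarrow> t \<le> b \<Longrightarrow> norm (f t - f s) \<le> norm (g t - g s)"
  shows "absolutely_continuous_on a b f"
proof (rule absolutely_continuous_onI)
  fix e :: real assume "0 < e"
  from absolutely_continuous_onD[OF g this]
  obtain \<delta> where \<delta>: "\<delta> > 0" "\<And>(I::real set set) l r. nonoverlapping a b I l r \<and> (\<Sum>i\<in>I. r i - l i) < \<delta> \<Longrightarrow>
           (\<Sum>i\<in>I. norm (g (r i) - g (l i))) < e" by blast
  have "(\<Sum>i\<in>I. norm (f (r i) - f (l i))) < e"
    if "nonoverlapping a b I l r \<and> (\<Sum>i\<in>I. r i - l i) < \<delta>" for I :: "real set set" and l r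
  proof -
    have "(\<Sum>i\<in>I. norm (f (r i) - f (l i))) \<le> (\<Sum>i\<in>I. norm (g (r i) - g (l i)))"
      using that by (intro sum_mono le) (auto simp: nonoverlapping_def)
    then show ?thesis using \<delta>(2)[OF that] by simp
  qed
  with \<delta>(1) show "\<exists>\<delta>>0. \<forall>(I::real set set) l r. nonoverlapping a b I l r \<and> (\<Sum>i\<in>I. r i - l i) < \<delta> \<longrightarrow>
           (\<Sum>i\<in>I. norm (f (r i) - f (l i))) < e" by blast
qed

lemma absolutely_continuous_on_add:
  fixes f g :: "real \<Rightarrow> 'a::real_normed_vector"
  assumes f: "absolutely_continuous_on a b f" and g: "absolutely_continuous_on a b g"
  shows "absolutely_continuous_on a b (\<lambda>t. f t + g t)"
proof (rule absolutely_continuous_onI)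
  fix e :: real assume "0 < e"
  then have e: "0 < e / 2" by simp
  obtain \<delta>1 where \<delta>1: "\<delta>1 > 0" "\<And>(I::real set set) l r. nonoverlapping a b I l r \<and> (\<Sum>i\<in>I. r i - l i) < \<delta>1 \<Longrightarrow>
           (\<Sum>i\<in>I. norm (f (r i) - f (l i))) < e/2" using absolutely_continuous_onD[OF f e] by blast
  obtain \<delta>2 where \<delta>2: "\<delta>2 > 0" "\<And>(I::real set set) l r. nonoverlapping a b I l r \<and> (\<Sum>i\<in>I. r i - l i) < \<delta>2 \<Longrightarrow>
           (\<Sum>i\<in>I. norm (g (r i) - g (l i))) < e/2" using absolutely_continuous_onD[OF g e] by blast
  have "(\<Sum>i\<in>I. norm (f (r i) + g (r i) - (f (l i) + g (l i)))) < e"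
    if *: "nonoverlapping a b I l r \<and> (\<Sum>i\<in>I. r i - l i) < min \<delta>1 \<delta>2" for I :: "real set set" and l r
  proof -
    have "norm (f (r i) + g (r i) - (f (l i) + g (l i))) \<le> norm (f (r i) - f (l i)) + norm (g (r i) - g (l i))" for i
      by (metis add_diff_add norm_triangle_ineq)
    then have "(\<Sum>i\<in>I. norm (f (r i) + g (r i) - (f (l i) + g (l i)))) \<le>
      (\<Sum>i\<in>I. norm (f (r i) - f (l i))) + (\<Sum>i\<in>I. norm (g (r i) - g (l i)))"
      by (auto simp: sum.distrib[symmetric] intro: sum_mono)
    then show ?thesis using \<delta>1(2)[of I l r] \<delta>2(2)[of I l r] * by auto
  qed
  then show "\<exists>\<delta>>0. \<forall>(I::real set set) l r. nonoverlapping a b I l r \<and> (\<Sum>i\<in>I. r i - l i) < \<delta> \<longrightarrow>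
           (\<Sum>i\<in>I. norm (f (r i) + g (r i) - (f (l i) + g (l i)))) < e"
    using \<delta>1(1) \<delta>2(1) by (intro exI[of _ "min \<delta>1 \<delta>2"]) auto
qed

lemma absolutely_continuous_on_imp_uniformly_continuous_on:
  fixes f :: "real \<Rightarrow> 'a::real_normed_vector"
  assumes "absolutely_continuous_on a b f"
  shows "uniformly_continuous_on {a..b} f"
  unfolding uniformly_continuous_on_def
proof (intro allI impI)
  fix e :: real assume "0 < e"
  from absolutely_continuous_onD[OF assms this]
  obtain \<delta> where \<delta>: "\<delta> > 0" "\<And>(I::unit set) l r. nonoverlapping a b I l r \<and> (\<Sum>i\<in>I. r i - l i) < \<delta> \<Longrightarrow>
           (\<Sum>i\<in>I. norm (f (r i) - f (l i))) < e" by blast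
  have *: "dist (f y) (f x) < e" if "x \<in> {a..b}" "y \<in> {a..b}" "x \<le> y" "dist y x < \<delta>" for x y
    using \<delta>(2)[of "{()}" "\<lambda>_. x" "\<lambda>_. y"] that by (auto simp: nonoverlapping_def dist_norm)
  have "dist (f y) (f x) < e" if "x \<in> {a..b}" "y \<in> {a..b}" "dist y x < \<delta>" for x y
    using *[of x y] *[of y x] that by (cases "x \<le> y") (auto simp: dist_commute)
  then show "\<exists>d>0. \<forall>x\<in>{a..b}. \<forall>x'\<in>{a..b}. dist x' x < d \<longrightarrow> dist (f x') (f x) < e"
    using \<delta>(1) by blast
qed

section \<open>Monotone absolutely continuous functions and their Stieltjes measures\<close>

text \<open>A null set is enclosed in an open set of length below \<delta> and covered by countably
  many nonoverlapping intervals inside it. Finitely many of them have Stieltjes measure below e, and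
  the bound survives the limit. The set is first cut to a bounded piece, which
  \<open>covering_lemma\<close> requires.\<close>

lemma mono_interval_measure_absolutely_continuous:
  fixes G :: "real \<Rightarrow> real"
  assumes mono: "mono G" and cont: "continuous_on UNIV G"
    and ac: "\<And>e. 0 < e \<Longrightarrow> \<exists>\<delta>>0. \<forall>(I::real set set) l r u v. nonoverlapping u v I l r \<and> (\<Sum>i\<in>I. r i - l i) < \<delta> \<longrightarrow>
           (\<Sum>i\<in>I. G (r i) - G (l i)) < e"
  shows "absolutely_continuous lborel (interval_measure G)"
proof -
  let ?\<mu> = "interval_measure G"
  have Icc: "emeasure ?\<mu> {u..v} = ennreal (G v - G u)" if "u \<le> v" for u v
    using mono cont that by (intro emeasure_interval_measure_Icc) (auto dest: monoD)
  have null: "emeasure ?\<mu> (N \<inter> {-real k..real k}) = 0" if N: "N \<in> null_sets lborel" for N :: "real set" and k :: nat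
  proof -
    let ?S = "N \<inter> {-real k..real k}"
    have S: "?S \<in> sets borel" "emeasure lborel ?S = 0"
      using N by (auto simp: null_sets_def intro!: emeasure_0_AE null_sets.Int)
        (metis N emeasure_eq_0 inf_le1 null_setsD1 null_setsD2)
    have "emeasure ?\<mu> ?S \<le> ennreal e" if e: "0 < e" for e :: real
    proof -
      obtain \<delta> where \<delta>: "\<delta> > 0" "\<And>(I::real set set) l r u v. nonoverlapping u v I l r \<Longrightarrow> (\<Sum>i\<in>I. r i - l i) < \<delta> \<Longrightarrow>
           (\<Sum>i\<in>I. G (r i) - G (l i)) < e" using ac[OF e] by blast
      obtain U where U: "open U" "?S \<subseteq> U" "emeasure lborel (U - ?S) < \<delta>"
        using outer_regular_lborel[OF S(1) \<delta>(1)] by metis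
      have "emeasure lborel U \<le> emeasure lborel (U - ?S) + emeasure lborel ?S"
        using U S by (subst emeasure_Un_null_set[symmetric]) (auto simp: null_sets_def intro!: emeasure_mono)
      then have mU: "emeasure lborel U < \<delta>" using U(3) S(2) by simp
      \<comment> \<open>This gauge forces every covering interval into U, because each is
        subordinate to a point of the null set; off U it only has to be an open
        neighbourhood.\<close>
      define g where "g x = (if x \<in> U then U else UNIV)" for x
      have "gauge g" using U(1) by (auto simp: gauge_def g_def)
      moreover have "?S \<subseteq> cbox (- real k - 1) (real k + 1)" "box (- real k - 1) (real k + 1) \<noteq> {}"
        by (auto simp: cbox_interval box_real)
      ultimately obtain D where D: "countable D" "\<And>K. K \<in> D \<Longrightarrow> interior K \<noteq> {} \<and> (\<exists>c d. K = cbox c d)"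
        "pairwise (\<lambda>A B. interior A \<inter> interior B = {}) D" "\<And>K. K \<in> D \<Longrightarrow> \<exists>x \<in> ?S \<inter> K. K \<subseteq> g x"
        "\<Union>D \<subseteq> cbox (- real k - 1) (real k + 1)" "?S \<subseteq> \<Union>D"
        using covering_lemma[of ?S "- real k - 1" "real k + 1" g] by (metis (no_types, lifting))
      have DU: "K \<subseteq> U" if "K \<in> D" for K
        using D(4)[OF that] U(2) by (auto simp: g_def split: if_splits)
      have K: "K = {Inf K..Sup K} \<and> Inf K < Sup K \<and> - real k - 1 \<le> Inf K \<and> Sup K \<le> real k + 1" if KD: "K \<in> D" for K
      proof -
        obtain c d where cd: "K = {c..d}" using D(2)[OF KD] by (auto simp: cbox_interval)
        have "c < d" using D(2)[OF KD] by (auto simp: cd interior_atLeastAtMost_real)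
        moreover have "K \<subseteq> {- real k - 1..real k + 1}" using D(5) KD by (auto simp: cbox_interval)
        ultimately show ?thesis by (auto simp: cd)
      qed
      have fin: "emeasure ?\<mu> (\<Union>F) \<le> ennreal e" if F: "finite F" "F \<subseteq> D" for F
      proof -
        have int: "interior K = {Inf K<..<Sup K}" if "K \<in> F" for K
          by (metis K F(2) that subsetD interior_atLeastAtMost_real)
        have no: "nonoverlapping (- real k - 1) (real k + 1) F Inf Sup"
          unfolding nonoverlapping_def
        proof (intro conjI ballI impI)
          fix i j assume "i \<in> F" "j \<in> F" "i \<noteq> j"
          then have "interior i \<inter> interior j = {}"
            using D(3) F(2) by (auto simp: pairwise_def)
          then show "{Inf i<..<Sup i} \<inter> {Inf j<..<Sup j} = {}"
            using int[OF \<open>i \<in> F\<close>] int[OF \<open>j \<in> F\<close>] by simp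
        next
          fix i assume "i \<in> F" then show "- real k - 1 \<le> Inf i" "Inf i \<le> Sup i" "Sup i \<le> real k + 1"
            using K[of i] F(2) by auto
        qed (use F in auto)
        \<comment> \<open>The intervals may share endpoints. Their lengths are those of the
          interiors, which are disjoint and lie in U.\<close>
        have "ennreal (\<Sum>K\<in>F. Sup K - Inf K) = (\<Sum>K\<in>F. ennreal (Sup K - Inf K))"
          using K F(2) by (intro sum_ennreal[symmetric]) (auto simp: less_imp_le)
        also have "\<dots> = (\<Sum>K\<in>F. emeasure lborel {Inf K<..<Sup K})"
          using K F(2) by (intro sum.cong refl) (auto simp: less_imp_le)
        also have "\<dots> = emeasure lborel (\<Union>K\<in>F. {Inf K<..<Sup K})"
          using no F(1) by (intro sum_emeasure) (auto simp: disjoint_family_on_def nonoverlapping_def)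
        also have "\<dots> \<le> emeasure lborel U"
        proof (rule emeasure_mono)
          show "(\<Union>K\<in>F. {Inf K<..<Sup K}) \<subseteq> U"
          proof
            fix x assume "x \<in> (\<Union>K\<in>F. {Inf K<..<Sup K})"
            then obtain K where "K \<in> F" "x \<in> interior K" using int by auto
            then show "x \<in> U" using DU[of K] F(2) interior_subset[of K] by auto
          qed
        qed (use U(1) in auto)
        also have "\<dots> < ennreal \<delta>" by (rule mU)
        finally have "(\<Sum>K\<in>F. Sup K - Inf K) < \<delta>" using \<delta>(1) by (simp add: ennreal_less_iff sum_nonneg K less_imp_le subsetD[OF F(2)])
        then have "(\<Sum>K\<in>F. G (Sup K) - G (Inf K)) < e" by (rule \<delta>(2)[OF no])
        moreover have "emeasure ?\<mu> (\<Union>F) \<le> (\<Sum>K\<in>F. emeasure ?\<mu> K)"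
        proof -
          have "(\<lambda>K. K) ` F \<subseteq> sets ?\<mu>"
          proof
            fix A assume "A \<in> (\<lambda>K. K) ` F"
            then have "A = {Inf A..Sup A}" using K F(2) by auto
            then show "A \<in> sets ?\<mu>" by (metis atLeastAtMost_borel sets_interval_measure)
          qed
          from emeasure_subadditive_finite[OF F(1) this] show ?thesis by simp
        qed
        moreover have "(\<Sum>K\<in>F. emeasure ?\<mu> K) = ennreal (\<Sum>K\<in>F. G (Sup K) - G (Inf K))"
        proof -
          have "(\<Sum>K\<in>F. emeasure ?\<mu> K) = (\<Sum>K\<in>F. ennreal (G (Sup K) - G (Inf K)))"
          proof (rule sum.cong[OF refl])
            fix A assume "A \<in> F"
            then have "A = {Inf A..Sup A}" "Inf A \<le> Sup A" using K[of A] F(2) by auto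
            then show "emeasure ?\<mu> A = ennreal (G (Sup A) - G (Inf A))" using Icc by metis
          qed
          also have "\<dots> = ennreal (\<Sum>K\<in>F. G (Sup K) - G (Inf K))"
            using K F(2) mono by (intro sum_ennreal) (auto simp: less_imp_le monoD subset_iff)
          finally show ?thesis .
        qed
        ultimately show ?thesis by (metis ennreal_leI less_imp_le order_trans)
      qed
      show "emeasure ?\<mu> ?S \<le> ennreal e"
      proof (cases "D = {}")
        case True then show ?thesis using D(6) by simp
      next
        case False
        \<comment> \<open>\<open>from_nat_into\<close> enumerates a nonempty countable D, with
          repetitions if D is finite, so D is exhausted by an increasing sequence of finite
          unions.\<close>
        let ?A = "\<lambda>n. \<Union>(from_nat_into D ` {..n})"
        have sA: "?A n \<in> sets ?\<mu>" for n
        proof -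
          have "A \<in> sets ?\<mu>" if "A \<in> D" for A
            by (metis K that atLeastAtMost_borel sets_interval_measure)
          then show ?thesis using from_nat_into[OF False] by (intro sets.finite_Union) auto
        qed
        have "\<Union>D = (\<Union>n. ?A n)"
        proof
          show "\<Union>D \<subseteq> (\<Union>n. ?A n)"
          proof
            fix x assume "x \<in> \<Union>D"
            then obtain K where "K \<in> D" "x \<in> K" by blast
            then obtain n where "from_nat_into D n = K" using from_nat_into_surj[OF D(1)] by blast
            then show "x \<in> (\<Union>n. ?A n)" using \<open>x \<in> K\<close> by blast
          qed
          show "(\<Union>n. ?A n) \<subseteq> \<Union>D" using from_nat_into[OF False] by blast
        qed
        then have "emeasure ?\<mu> ?S \<le> emeasure ?\<mu> (\<Union>n. ?A n)"
          using D(6) sA by (intro emeasure_mono) auto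
        also have "\<dots> = (SUP n. emeasure ?\<mu> (?A n))"
          using sA by (intro SUP_emeasure_incseq[symmetric]) (auto simp: incseq_def intro: order_trans)
        also have "\<dots> \<le> ennreal e"
          using from_nat_into[OF False] by (intro SUP_least fin) auto
        finally show ?thesis .
      qed
    qed
    then have "emeasure ?\<mu> ?S \<le> 0 + ennreal e" if "0 < e" for e :: real
      using that by simp
    then have "emeasure ?\<mu> ?S \<le> 0"
      by (rule ennreal_le_epsilon)
    then show ?thesis by simp
  qed
  show ?thesis unfolding absolutely_continuous_def
  proof
    fix N :: "real set" assume N: "N \<in> null_sets lborel"
    have "N \<inter> {-real k..real k} \<in> null_sets ?\<mu>" for k
    proof (rule null_setsI[OF null[OF N]])
      have "N \<in> sets borel" using N by (auto dest: null_setsD2)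
      then show "N \<inter> {-real k..real k} \<in> sets ?\<mu>" by simp
    qed
    then have "(\<Union>k. N \<inter> {-real k..real k}) \<in> null_sets ?\<mu>" by (rule null_sets_UN)
    moreover have "(\<Union>k. N \<inter> {-real k..real k}) = N"
    proof -
      have "\<exists>k. -real k \<le> x \<and> x \<le> real k" for x
      proof -
        obtain k where "\<bar>x\<bar> \<le> real k" using real_arch_simple by blast
        then have "-real k \<le> x \<and> x \<le> real k" by linarith
        then show ?thesis ..
      qed
      then show ?thesis by auto
    qed
    ultimately show "N \<in> null_sets ?\<mu>" by simp
  qed
qed


text \<open>The density is the Radon-Nikodym derivative of the Stieltjes measure of G, after G is
  extended to the line by constants.\<close>

lemma mono_absolutely_continuous_has_integral:
  fixes G :: "real \<Rightarrow> real"
  assumes ab: "a \<le> b" and mono: "mono_on {a..b} G" and ac: "absolutely_continuous_on a b G"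
  obtains g where "\<And>s t. a \<le> s \<Longrightarrow> s \<le> t \<Longrightarrow> t \<le> b \<Longrightarrow> (g has_integral G t - G s) {s..t}"
    "\<And>t. (0::real) \<le> g t"
proof -
  \<comment> \<open>Clamping is monotone and does not increase lengths, so any family of intervals
    on the line becomes an admissible one in {a..b}.\<close>
  define cl where "cl t = max a (min b t)" for t
  define H where "H t = G (cl t)" for t
  have cl: "cl t \<in> {a..b}" "s \<le> t \<Longrightarrow> cl s \<le> cl t" "cl t - cl s \<le> t - s \<or> t < s" for s t
    using ab by (auto simp: cl_def)
  have H: "mono H" unfolding H_def using cl mono by (auto intro!: monoI simp: mono_on_def)
  have contH: "continuous_on UNIV H"
  proof -
    have "continuous_on {a..b} G"
      using absolutely_continuous_on_imp_uniformly_continuous_on[OF ac] uniformly_continuous_imp_continuous by blast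
    moreover have "continuous_on UNIV cl" unfolding cl_def by (intro continuous_intros)
    ultimately show ?thesis
      unfolding H_def using cl(1) by (auto intro: continuous_on_compose2)
  qed
  have "absolutely_continuous lborel (interval_measure H)"
  proof (rule mono_interval_measure_absolutely_continuous[OF H contH])
    fix e :: real assume "0 < e"
    from absolutely_continuous_onD[OF ac this]
    obtain \<delta> where \<delta>: "\<delta> > 0" "\<And>(I::real set set) l r. nonoverlapping a b I l r \<Longrightarrow> (\<Sum>i\<in>I. r i - l i) < \<delta> \<Longrightarrow>
           (\<Sum>i\<in>I. norm (G (r i) - G (l i))) < e" by blast
    have "(\<Sum>i\<in>I. H (r i) - H (l i)) < e" if no: "nonoverlapping u v I l r" and len: "(\<Sum>i\<in>I. r i - l i) < \<delta>"
      for I :: "real set set" and l r u v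
    proof -
      have "nonoverlapping a b I (\<lambda>i. cl (l i)) (\<lambda>i. cl (r i))"
        unfolding nonoverlapping_def
      proof (intro conjI ballI impI)
        fix i j assume "i \<in> I" "j \<in> I" "i \<noteq> j"
        then have "{l i<..<r i} \<inter> {l j<..<r j} = {}" using no by (auto simp: nonoverlapping_def)
        moreover have "{cl (l k)<..<cl (r k)} \<subseteq> {l k<..<r k}" for k
          by (auto simp: cl_def)
        ultimately show "{cl (l i)<..<cl (r i)} \<inter> {cl (l j)<..<cl (r j)} = {}" by blast
      next
        fix i assume "i \<in> I"
        then have "l i \<le> r i" using no by (auto simp: nonoverlapping_def)
        then show "cl (l i) \<le> cl (r i)" by (rule cl)
      qed (use no cl(1) in \<open>auto simp: nonoverlapping_def\<close>)
      moreover have "(\<Sum>i\<in>I. cl (r i) - cl (l i)) \<le> (\<Sum>i\<in>I. r i - l i)"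
      proof (rule sum_mono)
        fix i assume "i \<in> I"
        then have "l i \<le> r i" using no by (auto simp: nonoverlapping_def)
        then show "cl (r i) - cl (l i) \<le> r i - l i" using cl(3)[of "r i" "l i"] by auto
      qed
      ultimately have "(\<Sum>i\<in>I. norm (G (cl (r i)) - G (cl (l i)))) < e"
        using \<delta>(2)[of I "\<lambda>i. cl (l i)" "\<lambda>i. cl (r i)"] len by linarith
      moreover have "(\<Sum>i\<in>I. H (r i) - H (l i)) \<le> (\<Sum>i\<in>I. norm (G (cl (r i)) - G (cl (l i))))"
        by (intro sum_mono) (auto simp: H_def)
      ultimately show ?thesis by linarith
    qed
    then show "\<exists>\<delta>>0. \<forall>(I::real set set) l r u v. nonoverlapping u v I l r \<and> (\<Sum>i\<in>I. r i - l i) < \<delta> \<longrightarrow>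
           (\<Sum>i\<in>I. H (r i) - H (l i)) < e" using \<delta>(1) by blast
  qed
  then obtain f where f: "f \<in> borel_measurable lborel" "density lborel f = interval_measure H"
    using sigma_finite_measure.Radon_Nikodym[OF sigma_finite_lborel, of "interval_measure H"] by auto
  have nn: "(\<integral>\<^sup>+x. f x * indicator {s..t} x \<partial>lborel) = ennreal (H t - H s)" if "s \<le> t" for s t
  proof -
    have "emeasure (interval_measure H) {s..t} = ennreal (H t - H s)"
      using H contH that by (intro emeasure_interval_measure_Icc) (auto dest: monoD)
    moreover have "emeasure (density lborel f) {s..t} = (\<integral>\<^sup>+x. f x * indicator {s..t} x \<partial>lborel)"
      using f(1) by (intro emeasure_density) auto
    ultimately show ?thesis by (simp add: f(2))
  qed
  \<comment> \<open>The density may be infinite, but within {a..b} only on a null set, where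
    \<open>enn2real\<close> replaces it by 0.\<close>
  define g where "g x = enn2real (f x)" for x
  have gm: "g \<in> borel_measurable borel" using f(1) unfolding g_def by simp
  have fin: "AE x in lborel. f x * indicator {a..b} x \<noteq> \<infinity>"
    using nn[OF ab] f(1) by (intro nn_integral_PInf_AE) auto
  show thesis
  proof
    show "0 \<le> g t" for t by (simp add: g_def)
    fix s t assume st: "a \<le> s" "s \<le> t" "t \<le> b"
    have "(\<integral>\<^sup>+x. ennreal (g x * indicator {s..t} x) \<partial>lborel) = (\<integral>\<^sup>+x. f x * indicator {s..t} x \<partial>lborel)"
    proof (rule nn_integral_cong_AE)
      show "AE x in lborel. ennreal (g x * indicator {s..t} x) = f x * indicator {s..t} x"
        using fin
      proof eventually_elim
        case (elim x)
        show ?case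
        proof (cases "x \<in> {s..t}")
          case True
          then have "f x \<noteq> \<infinity>" using elim st by auto
          then show ?thesis using True by (simp add: g_def less_top)
        qed simp
      qed
    qed
    also have "\<dots> = ennreal (G t - G s)"
      using nn[OF st(2)] st by (simp add: H_def cl_def max_def min_def)
    finally have "((\<lambda>x. g x * indicator {s..t} x) has_integral G t - G s) UNIV"
    proof (intro nn_integral_has_integral)
      show "(\<lambda>x. g x * indicator {s..t} x) \<in> borel_measurable borel" using gm by simp
      show "0 \<le> G t - G s" using mono st by (simp add: mono_on_def)
    qed (simp_all add: g_def)
    moreover have "(\<lambda>x. g x * indicator {s..t} x) = (\<lambda>x. if x \<in> {s..t} then g x else 0)"
      by (auto simp: indicator_def)
    ultimately show "(g has_integral G t - G s) {s..t}"
      by (simp only: has_integral_restrict_UNIV)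
  qed
qed

section \<open>Total variation and densities of vector-valued functions\<close>

text \<open>The sequences are monotone but need not be strictly monotone: truncating one by
  \<open>min\<close> or \<open>max\<close> at a point c gives again a sequence of this kind with the
  same number of terms.\<close>

definition variation_sums :: "(real \<Rightarrow> 'a::real_normed_vector) \<Rightarrow> real \<Rightarrow> real \<Rightarrow> real set" where
  "variation_sums f a b = {(\<Sum>i<n. norm (f (x (Suc i)) - f (x i))) | n x. mono x \<and> range x \<subseteq> {a..b}}"

lemma variation_sumsI:
  "mono x \<Longrightarrow> (\<And>i. x i \<in> {a..b}) \<Longrightarrow> (\<Sum>i<n. norm (f (x (Suc i)) - f (x i))) \<in> variation_sums f a b"
  unfolding variation_sums_def by blast

text \<open>Truncation at c from above and from below produces the two partitions. Only the step
  that crosses c needs the triangle inequality; every other step is left unchanged by one truncation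
  and collapsed by the other.\<close>

lemma variation_sums_split:
  assumes v: "v \<in> variation_sums f a b" and c: "a \<le> c" "c \<le> b"
  obtains v1 v2 where "v1 \<in> variation_sums f a c" "v2 \<in> variation_sums f c b" "v \<le> v1 + v2"
proof -
  obtain n and x :: "nat \<Rightarrow> real" where x: "v = (\<Sum>i<n. norm (f (x (Suc i)) - f (x i)))" "mono x" "\<And>i. x i \<in> {a..b}"
    using v unfolding variation_sums_def by blast
  let ?y = "\<lambda>i. min (x i) c" and ?z = "\<lambda>i. max (x i) c"
  have "norm (f (x (Suc i)) - f (x i)) \<le> norm (f (?y (Suc i)) - f (?y i)) + norm (f (?z (Suc i)) - f (?z i))" for i
  proof -
    have "x i \<le> x (Suc i)" using x(2) by (simp add: monoD)
    then consider "x (Suc i) \<le> c" | "c \<le> x i" | "x i \<le> c" "c \<le> x (Suc i)" by linarith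
    then show ?thesis
    proof cases
      case 3
      then show ?thesis
        using norm_triangle_ineq[of "f c - f (x i)" "f (x (Suc i)) - f c"] by (simp add: min_def max_def)
    qed (use \<open>x i \<le> x (Suc i)\<close> in \<open>simp_all add: min_def max_def\<close>)
  qed
  then have "v \<le> (\<Sum>i<n. norm (f (?y (Suc i)) - f (?y i))) + (\<Sum>i<n. norm (f (?z (Suc i)) - f (?z i)))"
    unfolding x(1) sum.distrib[symmetric] by (intro sum_mono)
  moreover have "(\<Sum>i<n. norm (f (?y (Suc i)) - f (?y i))) \<in> variation_sums f a c"
  proof (rule variation_sumsI)
    show "mono ?y" using x(2) by (intro monoI min.mono) (auto dest: monoD)
  qed (use x(3) c in auto)
  moreover have "(\<Sum>i<n. norm (f (?z (Suc i)) - f (?z i))) \<in> variation_sums f c b"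
  proof (rule variation_sumsI)
    show "mono ?z" using x(2) by (intro monoI max.mono) (auto dest: monoD)
  qed (use x(3) c in \<open>auto simp: le_max_iff_disj\<close>)
  ultimately show thesis using that by blast
qed

text \<open>The partitions of the single intervals are merged into one family indexed by pairs. Its
  total length telescopes and does not exceed that of the original family, so the same \<delta>
  works.\<close>

lemma absolutely_continuous_on_variation_sums:
  fixes f :: "real \<Rightarrow> 'a::real_normed_vector"
  assumes ac: "absolutely_continuous_on a b f" and e: "0 < e"
  shows "\<exists>\<delta>>0. \<forall>(I::'i set) l r v. nonoverlapping a b I l r \<and> (\<Sum>i\<in>I. r i - l i) < \<delta> \<and>
           (\<forall>i\<in>I. v i \<in> variation_sums f (l i) (r i)) \<longrightarrow> (\<Sum>i\<in>I. v i) < e"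
proof -
  obtain \<delta> where \<delta>: "\<delta> > 0" "\<And>(I::('i \<times> nat) set) l r. nonoverlapping a b I l r \<Longrightarrow> (\<Sum>i\<in>I. r i - l i) < \<delta> \<Longrightarrow>
           (\<Sum>i\<in>I. norm (f (r i) - f (l i))) < e" using absolutely_continuous_onD[OF ac e] by blast
  have "(\<Sum>i\<in>I. v i) < e" if no: "nonoverlapping a b I l r" and len: "(\<Sum>i\<in>I. r i - l i) < \<delta>"
    and v: "\<forall>i\<in>I. v i \<in> variation_sums f (l i) (r i)" for I :: "'i set" and l r v
  proof -
    have "\<forall>i\<in>I. \<exists>n x. v i = (\<Sum>j<n. norm (f (x (Suc j)) - f (x j))) \<and> mono x \<and> (\<forall>j. x j \<in> {l i..r i})"
      using v unfolding variation_sums_def by blast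
    then obtain n where "\<forall>i\<in>I. \<exists>x. v i = (\<Sum>j<n i. norm (f (x (Suc j)) - f (x j))) \<and> mono x \<and> (\<forall>j. x j \<in> {l i..r i})"
      by (rule bchoice[THEN exE])
    then obtain x where "\<forall>i\<in>I. v i = (\<Sum>j<n i. norm (f (x i (Suc j)) - f (x i j))) \<and> mono (x i) \<and> (\<forall>j. x i j \<in> {l i..r i})"
      by (rule bchoice[THEN exE])
    then have nx: "\<And>i. i \<in> I \<Longrightarrow> v i = (\<Sum>j<n i. norm (f (x i (Suc j)) - f (x i j)))"
      "\<And>i. i \<in> I \<Longrightarrow> mono (x i)" "\<And>i j. i \<in> I \<Longrightarrow> l i \<le> x i j \<and> x i j \<le> r i"
      by auto
    let ?J = "Sigma I (\<lambda>i. {..<n i})"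
    let ?l = "\<lambda>(i,j). x i j" and ?r = "\<lambda>(i,j). x i (Suc j)"
    have finI: "finite I" and I: "\<And>i. i \<in> I \<Longrightarrow> a \<le> l i \<and> l i \<le> r i \<and> r i \<le> b"
      and I2: "\<And>i j. i \<in> I \<Longrightarrow> j \<in> I \<Longrightarrow> i \<noteq> j \<Longrightarrow> {l i<..<r i} \<inter> {l j<..<r j} = {}"
      using no by (auto simp: nonoverlapping_def)
    have no': "nonoverlapping a b ?J ?l ?r"
      unfolding nonoverlapping_def
    proof (intro conjI ballI impI)
      show "finite ?J" using finI by auto
    next
      fix p assume "p \<in> ?J"
      then obtain i j where p: "p = (i,j)" "i \<in> I" by auto
      show "a \<le> ?l p" "?l p \<le> ?r p" "?r p \<le> b"
        using I[OF p(2)] nx(2,3)[OF p(2)] by (auto simp: p(1) mono_def intro: order_trans)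
    next
      fix p q assume "p \<in> ?J" "q \<in> ?J" "p \<noteq> q"
      then obtain i j k m where p: "p = (i,j)" "i \<in> I" and q: "q = (k,m)" "k \<in> I" and ne: "i \<noteq> k \<or> j \<noteq> m" by auto
      show "{?l p<..<?r p} \<inter> {?l q<..<?r q} = {}"
      proof (cases "i = k")
        case False
        have "{?l p<..<?r p} \<subseteq> {l i<..<r i}" "{?l q<..<?r q} \<subseteq> {l k<..<r k}"
          using nx(3)[OF p(2), of j] nx(3)[OF p(2), of "Suc j"] nx(3)[OF q(2), of m] nx(3)[OF q(2), of "Suc m"]
          by (auto simp: p(1) q(1))
        then show ?thesis using I2[OF p(2) q(2) False] by blast
      next
        case True
        then have "j < m \<or> m < j" using ne by auto
        then have "x i (Suc j) \<le> x i m \<or> x i (Suc m) \<le> x i j"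
          using nx(2)[OF p(2)] by (meson Suc_leI monoD)
        then show ?thesis using True by (auto simp: p(1) q(1))
      qed
    qed
    have "(\<Sum>p\<in>?J. ?r p - ?l p) = (\<Sum>i\<in>I. \<Sum>j<n i. x i (Suc j) - x i j)"
      using finI by (subst sum.Sigma) (auto simp: case_prod_beta)
    also have "\<dots> = (\<Sum>i\<in>I. x i (n i) - x i 0)"
      by (simp add: sum_lessThan_telescope)
    also have "\<dots> \<le> (\<Sum>i\<in>I. r i - l i)"
      using nx(3) by (intro sum_mono diff_mono) auto
    finally have len': "(\<Sum>p\<in>?J. ?r p - ?l p) < \<delta>" using len by linarith
    have "(\<Sum>i\<in>I. v i) = (\<Sum>i\<in>I. \<Sum>j<n i. norm (f (x i (Suc j)) - f (x i j)))"
      using nx(1) by simp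
    also have "\<dots> = (\<Sum>p\<in>?J. norm (f (?r p) - f (?l p)))"
      using finI by (subst sum.Sigma) (auto simp: case_prod_beta)
    also have "\<dots> < e" by (rule \<delta>(2)[OF no' len'])
    finally show ?thesis .
  qed
  with \<delta>(1) show ?thesis by blast
qed


text \<open>On pieces shorter than \<delta> all variation sums stay below 1. Finitely many pieces of
  length \<delta>/2 reach from a to b.\<close>

lemma bdd_above_variation_sums:
  fixes f :: "real \<Rightarrow> 'a::real_normed_vector"
  assumes ab: "a \<le> b" and ac: "absolutely_continuous_on a b f"
  shows "bdd_above (variation_sums f a b)"
proof -
  obtain \<delta> where \<delta>: "\<delta> > 0" "\<And>(I::unit set) l r v. nonoverlapping a b I l r \<and> (\<Sum>i\<in>I. r i - l i) < \<delta> \<and>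
           (\<forall>i\<in>I. v i \<in> variation_sums f (l i) (r i)) \<Longrightarrow> (\<Sum>i\<in>I. v i) < 1"
    using absolutely_continuous_on_variation_sums[OF ac zero_less_one] by blast
  have small: "v < 1" if "a \<le> s" "s \<le> t" "t \<le> b" "t - s < \<delta>" "v \<in> variation_sums f s t" for s t v
    using \<delta>(2)[of "{()}" "\<lambda>_. s" "\<lambda>_. t" "\<lambda>_. v"] that by (simp add: nonoverlapping_def)
  have bound: "v \<le> real n + 1" if "c \<in> {a..b}" "c - a \<le> real n * (\<delta>/2)" "v \<in> variation_sums f a c" for n c v
    using that
  proof (induction n arbitrary: c v)
    case 0
    then show ?case using small[of a c v] \<delta>(1) by simp
  next
    case (Suc n)
    \<comment> \<open>One piece is split off at the right end. The half of \<delta> keeps its length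
      strictly below \<delta>.\<close>
    define c' where "c' = max a (c - \<delta>/2)"
    have c': "a \<le> c'" "c' \<le> c" "c - c' < \<delta>" "c' - a \<le> real n * (\<delta>/2)"
    proof -
      have "0 \<le> real n * (\<delta>/2)" using \<delta>(1) by simp
      then show "c' - a \<le> real n * (\<delta>/2)"
        using Suc.prems(2) by (simp add: c'_def max_def algebra_simps)
    qed (use Suc.prems(1) \<delta>(1) in \<open>auto simp: c'_def\<close>)
    obtain v1 v2 where "v1 \<in> variation_sums f a c'" "v2 \<in> variation_sums f c' c" "v \<le> v1 + v2"
      using variation_sums_split[OF Suc.prems(3) c'(1,2)] .
    then show ?case
      using Suc.IH[of c' v1] small[of c' c v2] c' Suc.prems(1) by auto
  qed
  obtain n where "(b - a) / (\<delta>/2) \<le> real n" using real_arch_simple by blast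
  then have "b - a \<le> real n * (\<delta>/2)" using \<delta>(1) by (simp add: field_simps)
  then show ?thesis using bound[of b n] ab by (auto simp: bdd_above_def)
qed

text \<open>V is the total variation on {a..t}. Appending the point t to a partition of {a..s}
  bounds its increments from below; a nearly optimal partition of {a..r}, split at l, bounds them
  from above by a variation sum on {l..r}, and the refined family then gives absolute
  continuity.\<close>

lemma absolutely_continuous_on_variation:
  fixes f :: "real \<Rightarrow> 'a::real_normed_vector"
  assumes ab: "a \<le> b" and ac: "absolutely_continuous_on a b f"
  obtains V :: "real \<Rightarrow> real" where "absolutely_continuous_on a b V"
    "\<And>s t. a \<le> s \<Longrightarrow> s \<le> t \<Longrightarrow> t \<le> b \<Longrightarrow> norm (f t - f s) \<le> V t - V s"
proof
  define V where "V t = Sup (variation_sums f a t)" for t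
  have bdd: "bdd_above (variation_sums f a t)" if "t \<le> b" for t
  proof (rule bdd_above_mono[OF bdd_above_variation_sums[OF ab ac]])
    show "variation_sums f a t \<subseteq> variation_sums f a b"
    proof -
      have "{a..t} \<subseteq> {a..b}" using that by auto
      then show ?thesis unfolding variation_sums_def by blast
    qed
  qed
  have ne: "variation_sums f a t \<noteq> {}" if "a \<le> t" for t
    using variation_sumsI[of "\<lambda>_. a" a t f 0] that by (auto simp: mono_def)
  show inc: "norm (f t - f s) \<le> V t - V s" if st: "a \<le> s" "s \<le> t" "t \<le> b" for s t
  proof -
    have "V s \<le> V t - norm (f t - f s)" unfolding V_def[of s]
    proof (rule cSup_least[OF ne[OF st(1)]])
      fix v assume "v \<in> variation_sums f a s"
      then obtain n and x :: "nat \<Rightarrow> real" where x: "v = (\<Sum>i<n. norm (f (x (Suc i)) - f (x i)))" "mono x" "\<And>i. a \<le> x i \<and> x i \<le> s"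
        unfolding variation_sums_def by (auto simp: subset_iff)
      \<comment> \<open>The entries of x after index n are discarded and replaced by s and then t.
        The jump to s can only increase the sum, and the jump from s to t contributes the required
        increment.\<close>
      define y where "y i = (if i \<le> n then x i else if i = Suc n then s else t)" for i
      have "mono y"
        unfolding mono_iff_le_Suc
      proof
        fix i
        show "y i \<le> y (Suc i)"
          using x(2,3) st unfolding y_def mono_iff_le_Suc by (cases "i < n"; cases "i = n") auto
      qed
      moreover have "y i \<in> {a..t}" for i
        using x(3)[of i] st by (auto simp: y_def)
      ultimately have "(\<Sum>i<Suc (Suc n). norm (f (y (Suc i)) - f (y i))) \<in> variation_sums f a t"
        by (rule variation_sumsI)
      then have "(\<Sum>i<Suc (Suc n). norm (f (y (Suc i)) - f (y i))) \<le> V t"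
        unfolding V_def by (rule cSup_upper[OF _ bdd[OF st(3)]])
      moreover have "(\<Sum>i<n. norm (f (y (Suc i)) - f (y i))) = v"
        unfolding x(1) by (intro sum.cong) (auto simp: y_def)
      moreover have "y (Suc (Suc n)) = t" "y (Suc n) = s" by (auto simp: y_def)
      ultimately show "v \<le> V t - norm (f t - f s)"
        by (auto simp: intro: order_trans) (smt (verit) norm_ge_zero)
    qed
    then show ?thesis by simp
  qed
  show "absolutely_continuous_on a b V"
  proof (rule absolutely_continuous_onI)
    fix e :: real assume "0 < e"
    then have e: "0 < e/2" by simp
    obtain \<delta> where \<delta>: "\<delta> > 0" "\<And>(I::real set set) l r v. nonoverlapping a b I l r \<and> (\<Sum>i\<in>I. r i - l i) < \<delta> \<and>
           (\<forall>i\<in>I. v i \<in> variation_sums f (l i) (r i)) \<Longrightarrow> (\<Sum>i\<in>I. v i) < e/2"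
      using absolutely_continuous_on_variation_sums[OF ac e] by blast
    have "(\<Sum>i\<in>I. norm (V (r i) - V (l i))) < e"
      if no: "nonoverlapping a b I l r" and len: "(\<Sum>i\<in>I. r i - l i) < \<delta>" for I :: "real set set" and l r
    proof -
      \<comment> \<open>The error of the nearly optimal partitions is spread evenly over the family;
        the summand 1 covers the empty family.\<close>
      define \<eta> where "\<eta> = e/2 / (real (card I) + 1)"
      have \<eta>: "\<eta> > 0" using e by (simp add: \<eta>_def)
      have I: "a \<le> l i \<and> l i \<le> r i \<and> r i \<le> b" if "i \<in> I" for i using no that by (auto simp: nonoverlapping_def)
      have "\<exists>v. v \<in> variation_sums f (l i) (r i) \<and> norm (V (r i) - V (l i)) \<le> v + \<eta>" if i: "i \<in> I" for i
      proof -
        have lr: "a \<le> l i" "l i \<le> r i" "r i \<le> b" "a \<le> r i" "l i \<le> b" using I[OF i] by auto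
        have "V (r i) - \<eta> < V (r i)" using \<eta> by simp
        then obtain w where w: "w \<in> variation_sums f a (r i)" "V (r i) - \<eta> < w"
          unfolding V_def using less_cSup_iff[OF ne[OF lr(4)] bdd[OF lr(3)]] by auto
        obtain v1 v2 where v: "v1 \<in> variation_sums f a (l i)" "v2 \<in> variation_sums f (l i) (r i)" "w \<le> v1 + v2"
          using variation_sums_split[OF w(1) lr(1,2)] .
        have "v1 \<le> V (l i)" unfolding V_def by (rule cSup_upper[OF v(1) bdd[OF lr(5)]])
        moreover have "V (r i) - V (l i) \<ge> 0" using inc[OF lr(1-3)] norm_ge_zero order_trans by blast
        ultimately have "norm (V (r i) - V (l i)) \<le> v2 + \<eta>" using w(2) v(3) by simp
        then show ?thesis using v(2) by blast
      qed
      then obtain v where v: "\<And>i. i \<in> I \<Longrightarrow> v i \<in> variation_sums f (l i) (r i)"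
        "\<And>i. i \<in> I \<Longrightarrow> norm (V (r i) - V (l i)) \<le> v i + \<eta>" by metis
      have "(\<Sum>i\<in>I. norm (V (r i) - V (l i))) \<le> (\<Sum>i\<in>I. v i + \<eta>)" by (intro sum_mono v(2))
      also have "\<dots> = (\<Sum>i\<in>I. v i) + real (card I) * \<eta>" by (simp add: sum.distrib)
      also have "(\<Sum>i\<in>I. v i) < e/2" using \<delta>(2)[of I l r v] no len v(1) by blast
      also have "real (card I) * \<eta> \<le> e/2" using e by (simp add: \<eta>_def field_simps)
      finally show ?thesis by simp
    qed
    with \<delta>(1) show "\<exists>\<delta>>0. \<forall>(I::real set set) l r. nonoverlapping a b I l r \<and> (\<Sum>i\<in>I. r i - l i) < \<delta> \<longrightarrow>
        (\<Sum>i\<in>I. norm (V (r i) - V (l i))) < e" by blast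
  qed
qed

text \<open>Jordan decomposition in coordinates: V and \<open>V t - f t \<bullet> i\<close> are both
  monotone and absolutely continuous, and the difference of their nonnegative densities is a density
  for the i-th coordinate of f.\<close>

lemma absolutely_continuous_on_has_integral:
  fixes f :: "real \<Rightarrow> 'a::euclidean_space"
  assumes ab: "a \<le> b" and ac: "absolutely_continuous_on a b f"
  obtains g where "g absolutely_integrable_on {a..b}"
    "\<And>s t. a \<le> s \<Longrightarrow> s \<le> t \<Longrightarrow> t \<le> b \<Longrightarrow> (g has_integral f t - f s) {s..t}"
proof -
  obtain V :: "real \<Rightarrow> real" where V: "absolutely_continuous_on a b V"
    "\<And>s t. a \<le> s \<Longrightarrow> s \<le> t \<Longrightarrow> t \<le> b \<Longrightarrow> norm (f t - f s) \<le> V t - V s"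
    using absolutely_continuous_on_variation[OF ab ac] by blast
  have "V s \<le> V t" if "a \<le> s" "s \<le> t" "t \<le> b" for s t
    using V(2)[OF that] norm_ge_zero[of "f t - f s"] by linarith
  then have monoV: "mono_on {a..b} V" by (auto simp: mono_on_def)
  obtain g1 where g1: "\<And>s t. a \<le> s \<Longrightarrow> s \<le> t \<Longrightarrow> t \<le> b \<Longrightarrow> (g1 has_integral V t - V s) {s..t}" "\<And>t. (0::real) \<le> g1 t"
    using mono_absolutely_continuous_has_integral[OF ab monoV V(1)] by blast
  have "\<exists>g2. (\<forall>s t. a \<le> s \<and> s \<le> t \<and> t \<le> b \<longrightarrow> (g2 has_integral (V t - f t \<bullet> i) - (V s - f s \<bullet> i)) {s..t}) \<and>
    (\<forall>t. (0::real) \<le> g2 t)" if i: "i \<in> Basis" for i :: 'a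
  proof -
    have comp: "norm (- (f t \<bullet> i) - - (f s \<bullet> i)) \<le> norm (f t - f s)" for s t
      using Basis_le_norm[OF i, of "f s - f t"] by (simp add: inner_diff_left norm_minus_commute)
    have "absolutely_continuous_on a b (\<lambda>t. - (f t \<bullet> i))"
      using absolutely_continuous_on_le[OF ac comp] .
    from absolutely_continuous_on_add[OF V(1) this]
    have ac2: "absolutely_continuous_on a b (\<lambda>t. V t - f t \<bullet> i)" by simp
    have mono2: "mono_on {a..b} (\<lambda>t. V t - f t \<bullet> i)"
    proof (rule mono_onI)
      fix s t assume "s \<in> {a..b}" "t \<in> {a..b}" "s \<le> t"
      then show "V s - f s \<bullet> i \<le> V t - f t \<bullet> i" using V(2)[of s t] comp[of t s] by simp
    qed
    show ?thesis using mono_absolutely_continuous_has_integral[OF ab mono2 ac2] by metis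
  qed
  then obtain g2 where g2: "\<And>i s t. i \<in> Basis \<Longrightarrow> a \<le> s \<Longrightarrow> s \<le> t \<Longrightarrow> t \<le> b \<Longrightarrow>
     (g2 i has_integral (V t - f t \<bullet> i) - (V s - f s \<bullet> i)) {s..t}"
    "\<And>i t. i \<in> Basis \<Longrightarrow> (0::real) \<le> g2 i t" by metis
  define g where "g t = (\<Sum>i\<in>Basis. (g1 t - g2 i t) *\<^sub>R i)" for t
  have gi: "g t \<bullet> i = g1 t - g2 i t" if "i \<in> Basis" for i t
    using that by (simp add: g_def inner_sum_left_Basis)
  show thesis
  proof
    show "(g has_integral f t - f s) {s..t}" if st: "a \<le> s" "s \<le> t" "t \<le> b" for s t
    proof (subst has_integral_componentwise_iff, rule ballI)
      fix i :: 'a assume i: "i \<in> Basis"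
      show "((\<lambda>x. g x \<bullet> i) has_integral (f t - f s) \<bullet> i) {s..t}"
        using has_integral_diff[OF g1(1)[OF st] g2(1)[OF i st]]
        by (simp add: gi[OF i] inner_diff_left)
    qed
    show "g absolutely_integrable_on {a..b}"
    proof (subst absolutely_integrable_componentwise_iff, rule ballI)
      fix i :: 'a assume i: "i \<in> Basis"
      have "g1 absolutely_integrable_on {a..b}"
        using g1(1)[of a b] ab g1(2) by (intro nonnegative_absolutely_integrable_1) (auto simp: integrable_on_def)
      moreover have "g2 i absolutely_integrable_on {a..b}"
        using g2(1)[OF i, of a b] ab g2(2)[OF i] by (intro nonnegative_absolutely_integrable_1) (auto simp: integrable_on_def)
      ultimately show "(\<lambda>t. g t \<bullet> i) absolutely_integrable_on {a..b}"
        unfolding gi[OF i] by (rule set_integral_diff)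
    qed
  qed
qed

section \<open>The fundamental theorem of calculus for absolutely continuous functions\<close>

lemma AE_lebesgue_on_iff_negligible:
  assumes "S \<in> sets lebesgue"
  shows "(AE t in lebesgue_on S. P t) \<longleftrightarrow> (\<exists>N. negligible N \<and> (\<forall>t\<in>S - N. P t))"
proof -
  have "(AE t in lebesgue_on S. P t) \<longleftrightarrow> (AE t in lebesgue. t \<in> S \<longrightarrow> P t)"
    using assms by (subst AE_restrict_space_iff) auto
  also have "\<dots> \<longleftrightarrow> (\<exists>N. negligible N \<and> (\<forall>t\<in>S - N. P t))"
  proof
    assume "AE t in lebesgue. t \<in> S \<longrightarrow> P t"
    then obtain N where "{t\<in>space lebesgue. \<not> (t \<in> S \<longrightarrow> P t)} \<subseteq> N" "N \<in> null_sets lebesgue"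
      by (auto elim!: AE_E simp: null_sets_def)
    then show "\<exists>N. negligible N \<and> (\<forall>t\<in>S - N. P t)"
      by (intro exI[of _ N]) (auto simp: negligible_iff_null_sets)
  next
    assume "\<exists>N. negligible N \<and> (\<forall>t\<in>S - N. P t)"
    then obtain N where "negligible N" "\<forall>t\<in>S - N. P t" by blast
    then show "AE t in lebesgue. t \<in> S \<longrightarrow> P t"
      by (intro AE_I'[of N]) (auto simp: negligible_iff_null_sets)
  qed
  finally show ?thesis .
qed

text \<open>The function u is a constant plus the integral of its density, so Lebesgue
  differentiation identifies the density with \<open>weak_deriv\<close> almost everywhere.
  Positivity of T makes derivatives within the interval unique, also at its endpoints.\<close>

theorem absolutely_continuous_on_FTC:
  fixes u :: "real \<Rightarrow> 'a::euclidean_space"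
  assumes T: "0 < T" and ac: "absolutely_continuous_on 0 T u"
  shows "AE t in lebesgue_on {0..T}. (u has_vector_derivative weak_deriv T u t) (at t within {0..T})"
    and "weak_deriv T u absolutely_integrable_on {0..T}"
    and "\<And>s t. 0 \<le> s \<Longrightarrow> s \<le> t \<Longrightarrow> t \<le> T \<Longrightarrow> (weak_deriv T u has_integral u t - u s) {s..t}"
proof -
  obtain g where g: "g absolutely_integrable_on {0..T}"
    "\<And>s t. 0 \<le> s \<Longrightarrow> s \<le> t \<Longrightarrow> t \<le> T \<Longrightarrow> (g has_integral u t - u s) {s..t}"
    using absolutely_continuous_on_has_integral[OF _ ac] T by auto
  obtain N where N: "negligible N"
    "\<And>t. t \<in> {0..T} - N \<Longrightarrow> ((\<lambda>u. integral {0..u} g) has_vector_derivative g t) (at t within {0..T})"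
    using integral_has_vector_derivative_AE[of g 0 T] g(1) by (auto simp: absolutely_integrable_on_def)
  have D: "(u has_vector_derivative g t) (at t within {0..T})" if t: "t \<in> {0..T} - N" for t
  proof (rule has_vector_derivative_transform)
    show "((\<lambda>t. integral {0..t} g + u 0) has_vector_derivative g t) (at t within {0..T})"
      using has_vector_derivative_add[OF N(2)[OF t] has_vector_derivative_const] by simp
    show "x \<in> {0..T} \<Longrightarrow> u x = integral {0..x} g + u 0" for x
      using integral_unique[OF g(2)[of 0 x]] by simp
  qed (use t in auto)
  have eq: "weak_deriv T u t = g t" if t: "t \<in> {0..T} - N" for t
    using D[OF t] T t by (intro vector_derivative_within_cbox[of 0 T, unfolded cbox_interval]) auto
  show "AE t in lebesgue_on {0..T}. (u has_vector_derivative weak_deriv T u t) (at t within {0..T})"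
    using N(1) D eq by (subst AE_lebesgue_on_iff_negligible) auto
  show "weak_deriv T u absolutely_integrable_on {0..T}"
    using absolutely_integrable_spike[OF g(1) N(1)] eq by auto
  show "(weak_deriv T u has_integral u t - u s) {s..t}" if "0 \<le> s" "s \<le> t" "t \<le> T" for s t
    using has_integral_spike[OF N(1) _ g(2)[OF that]] eq that by auto
qed

lemma division_sum_integral_le:
  fixes h :: "real \<Rightarrow> real"
  assumes d: "d division_of s" "s \<subseteq> {a..b}" and h: "h integrable_on {a..b}" "\<And>t. t \<in> {a..b} \<Longrightarrow> 0 \<le> h t"
  shows "(\<Sum>k\<in>d. integral k h) \<le> integral {a..b} h"
proof -
  have "h integrable_on k" if k: "k \<in> d" for k
  proof -
    obtain u v where "k = {u..v}" using division_ofD(4)[OF d(1) k] by (auto simp: cbox_interval)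
    moreover have "k \<subseteq> {a..b}" using division_ofD(2)[OF d(1) k] d(2) by auto
    ultimately show ?thesis using integrable_on_subinterval[OF h(1)] by auto
  qed
  then have "(h has_integral (\<Sum>k\<in>d. integral k h)) s"
    by (intro has_integral_combine_division[OF d(1)]) (auto intro: integrable_integral)
  then show ?thesis
    using h d(2) by (intro has_integral_subset_le[of s "{a..b}" h]) (auto intro: integrable_integral)
qed

text \<open>The integrand is at most n plus the excess \<open>h n\<close> of its norm over the level
  n. The excess has small integral for large n by dominated convergence, and the level n contributes
  n times the total length.\<close>

theorem absolutely_continuous_on_integral:
  fixes g :: "real \<Rightarrow> 'a::euclidean_space"
  assumes g: "g absolutely_integrable_on {a..b}"
  shows "absolutely_continuous_on a b (\<lambda>t. integral {a..t} g)"
  unfolding absolutely_continuous_on_def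
proof (intro allI impI)
  fix e :: real assume e: "0 < e"
  define h where "h n t = norm (g t) - min (norm (g t)) (real n)" for n :: nat and t
  have ng: "(\<lambda>t. norm (g t)) absolutely_integrable_on {a..b}"
    using g by (intro nonnegative_absolutely_integrable_1) (auto simp: absolutely_integrable_on_def)
  have h0: "0 \<le> h n t" "h n t \<le> norm (g t)" for n t by (auto simp: h_def)
  have hi: "h n integrable_on {a..b}" for n
    unfolding h_def
    by (rule set_lebesgue_integral_eq_integral(1), intro set_integral_diff absolutely_integrable_min_1 ng)
       (auto intro: absolutely_integrable_continuous_real continuous_intros)
  have "(\<lambda>n. integral {a..b} (h n)) \<longlonglongrightarrow> integral {a..b} (\<lambda>t. 0)"
  proof (rule dominated_convergence(2))
    show "(\<lambda>t. norm (g t)) integrable_on {a..b}" using ng by (simp add: absolutely_integrable_on_def)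
    show "norm (h n t) \<le> norm (g t)" for n t using h0 by simp
    show "(\<lambda>n. h n t) \<longlonglongrightarrow> 0" for t
    proof (rule tendsto_eventually)
      obtain m where "norm (g t) \<le> real m" using real_arch_simple by blast
      then show "eventually (\<lambda>n. h n t = 0) sequentially"
        by (auto simp: h_def eventually_sequentially intro!: exI[of _ m])
    qed
  qed (rule hi)
  then have "eventually (\<lambda>n. integral {a..b} (h n) < e/2) sequentially"
    using e by (intro order_tendstoD(2)) auto
  then obtain n where n: "integral {a..b} (h n) < e/2"
    unfolding eventually_sequentially by blast
  show "\<exists>\<delta>>0. \<forall>d s. d division_of s \<and> s \<subseteq> {a..b} \<and> (\<Sum>k\<in>d. Sup k - Inf k) < \<delta> \<longrightarrow>
    (\<Sum>k\<in>d. norm (integral {a..Sup k} g - integral {a..Inf k} g)) < e"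
  \<comment> \<open>Half of e is reserved for the excess; the summand 1 allows n to be 0.\<close>
  proof (intro exI[of _ "e / (2 * (real n + 1))"] conjI allI impI)
    show "0 < e / (2 * (real n + 1))" using e by simp
    fix d s assume ds: "d division_of s \<and> s \<subseteq> {a..b} \<and> (\<Sum>k\<in>d. Sup k - Inf k) < e / (2 * (real n + 1))"
    have *: "norm (integral {a..Sup k} g - integral {a..Inf k} g) \<le> real n * (Sup k - Inf k) + integral k (h n)"
      if kd: "k \<in> d" for k
    proof -
      have k: "k = {Inf k..Sup k}" "a \<le> Inf k" "Inf k \<le> Sup k" "Sup k \<le> b"
        using nonoverlapping_division[of d s a b] ds kd by (auto simp: nonoverlapping_def)
      define l r where "l = Inf k" and "r = Sup k"
      have lr: "k = {l..r}" "a \<le> l" "l \<le> r" "r \<le> b" using k by (simp_all add: l_def r_def)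
      have gi: "g integrable_on {a..r}" "g integrable_on {l..r}"
        using integrable_on_subinterval[of g "{a..b}"] g lr by (auto simp: absolutely_integrable_on_def)
      have hlr: "h n integrable_on {l..r}" using integrable_on_subinterval[OF hi] lr by auto
      have "integral {a..r} g - integral {a..l} g = integral {l..r} g"
        using Henstock_Kurzweil_Integration.integral_combine[OF lr(2,3) gi(1)] by (simp add: algebra_simps)
      moreover have "norm (integral {l..r} g) \<le> integral {l..r} (\<lambda>t. real n + h n t)"
      proof (rule integral_norm_bound_integral[OF gi(2)])
        show "(\<lambda>t. real n + h n t) integrable_on {l..r}"
          by (intro integrable_add integrable_const_ivl hlr)
        show "norm (g t) \<le> real n + h n t" for t by (simp add: h_def)
      qed
      moreover have "integral {l..r} (\<lambda>t. real n + h n t) = real n * (r - l) + integral {l..r} (h n)"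
        using Henstock_Kurzweil_Integration.integral_add[OF integrable_const_ivl[of "real n" l r] hlr] lr(3)
        by (simp add: mult.commute)
      ultimately have "norm (integral {a..r} g - integral {a..l} g) \<le> real n * (r - l) + integral {l..r} (h n)"
        by simp
      then show ?thesis unfolding lr(1)[symmetric] by (simp only: l_def r_def)
    qed
    have "(\<Sum>k\<in>d. norm (integral {a..Sup k} g - integral {a..Inf k} g))
      \<le> (\<Sum>k\<in>d. real n * (Sup k - Inf k) + integral k (h n))" by (intro sum_mono *)
    also have "\<dots> = real n * (\<Sum>k\<in>d. Sup k - Inf k) + (\<Sum>k\<in>d. integral k (h n))"
      by (simp add: sum.distrib sum_distrib_left)
    also have "(\<Sum>k\<in>d. integral k (h n)) \<le> integral {a..b} (h n)"
      using ds hi h0 by (intro division_sum_integral_le) auto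
    also have "real n * (\<Sum>k\<in>d. Sup k - Inf k) \<le> real n * (e / (2 * (real n + 1)))"
      using ds by (intro mult_left_mono) auto
    also have "\<dots> \<le> e / 2" using e by (simp add: field_simps)
    finally show "(\<Sum>k\<in>d. norm (integral {a..Sup k} g - integral {a..Inf k} g)) < e" using n by simp
  qed
qed


section \<open>Convex functions satisfying the \<open>\<Delta>\<^sub>2\<close>-condition\<close>

text \<open>Riesz representation in coordinates, together with uniqueness of the derivative,
  justifies the definite description in \<open>grad\<close>.\<close>

lemma differentiable_imp_GDERIV:
  fixes f :: "'a::euclidean_space \<Rightarrow> real"
  assumes "f differentiable (at x)"
  shows "GDERIV f x :> grad f x"
proof -
  obtain L where L: "(f has_derivative L) (at x)" using assms unfolding differentiable_def by blast
  then have lin: "linear L" by (rule has_derivative_linear)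
  define D where "D = (\<Sum>b\<in>Basis. L b *\<^sub>R b)"
  have "L h = h \<bullet> D" for h
  proof -
    have "L h = L (\<Sum>b\<in>Basis. (h \<bullet> b) *\<^sub>R b)" by (simp add: euclidean_representation)
    also have "\<dots> = (\<Sum>b\<in>Basis. (h \<bullet> b) * L b)" using lin by (simp add: linear_sum linear_scale)
    also have "\<dots> = h \<bullet> D" by (simp add: D_def inner_sum_right mult.commute)
    finally show ?thesis .
  qed
  then have "L = (\<lambda>h. h \<bullet> D)" by blast
  then have D: "GDERIV f x :> D" using L unfolding gderiv_def by simp
  have uniq: "D' = D" if "GDERIV f x :> D'" for D'
  proof -
    have "(\<lambda>h. h \<bullet> D') = (\<lambda>h. h \<bullet> D)"
      using D that has_derivative_unique unfolding gderiv_def by blast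
    then show ?thesis by (metis vector_eq_ldot)
  qed
  then show ?thesis unfolding grad_def by (metis D theI)
qed

lemma GDERIV_directional:
  fixes f :: "'a::real_inner \<Rightarrow> real"
  assumes "GDERIV f x :> D"
  shows "((\<lambda>l. (f (x + l *\<^sub>R v) - f x) / l) \<longlongrightarrow> D \<bullet> v) (at_right 0)"
proof -
  have "((\<lambda>l. x + l *\<^sub>R v) has_derivative (\<lambda>l. l *\<^sub>R v)) (at 0)"
    by (auto intro!: derivative_eq_intros)
  moreover have "(f has_derivative (\<lambda>h. h \<bullet> D)) (at (x + 0 *\<^sub>R v))"
    using assms by (simp add: gderiv_def)
  ultimately have D: "((\<lambda>l. f (x + l *\<^sub>R v)) has_derivative (\<lambda>l. (l *\<^sub>R v) \<bullet> D)) (at 0)"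
    by (rule has_derivative_compose)
  moreover have "(\<lambda>l. (l *\<^sub>R v) \<bullet> D) = (*) (D \<bullet> v)"
    by (auto simp: inner_commute)
  ultimately have "((\<lambda>l. f (x + l *\<^sub>R v)) has_field_derivative (D \<bullet> v)) (at 0)"
    using D unfolding has_field_derivative_def by simp
  then have "((\<lambda>l. (f (x + l *\<^sub>R v) - f x) / l) \<longlongrightarrow> D \<bullet> v) (at 0)"
    unfolding has_field_derivative_iff by simp
  then show ?thesis by (rule tendsto_within_subset) simp
qed

locale Delta2_function =
  fixes \<phi> :: "'a::euclidean_space \<Rightarrow> real"
  assumes differentiable: "\<And>x. \<phi> differentiable (at x)"
    and strict: "strictly_convex \<phi>"
    and G_function: "G_function (\<lambda>x. ereal (\<phi> x))"
    and Delta2: "Delta2 (\<lambda>x. ereal (\<phi> x))"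
    and Delta2_conjugate: "Delta2 (conjugate (\<lambda>x. ereal (\<phi> x)))"
begin

lemma nonneg: "0 \<le> \<phi> x" and zero: "\<phi> 0 = 0" and even: "\<phi> (- x) = \<phi> x"
  using G_function unfolding G_function_def by auto

lemma convex: "0 \<le> s \<Longrightarrow> s \<le> 1 \<Longrightarrow> \<phi> ((1 - s) *\<^sub>R x + s *\<^sub>R y) \<le> (1 - s) * \<phi> x + s * \<phi> y"
  using G_function unfolding G_function_def
  by (cases "s = 0"; cases "s = 1") (auto simp: order.order_iff_strict)

lemma strictD: "x \<noteq> y \<Longrightarrow> 0 < s \<Longrightarrow> s < 1 \<Longrightarrow> \<phi> ((1 - s) *\<^sub>R x + s *\<^sub>R y) < (1 - s) * \<phi> x + s * \<phi> y"
  using strict unfolding strictly_convex_def by blast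

lemma continuous_on: "continuous_on S \<phi>"
  using differentiable differentiable_imp_continuous_within
  by (intro continuous_at_imp_continuous_on) blast

lemma gderiv: "GDERIV \<phi> x :> grad \<phi> x"
  using differentiable by (rule differentiable_imp_GDERIV)

lemma directional: "((\<lambda>l. (\<phi> (x + l *\<^sub>R v) - \<phi> x) / l) \<longlongrightarrow> grad \<phi> x \<bullet> v) (at_right 0)"
  using gderiv by (rule GDERIV_directional)

text \<open>Monotonicity of the difference quotients of a convex function. With
  \<open>quotient_ge\<close> it encloses them between bounds independent of l, which supply the
  majorant for the first variation of the energy.\<close>

lemma quotient_le:
  assumes "0 < l" "l \<le> 1"
  shows "(\<phi> (x + l *\<^sub>R v) - \<phi> x) / l \<le> \<phi> (x + v) - \<phi> x"
proof -
  have "(1 - l) *\<^sub>R x + l *\<^sub>R (x + v) = x + l *\<^sub>R v" by (simp add: algebra_simps)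
  then have "\<phi> (x + l *\<^sub>R v) \<le> (1 - l) * \<phi> x + l * \<phi> (x + v)"
    using convex[of l x "x + v"] assms by simp
  then show ?thesis using assms by (simp add: field_simps)
qed

lemma grad_le: "grad \<phi> x \<bullet> v \<le> \<phi> (x + v) - \<phi> x"
proof (rule tendsto_upperbound[OF directional])
  show "eventually (\<lambda>l. (\<phi> (x + l *\<^sub>R v) - \<phi> x) / l \<le> \<phi> (x + v) - \<phi> x) (at_right 0)"
    using quotient_le eventually_at_right[of 0 "1::real"] by (auto intro!: exI[of _ 1])
qed simp

lemma quotient_ge:
  assumes "0 < l"
  shows "\<phi> x - \<phi> (x - v) \<le> (\<phi> (x + l *\<^sub>R v) - \<phi> x) / l"
proof -
  have "grad \<phi> x \<bullet> (- v) \<le> \<phi> (x - v) - \<phi> x" using grad_le[of x "- v"] by simp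
  moreover have "grad \<phi> x \<bullet> (l *\<^sub>R v) \<le> \<phi> (x + l *\<^sub>R v) - \<phi> x" by (rule grad_le)
  then have "grad \<phi> x \<bullet> v \<le> (\<phi> (x + l *\<^sub>R v) - \<phi> x) / l"
    using assms by (simp add: field_simps)
  ultimately show ?thesis by simp
qed

lemma grad_less:
  assumes "v \<noteq> 0"
  shows "grad \<phi> x \<bullet> v < \<phi> (x + v) - \<phi> x"
proof -
  have "(1 - 1/2) *\<^sub>R x + (1/2) *\<^sub>R (x + v) = x + (1/2) *\<^sub>R v"
    by (simp add: algebra_simps flip: scaleR_add_left)
  then have "\<phi> (x + (1/2) *\<^sub>R v) < (1 - 1/2) * \<phi> x + (1/2) * \<phi> (x + v)"
    using strictD[of x "x + v" "1/2"] assms by simp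
  then show ?thesis using grad_le[of x "(1/2) *\<^sub>R v"] by simp
qed

text \<open>If two points shared a gradient, adding the strict subgradient inequalities from one to
  the other and back would give 0 < 0.\<close>

lemma inj_grad: "inj (grad \<phi>)"
proof (rule injI, rule ccontr)
  fix x y assume "grad \<phi> x = grad \<phi> y" "x \<noteq> y"
  then show False using grad_less[of "y - x" x] grad_less[of "x - y" y]
    by (simp add: inner_diff_right)
qed

lemma shrink: "0 \<le> s \<Longrightarrow> s \<le> 1 \<Longrightarrow> \<phi> (s *\<^sub>R x) \<le> s * \<phi> x"
  using convex[of s 0 x] by (simp add: zero)

definition cj :: "'a \<Rightarrow> real" where
  "cj \<xi> = real_of_ereal (conjugate (\<lambda>x. ereal (\<phi> x)) \<xi>)"

lemma conjugate_eq_cj: "conjugate (\<lambda>x. ereal (\<phi> x)) \<xi> = ereal (cj \<xi>)"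
proof -
  have "ereal (\<xi> \<bullet> 0) - ereal (\<phi> 0) \<le> conjugate (\<lambda>x. ereal (\<phi> x)) \<xi>"
    unfolding conjugate_def by (rule SUP_upper) simp
  moreover have "conjugate (\<lambda>x. ereal (\<phi> x)) \<xi> < \<infinity>"
    using Delta2_conjugate unfolding Delta2_def by blast
  ultimately show ?thesis unfolding cj_def
    by (cases "conjugate (\<lambda>x. ereal (\<phi> x)) \<xi>") (auto simp: zero)
qed

lemma young: "\<xi> \<bullet> x \<le> \<phi> x + cj \<xi>"
proof -
  have "ereal (\<xi> \<bullet> x) - ereal (\<phi> x) \<le> ereal (cj \<xi>)"
    unfolding conjugate_eq_cj[symmetric] conjugate_def by (rule SUP_upper) simp
  then show ?thesis by simp
qed

lemma cj_le: "(\<And>x. \<xi> \<bullet> x - \<phi> x \<le> M) \<Longrightarrow> cj \<xi> \<le> M"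
proof -
  assume "\<And>x. \<xi> \<bullet> x - \<phi> x \<le> M"
  then have "conjugate (\<lambda>x. ereal (\<phi> x)) \<xi> \<le> ereal M"
    unfolding conjugate_def by (intro SUP_least) simp
  then show ?thesis by (simp add: conjugate_eq_cj)
qed

lemma young_abs: "\<bar>\<xi> \<bullet> x\<bar> \<le> \<phi> x + cj \<xi>"
  using young[of \<xi> x] young[of \<xi> "- x"] by (simp add: even)

lemma cj_grad: "cj (grad \<phi> y) \<le> grad \<phi> y \<bullet> y - \<phi> y"
proof (rule cj_le)
  fix x show "grad \<phi> y \<bullet> x - \<phi> x \<le> grad \<phi> y \<bullet> y - \<phi> y"
    using grad_le[of y "x - y"] by (simp add: inner_diff_right)
qed

text \<open>This uses that the conjugate is finite at the finitely many points S i: Young's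
  inequality there bounds each coordinate of z, and the sum of the coordinates dominates the
  norm.\<close>

lemma superlinear: "\<exists>C\<ge>0. \<forall>z. R * norm z \<le> \<phi> z + C"
proof -
  define n where "n = real DIM('a)"
  have n: "n > 0" by (simp add: n_def)
  \<comment> \<open>Summing over the basis spends one \<phi> z per dimension; the factor n
    compensates when the sum is divided by n.\<close>
  define S where "S = \<bar>R\<bar> * n"
  define M where "M = (\<Sum>i\<in>Basis. cj (S *\<^sub>R (i::'a)))"
  have "\<bar>R\<bar> * norm z \<le> \<phi> z + \<bar>M\<bar>" for z
  proof -
    have le: "\<bar>R\<bar> * norm z \<le> \<bar>R\<bar> * (\<Sum>i\<in>Basis. \<bar>z \<bullet> i\<bar>)" by (intro mult_left_mono norm_le_l1) simp
    have "n * (\<bar>R\<bar> * norm z) \<le> n * (\<bar>R\<bar> * (\<Sum>i\<in>Basis. \<bar>z \<bullet> i\<bar>))"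
      using n by (intro mult_left_mono[of _ _ n] le) simp
    also have "\<dots> = (\<Sum>i\<in>Basis. \<bar>(S *\<^sub>R i) \<bullet> z\<bar>)"
      using n by (simp add: S_def sum_distrib_left abs_mult inner_commute mult.assoc mult.left_commute)
    also have "\<dots> \<le> (\<Sum>i\<in>Basis. \<phi> z + cj (S *\<^sub>R i))" by (intro sum_mono young_abs)
    also have "\<dots> = n * \<phi> z + M" by (simp add: sum.distrib M_def n_def)
    also have "\<dots> \<le> n * \<phi> z + n * \<bar>M\<bar>"
    proof -
      have "1 \<le> n" using DIM_positive[where 'a='a] unfolding n_def by linarith
      then have "\<bar>M\<bar> * 1 \<le> \<bar>M\<bar> * n" by (intro mult_left_mono) auto
      then show ?thesis by (simp add: mult.commute)
    qed
    finally have "n * (\<bar>R\<bar> * norm z) \<le> n * (\<phi> z + \<bar>M\<bar>)" by (simp add: algebra_simps)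
    then show ?thesis using n by simp
  qed
  moreover have "R * norm z \<le> \<bar>R\<bar> * norm z" for z :: 'a by (intro mult_right_mono) auto
  ultimately show ?thesis by (intro exI[of _ "\<bar>M\<bar>"]) (auto intro: order_trans)
qed

text \<open>The solution is a minimizer of \<phi> minus the linear function of p. Superlinear growth
  confines the search to a compact ball, and minimality is read off the one-sided directional
  derivatives.\<close>

lemma surj_grad: "\<exists>x. grad \<phi> x = p"
proof -
  define g where "g x = \<phi> x - p \<bullet> x" for x
  \<comment> \<open>Slope \<open>norm p + 1\<close> pays for the linear term and leaves
    \<open>norm z\<close> as a coercive lower bound.\<close>
  obtain C where C: "C \<ge> 0" "\<And>z. (norm p + 1) * norm z \<le> \<phi> z + C" using superlinear by blast
  have lower: "norm z - C \<le> g z" for z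
  proof -
    have "p \<bullet> z \<le> norm p * norm z" by (rule norm_cauchy_schwarz)
    then show ?thesis using C(2)[of z] by (simp add: g_def algebra_simps)
  qed
  have cont: "continuous_on (cball 0 (C + 1)) g"
    unfolding g_def by (intro continuous_intros continuous_on)
  obtain x where x: "x \<in> cball 0 (C+1)" "\<And>y. y \<in> cball 0 (C+1) \<Longrightarrow> g x \<le> g y"
    using continuous_attains_inf[OF compact_cball _ cont] C(1) by auto
  have min: "g x \<le> g y" for y
  proof (cases "y \<in> cball 0 (C+1)")
    case False
    then have "1 < g y" using lower[of y] by (simp add: dist_norm)
    moreover have "g x \<le> g 0" using x(2)[of 0] C(1) by simp
    ultimately show ?thesis by (simp add: g_def zero)
  qed (rule x)
  have "p \<bullet> v \<le> grad \<phi> x \<bullet> v" for v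
  proof (rule tendsto_lowerbound[OF directional])
    have "p \<bullet> v \<le> (\<phi> (x + l *\<^sub>R v) - \<phi> x) / l" if "0 < l" for l
      using min[of "x + l *\<^sub>R v"] that by (simp add: g_def inner_add_right field_simps)
    then show "eventually (\<lambda>l. p \<bullet> v \<le> (\<phi> (x + l *\<^sub>R v) - \<phi> x) / l) (at_right 0)"
      using eventually_at_right[of 0 "1::real"] by (auto intro!: exI[of _ 1])
  qed simp
  from this[of "p - grad \<phi> x"] have "(p - grad \<phi> x) \<bullet> (p - grad \<phi> x) \<le> 0"
    by (simp add: inner_diff_left)
  then have "p - grad \<phi> x = 0" by (metis antisym inner_ge_zero inner_eq_zero_iff)
  then show ?thesis by (intro exI[of _ x]) simp
qed

text \<open>Dualizes the \<open>\<Delta>\<^sub>2\<close>-condition on the conjugate: it is applied at \<open>\<xi> = \<nabla>\<phi> y\<close>, where Young's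
  inequality for \<open>y\<close> and \<open>\<xi>\<close> is an equality.\<close>

lemma conjugate_contraction:
  obtains a where "a > 0" "\<And>z. a * \<phi> (z /\<^sub>R a) \<le> (\<phi> z + 1) / 2"
proof -
  obtain C where C: "0 < C" "\<And>\<xi>. cj (2 *\<^sub>R \<xi>) \<le> C * cj \<xi> + 1"
    using Delta2_conjugate unfolding Delta2_def conjugate_eq_cj by auto
  have "C * \<phi> y \<le> \<phi> ((C/2) *\<^sub>R y) + 1" for y
  proof -
    let ?\<xi> = "grad \<phi> y"
    have "(2 *\<^sub>R ?\<xi>) \<bullet> ((C/2) *\<^sub>R y) \<le> \<phi> ((C/2) *\<^sub>R y) + cj (2 *\<^sub>R ?\<xi>)" by (rule young)
    moreover have "C * cj ?\<xi> \<le> C * (?\<xi> \<bullet> y - \<phi> y)" using cj_grad C(1) by (intro mult_left_mono) auto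
    ultimately show ?thesis using C(2)[of ?\<xi>] by (simp add: algebra_simps)
  qed
  note * = this
  show thesis
  proof
    show "0 < C/2" using C by simp
    show "C/2 * \<phi> (z /\<^sub>R (C/2)) \<le> (\<phi> z + 1) / 2" for z
      using *[of "z /\<^sub>R (C/2)"] C(1) by simp
  qed
qed

text \<open>Each application of \<open>conjugate_contraction\<close> halves the coefficient of
  \<phi> z at the price of a larger additive constant. After n applications the scale is
  \<open>a^n\<close> and the coefficient is below \<theta>.\<close>

lemma sublinear_rescaling:
  assumes "0 < \<theta>"
  obtains R C where "R > 0" "C \<ge> 0" "\<And>z. R * \<phi> (z /\<^sub>R R) \<le> \<theta> * \<phi> z + C"
proof -
  obtain a where a: "a > 0" "\<And>z. a * \<phi> (z /\<^sub>R a) \<le> (\<phi> z + 1) / 2" using conjugate_contraction by blast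
  have "\<exists>C\<ge>0. \<forall>z. a^n * \<phi> (z /\<^sub>R a^n) \<le> (1/2)^n * \<phi> z + C" for n
  proof (induction n)
    case 0
    then show ?case by (intro exI[of _ 0]) simp
  next
    case (Suc n)
    then obtain C where C: "C \<ge> 0" "\<And>z. a^n * \<phi> (z /\<^sub>R a^n) \<le> (1/2)^n * \<phi> z + C" by blast
    have "a^Suc n * \<phi> (z /\<^sub>R a^Suc n) \<le> (1/2)^Suc n * \<phi> z + (C + a^n) / 2" for z
    proof -
      have "a^Suc n * \<phi> (z /\<^sub>R a^Suc n) = a^n * (a * \<phi> ((z /\<^sub>R a^n) /\<^sub>R a))"
        by (simp add: mult.commute mult.left_commute)
      also have "\<dots> \<le> a^n * ((\<phi> (z /\<^sub>R a^n) + 1) / 2)" using a(1) by (intro mult_left_mono a(2)) simp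
      also have "\<dots> = (a^n * \<phi> (z /\<^sub>R a^n) + a^n) / 2" by (simp add: algebra_simps)
      also have "\<dots> \<le> ((1/2)^n * \<phi> z + C + a^n) / 2" using C(2)[of z] by simp
      also have "\<dots> = (1/2)^Suc n * \<phi> z + (C + a^n) / 2" by (simp add: field_simps)
      finally show ?thesis .
    qed
    then show ?case using C(1) a(1) by (intro exI[of _ "(C + a^n) / 2"]) auto
  qed
  note * = this
  obtain n where n: "(1/2)^n < \<theta>" using real_arch_pow_inv[OF assms, of "1/2"] by auto
  obtain C where C: "C \<ge> 0" "\<And>z. a^n * \<phi> (z /\<^sub>R a^n) \<le> (1/2)^n * \<phi> z + C" using *[of n] by blast
  show thesis
  proof
    show "a^n > 0" using a by simp
    show "a^n * \<phi> (z /\<^sub>R a^n) \<le> \<theta> * \<phi> z + C" for z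
      using C(2)[of z] mult_right_mono[OF less_imp_le[OF n] nonneg, of z] by linarith
  qed fact
qed

text \<open>The doubling condition is iterated until the power of 2 exceeds the absolute value of l;
  convexity with \<phi> 0 = 0 and evenness then descend to l.\<close>

lemma dilation:
  fixes l :: real
  obtains A B where "A \<ge> 0" "B \<ge> 0" "\<And>z. \<phi> (l *\<^sub>R z) \<le> A * \<phi> z + B"
proof -
  obtain C where C: "0 < C" "\<And>x. \<phi> (2 *\<^sub>R x) \<le> C * \<phi> x + 1"
    using Delta2 unfolding Delta2_def by auto
  have "\<exists>A B. A \<ge> 0 \<and> B \<ge> 0 \<and> (\<forall>z. \<phi> (2^n *\<^sub>R z) \<le> A * \<phi> z + B)" for n :: nat
  proof (induction n)
    case 0
    then show ?case by (intro exI[of _ 1] exI[of _ 0]) simp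
  next
    case (Suc n)
    then obtain A B where AB: "A \<ge> 0" "B \<ge> 0" "\<And>z. \<phi> (2^n *\<^sub>R z) \<le> A * \<phi> z + B" by blast
    have "\<phi> (2^Suc n *\<^sub>R z) \<le> (C * A) * \<phi> z + (C * B + 1)" for z
    proof -
      have "\<phi> (2^Suc n *\<^sub>R z) \<le> C * \<phi> (2^n *\<^sub>R z) + 1" using C(2)[of "2^n *\<^sub>R z"] by simp
      also have "C * \<phi> (2^n *\<^sub>R z) \<le> C * (A * \<phi> z + B)" using C(1) AB(3) by (intro mult_left_mono) auto
      finally show ?thesis by (simp add: algebra_simps)
    qed
    then show ?case using C(1) AB by (intro exI[of _ "C * A"] exI[of _ "C * B + 1"]) auto
  qed
  note * = this
  obtain n where n: "\<bar>l\<bar> < 2^n" using real_arch_pow[of 2 "\<bar>l\<bar>"] by auto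
  obtain A B where AB: "A \<ge> 0" "B \<ge> 0" "\<And>z. \<phi> (2^n *\<^sub>R z) \<le> A * \<phi> z + B" using *[of n] by blast
  have "\<phi> (l *\<^sub>R z) \<le> A * \<phi> z + B" for z
  proof -
    have abs: "\<phi> (l *\<^sub>R z) = \<phi> (\<bar>l\<bar> *\<^sub>R z)" using even[of "l *\<^sub>R z"] by (cases "l \<ge> 0") auto
    have "\<phi> ((\<bar>l\<bar> / 2^n) *\<^sub>R (2^n *\<^sub>R z)) \<le> (\<bar>l\<bar> / 2^n) * \<phi> (2^n *\<^sub>R z)"
      using n by (intro shrink) auto
    also have "\<dots> \<le> 1 * \<phi> (2^n *\<^sub>R z)" using n nonneg by (intro mult_right_mono) auto
    finally show ?thesis using AB(3)[of z] abs by simp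
  qed
  then show thesis using that AB(1,2) by blast
qed

lemma add_le: "\<phi> (x + y) \<le> (\<phi> (2 *\<^sub>R x) + \<phi> (2 *\<^sub>R y)) / 2"
  using convex[of "1/2" "2 *\<^sub>R x" "2 *\<^sub>R y"] by simp

end


section \<open>Clarke derivatives of regular functions\<close>

text \<open>For a regular function the Clarke derivative is finite, so \<open>dir\<close> carries
  the same information. It is used for regular functions.\<close>

definition dir :: "('a::euclidean_space \<Rightarrow> real) \<Rightarrow> 'a \<Rightarrow> 'a \<Rightarrow> real" where
  "dir f x v = real_of_ereal (clarke_derivative f x v)"

context
  fixes f :: "'a::euclidean_space \<Rightarrow> real"
  assumes regular: "clarke_regular f"
begin

lemma clarke_derivative_eq_dir: "clarke_derivative f x v = ereal (dir f x v)"
  and dir_tendsto: "((\<lambda>l. (f (x + l *\<^sub>R v) - f x) / l) \<longlongrightarrow> dir f x v) (at_right 0)"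
proof -
  obtain D where "((\<lambda>l. (f (x + l *\<^sub>R v) - f x) / l) \<longlongrightarrow> D) (at_right 0)" "clarke_derivative f x v = ereal D"
    using regular unfolding clarke_regular_def by blast
  then show "clarke_derivative f x v = ereal (dir f x v)"
    "((\<lambda>l. (f (x + l *\<^sub>R v) - f x) / l) \<longlongrightarrow> dir f x v) (at_right 0)"
    by (simp_all add: dir_def)
qed

lemma clarke_gradient_iff: "\<xi> \<in> clarke_gradient f x \<longleftrightarrow> (\<forall>v. \<xi> \<bullet> v \<le> dir f x v)"
  unfolding clarke_gradient_def by (simp add: clarke_derivative_eq_dir)

lemma dir_zero: "dir f x 0 = 0"
  using dir_tendsto[of x 0] by (simp add: tendsto_const_iff)

lemma dir_scale:
  assumes "0 < c"
  shows "dir f x (c *\<^sub>R v) = c * dir f x v"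
proof (rule tendsto_unique[OF _ dir_tendsto])
  have "filterlim (\<lambda>l. c * l) (at_right 0) (at_right (0::real))"
    unfolding filterlim_at
  proof
    show "eventually (\<lambda>l. c * l \<in> {0<..} \<and> c * l \<noteq> 0) (at_right 0)"
      using assms by (auto simp: eventually_at_right_less eventually_at_filter)
  qed (use assms in \<open>auto intro!: tendsto_eq_intros\<close>)
  then have "((\<lambda>l. c * ((f (x + (c * l) *\<^sub>R v) - f x) / (c * l))) \<longlongrightarrow> c * dir f x v) (at_right 0)"
    by (intro tendsto_intros filterlim_compose[OF dir_tendsto[of x v]])
  then show "((\<lambda>l. (f (x + l *\<^sub>R c *\<^sub>R v) - f x) / l) \<longlongrightarrow> c * dir f x v) (at_right 0)"
    using assms by (simp add: mult.commute)
qed simp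

text \<open>An ordinary one-sided derivative need not be subadditive. Here the increment in
  direction v + w is split at x + l w, so that its first part starts from a moving base point. The
  Limsup over nearby base points in \<open>clarke_derivative\<close> controls exactly this
  part.\<close>

lemma dir_add: "dir f x (v + w) \<le> dir f x v + dir f x w"
proof (rule field_le_epsilon)
  fix e :: real assume e: "0 < e"
  let ?q = "\<lambda>(y, l). ereal ((f (y + l *\<^sub>R v) - f y) / l)"
  have "Limsup (nhds x \<times>\<^sub>F at_right 0) ?q < ereal (dir f x v + e)"
    using clarke_derivative_eq_dir[of x v] e unfolding clarke_derivative_def by simp
  then have ev: "eventually (\<lambda>p. ?q p < ereal (dir f x v + e)) (nhds x \<times>\<^sub>F at_right 0)"
    by (rule Limsup_lessD)
  have "filterlim (\<lambda>l. x + l *\<^sub>R w) (nhds x) (at_right (0::real))"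
    by (auto intro!: tendsto_eq_intros)
  then have "filterlim (\<lambda>l. (x + l *\<^sub>R w, l)) (nhds x \<times>\<^sub>F at_right 0) (at_right (0::real))"
    by (rule filterlim_Pair[OF _ filterlim_ident])
  from eventually_compose_filterlim[OF ev this]
  have ev1: "eventually (\<lambda>l. (f (x + l *\<^sub>R w + l *\<^sub>R v) - f (x + l *\<^sub>R w)) / l < dir f x v + e) (at_right 0)"
    by simp
  show "dir f x (v + w) \<le> dir f x v + dir f x w + e"
  proof (rule tendsto_le[OF _ _ dir_tendsto])
    show "((\<lambda>l. (dir f x v + e) + (f (x + l *\<^sub>R w) - f x) / l) \<longlongrightarrow> dir f x v + dir f x w + e) (at_right 0)"
      using tendsto_add[OF tendsto_const[of "dir f x v + e"] dir_tendsto[of x w]] by (simp add: algebra_simps)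
    show "eventually (\<lambda>l. (f (x + l *\<^sub>R (v + w)) - f x) / l \<le> (dir f x v + e) + (f (x + l *\<^sub>R w) - f x) / l) (at_right 0)"
      using ev1
    proof eventually_elim
      case (elim l)
      have "(f (x + l *\<^sub>R (v + w)) - f x) / l
        = (f (x + l *\<^sub>R w + l *\<^sub>R v) - f (x + l *\<^sub>R w)) / l + (f (x + l *\<^sub>R w) - f x) / l"
        by (simp add: algebra_simps diff_divide_distrib)
      then show ?case using elim by simp
    qed
  qed simp
qed

text \<open>Hahn--Banach in finite dimensions: a hyperplane separating the open epigraph of the
  sublinear function \<open>dir f x\<close> from the point of its graph above \<open>v\<close>.\<close>

lemma clarke_gradient_attains_dir:
  obtains \<xi> where "\<xi> \<in> clarke_gradient f x" "\<xi> \<bullet> v = dir f x v"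
proof -
  let ?S = "{(w, r). dir f x w < r}"
  have "convex ?S"
  proof (rule convexI)
    fix p q and s t :: real
    assume pq: "p \<in> ?S" "q \<in> ?S" and st: "0 \<le> s" "0 \<le> t" "s + t = 1"
    obtain w r w' r' where p: "p = (w, r)" "q = (w', r')" by (cases p; cases q) auto
    have scale: "dir f x (c *\<^sub>R w) = c * dir f x w" if "0 \<le> c" for c w
      using dir_scale[of c x w] dir_zero that by (cases "c = 0") auto
    have "dir f x (s *\<^sub>R w + t *\<^sub>R w') \<le> s * dir f x w + t * dir f x w'"
      using dir_add[of x "s *\<^sub>R w" "t *\<^sub>R w'"] scale st by simp
    also have "\<dots> < s * r + t * r'"
    proof (cases "s = 0")
      case True then show ?thesis using pq st p by simp
    next
      case False
      then have "s * dir f x w < s * r" using st pq p by simp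
      moreover have "t * dir f x w' \<le> t * r'" using st pq p by (intro mult_left_mono) auto
      ultimately show ?thesis by simp
    qed
    finally show "s *\<^sub>R p + t *\<^sub>R q \<in> ?S" by (simp add: p)
  qed
  moreover have "(0, dir f x 0 + 1) \<in> ?S" by simp
  then have "?S \<noteq> {}" by blast
  moreover have "{(v, dir f x v)} \<inter> ?S = {}" by simp
  ultimately obtain a b where ab: "a \<noteq> 0" "\<forall>p\<in>{(v, dir f x v)}. a \<bullet> p \<le> b" "\<forall>p\<in>?S. b \<le> a \<bullet> p"
    using separating_hyperplane_sets[of "{(v, dir f x v)}" ?S] by auto
  obtain \<alpha> \<beta> where a: "a = (\<alpha>, \<beta>)" by (cases a)
  have sep: "\<alpha> \<bullet> v + \<beta> * dir f x v \<le> \<alpha> \<bullet> w + \<beta> * r" if "dir f x w < r" for w r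
    using ab(2,3) that unfolding a by (force simp: inner_prod_def)
  have "\<beta> \<ge> 0"
    using sep[of v "dir f x v + 1"] by (simp add: algebra_simps)
  \<comment> \<open>The hyperplane cannot be vertical, because the epigraph projects onto the whole
    space.\<close>
  moreover have "\<beta> \<noteq> 0"
  proof
    assume "\<beta> = 0"
    then have "\<alpha> \<bullet> v \<le> \<alpha> \<bullet> (v - \<alpha>)" using sep[of "v - \<alpha>" "dir f x (v - \<alpha>) + 1"] by simp
    then have "\<alpha> \<bullet> \<alpha> \<le> 0" by (simp add: inner_diff_right)
    then have "\<alpha> = 0" by (metis antisym inner_ge_zero inner_eq_zero_iff)
    then show False using ab(1) a \<open>\<beta> = 0\<close> by (simp add: zero_prod_def)
  qed
  ultimately have \<beta>: "\<beta> > 0" by simp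
  define \<xi> where "\<xi> = - (\<alpha> /\<^sub>R \<beta>)"
  have \<alpha>: "\<alpha> \<bullet> w = - \<beta> * (\<xi> \<bullet> w)" for w using \<beta> by (simp add: \<xi>_def)
  have le: "dir f x v - \<xi> \<bullet> v \<le> dir f x w - \<xi> \<bullet> w" for w
  proof (rule field_le_epsilon)
    fix e :: real assume "0 < e"
    then have "\<beta> * (dir f x v - \<xi> \<bullet> v) \<le> \<beta> * (dir f x w + e - \<xi> \<bullet> w)"
      using sep[of w "dir f x w + e"] unfolding \<alpha> by (simp add: algebra_simps)
    then show "dir f x v - \<xi> \<bullet> v \<le> dir f x w - \<xi> \<bullet> w + e" using \<beta> by simp
  qed
  \<comment> \<open>The point 0 shows that the gap is at most 0. At 2 v, homogeneity doubles the
    gap, so it is at least 0.\<close>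
  have eq: "\<xi> \<bullet> v = dir f x v"
    using le[of 0] le[of "2 *\<^sub>R v"] dir_scale[of 2 x v] by (simp add: dir_zero)
  moreover have "\<xi> \<in> clarke_gradient f x"
    unfolding clarke_gradient_iff using le eq by simp
  ultimately show thesis using that by blast
qed

end

section \<open>Increments controlled by one-sided derivatives\<close>

text \<open>Continuous induction: the set where H lies below the line of slope e through its initial
  value is compact, and a last point before 1 could be moved to the right by \<open>step\<close>.
  Then e tends to 0.\<close>

lemma right_increment_le_imp_le:
  fixes H :: "real \<Rightarrow> real"
  assumes cont: "continuous_on {0..1} H"
    and step: "\<And>s e. 0 \<le> s \<Longrightarrow> s < 1 \<Longrightarrow> 0 < e \<Longrightarrow> \<exists>l>0. s + l \<le> 1 \<and> H (s + l) - H s \<le> e * l"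
  shows "H 1 \<le> H 0"
proof (rule field_le_epsilon)
  fix e :: real assume e: "0 < e"
  let ?K = "{s \<in> {0..1}. H s - e * s \<le> H 0}"
  have "closed ({0..1} \<inter> (\<lambda>s. H s - e * s) -` {..H 0})"
    by (intro continuous_closed_preimage continuous_intros cont closed_atLeastAtMost closed_atMost)
  then have "compact ({0..1} \<inter> ({0..1} \<inter> (\<lambda>s. H s - e * s) -` {..H 0}))"
    by (rule compact_Int_closed[OF compact_Icc])
  moreover have "{0..1} \<inter> ({0..1} \<inter> (\<lambda>s. H s - e * s) -` {..H 0}) = ?K" by auto
  ultimately have "compact ?K" by simp
  moreover have "0 \<in> ?K" by simp
  ultimately obtain m where m: "m \<in> ?K" "\<And>s. s \<in> ?K \<Longrightarrow> s \<le> m"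
    using compact_attains_sup[of ?K] by blast
  have "m = 1"
  proof (rule ccontr)
    assume "m \<noteq> 1"
    then obtain l where l: "l > 0" "m + l \<le> 1" "H (m + l) - H m \<le> e * l"
      using step[of m e] m(1) e by auto
    then have "m + l \<in> ?K" using m(1) by (simp add: algebra_simps)
    then show False using m(2)[of "m + l"] l(1) by simp
  qed
  then show "H 1 \<le> H 0 + e" using m(1) by simp
qed

text \<open>The exceptional null set of the hypothesis on right derivatives may depend on \<open>s\<close>. Integrating
  the increment over the set where the conclusion fails removes this dependence without
  measurability in \<open>(t, s)\<close>.\<close>

lemma (in finite_measure) AE_increment_le:
  fixes h :: "'a \<Rightarrow> real \<Rightarrow> real" and A :: "'a \<Rightarrow> real"
  assumes h [measurable]: "\<And>s. (\<lambda>t. h t s) \<in> borel_measurable M"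
    and A [measurable]: "A \<in> borel_measurable M"
    and Lip: "AE t in M. \<exists>L. L-lipschitz_on {0..1} (h t)"
    and der: "\<And>s. 0 \<le> s \<Longrightarrow> s < 1 \<Longrightarrow>
      AE t in M. \<exists>D\<le>A t. ((\<lambda>l. (h t (s + l) - h t s) / l) \<longlongrightarrow> D) (at_right 0)"
  shows "AE t in M. h t 1 - h t 0 \<le> A t"
proof -
  \<comment> \<open>A Lipschitz condition on this countable set is measurable in t; for continuous
    functions it extends to {0..1}.\<close>
  define Q where "Q = {0<..<1} \<inter> (\<rat> :: real set)"
  have Q: "countable Q" "closure Q = {0..1}"
    using closure_open_Int_superset[of "{0<..<1}" "\<rat> :: real set"]
    by (auto simp: Q_def Rats_closure_real countable_rat)
  have small: "AE t in M. \<not> ((\<forall>s\<in>Q. \<forall>r\<in>Q. \<bar>h t s - h t r\<bar> \<le> real N * \<bar>s - r\<bar>) \<and> \<bar>A t\<bar> \<le> real N \<and> A t < h t 1 - h t 0)"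
    for N :: nat
  proof -
    \<comment> \<open>The exceptional set, cut down to points with a common Lipschitz constant and a
      common bound on A. This makes all quotients below uniformly bounded.\<close>
    define E where "E = {t \<in> space M. (\<forall>s\<in>Q. \<forall>r\<in>Q. \<bar>h t s - h t r\<bar> \<le> real N * \<bar>s - r\<bar>) \<and> \<bar>A t\<bar> \<le> real N \<and> A t < h t 1 - h t 0}"
    have "{t \<in> space M. \<bar>h t s - h t r\<bar> \<le> real N * \<bar>s - r\<bar>} \<in> sets M" for s r
      by measurable
    then have "{t \<in> space M. \<forall>s\<in>Q. \<forall>r\<in>Q. \<bar>h t s - h t r\<bar> \<le> real N * \<bar>s - r\<bar>} \<in> sets M"
      using Q(1) by (intro sets.sets_Collect_countable_All')
    moreover have "{t \<in> space M. \<bar>A t\<bar> \<le> real N \<and> A t < h t 1 - h t 0} \<in> sets M" by measurable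
    ultimately have E [measurable]: "E \<in> sets M"
    proof -
      assume "{t \<in> space M. \<forall>s\<in>Q. \<forall>r\<in>Q. \<bar>h t s - h t r\<bar> \<le> real N * \<bar>s - r\<bar>} \<in> sets M"
        "{t \<in> space M. \<bar>A t\<bar> \<le> real N \<and> A t < h t 1 - h t 0} \<in> sets M"
      from sets.Int[OF this] show ?thesis
        unfolding E_def by (rule back_subst[where P = "\<lambda>X. X \<in> sets M"]) auto
    qed
    have AE_Lip: "AE t in M. t \<in> E \<longrightarrow> (real N)-lipschitz_on {0..1} (h t)"
      using Lip
    proof eventually_elim
      case (elim t)
      show ?case
      proof
        assume "t \<in> E"
        then have "(real N)-lipschitz_on Q (h t)" by (auto simp: E_def lipschitz_on_def dist_real_def)
        moreover have "continuous_on (closure Q) (h t)" using elim lipschitz_on_continuous_on Q(2) by metis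
        ultimately have "(real N)-lipschitz_on (closure Q) (h t)" by (rule lipschitz_on_closure)
        then show "(real N)-lipschitz_on {0..1} (h t)" by (simp add: Q(2))
      qed
    qed
    \<comment> \<open>Subtracting A t times s reduces the claim to right derivatives at most 0; the
      indicator restricts to E. For each fixed s the hypothesis applies off its own null set, which
      integration over t does not see.\<close>
    define g where "g s t = indicator E t * (h t s - h t 0 - A t * s)" for s t
    have gm [measurable]: "g s \<in> borel_measurable M" for s unfolding g_def by measurable
    have g_diff: "AE t in M. \<bar>g s t - g r t\<bar> \<le> 2 * real N * \<bar>s - r\<bar>" if sr: "s \<in> {0..1}" "r \<in> {0..1}" for s r
      using AE_Lip
    proof eventually_elim
      case (elim t)
      show ?case
      proof (cases "t \<in> E")
        case True
        then have "\<bar>h t s - h t r\<bar> \<le> real N * \<bar>s - r\<bar>"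
          using elim sr lipschitz_onD[of "real N" "{0..1}" "h t" s r] by (simp add: dist_real_def)
        moreover have "\<bar>A t * (s - r)\<bar> \<le> real N * \<bar>s - r\<bar>"
          using True by (auto simp: E_def abs_mult intro!: mult_right_mono)
        ultimately show ?thesis using True by (simp add: g_def algebra_simps abs_if split: if_splits)
      qed (simp add: g_def)
    qed
    have gi: "integrable M (g s)" if s: "s \<in> {0..1}" for s
    proof (rule integrable_const_bound[where B = "2 * real N"])
      show "AE t in M. norm (g s t) \<le> 2 * real N"
        using g_diff[OF s, of 0, simplified]
      proof eventually_elim
        case (elim t)
        have "2 * real N * \<bar>s - 0\<bar> \<le> 2 * real N * 1" using s by (intro mult_left_mono) auto
        then show ?case using elim by (simp add: g_def)
      qed
    qed simp
    define H where "H s = (\<integral>t. g s t \<partial>M)" for s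
    have "(2 * real N * measure M (space M))-lipschitz_on {0..1} H"
    proof (rule lipschitz_onI)
      fix s r :: real assume sr: "s \<in> {0..1}" "r \<in> {0..1}"
      have "\<bar>H s - H r\<bar> = \<bar>\<integral>t. g s t - g r t \<partial>M\<bar>" using gi sr by (simp add: H_def)
      also have "\<dots> \<le> (\<integral>t. \<bar>g s t - g r t\<bar> \<partial>M)" by (rule integral_abs_bound)
      also have "\<dots> \<le> (\<integral>t. 2 * real N * \<bar>s - r\<bar> \<partial>M)"
        using gi sr g_diff by (intro integral_mono_AE) auto
      also have "\<dots> = 2 * real N * measure M (space M) * \<bar>s - r\<bar>" by (simp add: mult.commute)
      finally show "dist (H s) (H r) \<le> 2 * real N * measure M (space M) * dist s r" by (simp add: dist_real_def)
    qed simp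
    then have cont: "continuous_on {0..1} H" by (rule lipschitz_on_continuous_on)
    have "H 1 \<le> H 0"
    proof (rule right_increment_le_imp_le[OF cont])
      fix s e :: real assume s: "0 \<le> s" "s < 1" and e: "0 < e"
      define l where "l n = (1 - s) / real (Suc n)" for n
      have l: "0 < l n" "s + l n \<le> 1" for n
      proof -
        show "0 < l n" using s by (simp add: l_def)
        have "(1 - s) * 1 \<le> (1 - s) * real (Suc n)" using s by (intro mult_left_mono) auto
        then show "s + l n \<le> 1" by (simp add: l_def field_simps)
      qed
      have l0: "filterlim l (at_right 0) sequentially"
        unfolding filterlim_at
      proof
        show "eventually (\<lambda>n. l n \<in> {0<..} \<and> l n \<noteq> 0) sequentially"
          using l(1) by (auto simp: less_imp_neq[symmetric] intro!: always_eventually)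
        show "l \<longlonglongrightarrow> 0" unfolding l_def by (rule LIMSEQ_Suc[OF lim_const_over_n])
      qed
      define q where "q n t = (g (s + l n) t - g s t) / l n" for n t
      have qm [measurable]: "q n \<in> borel_measurable M" for n unfolding q_def by measurable
      have conv: "AE t in M. \<exists>D\<le>0. (\<lambda>n. q n t) \<longlonglongrightarrow> D"
        using der[OF s]
      proof eventually_elim
        case (elim t)
        then obtain D where D: "D \<le> A t" "((\<lambda>l. (h t (s + l) - h t s) / l) \<longlongrightarrow> D) (at_right 0)" by blast
        have "(\<lambda>n. (h t (s + l n) - h t s) / l n) \<longlonglongrightarrow> D"
          by (rule filterlim_compose[OF D(2) l0])
        then have "(\<lambda>n. indicator E t * ((h t (s + l n) - h t s) / l n - A t)) \<longlonglongrightarrow> indicator E t * (D - A t)"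
          by (intro tendsto_intros)
        moreover have "indicator E t * ((h t (s + l n) - h t s) / l n - A t) = q n t" for n
          using l(1)[of n] by (simp add: q_def g_def indicator_def field_simps)
        ultimately have "(\<lambda>n. q n t) \<longlonglongrightarrow> indicator E t * (D - A t)" by simp
        moreover have "indicator E t * (D - A t) \<le> 0" using D(1) by (simp add: indicator_def)
        ultimately show ?case by blast
      qed
      \<comment> \<open>The limit D is only known to exist almost everywhere. The function
        \<open>lim\<close> names it measurably; its value on the exceptional null set is
        immaterial.\<close>
      have tend: "(\<lambda>n. \<integral>t. q n t \<partial>M) \<longlonglongrightarrow> (\<integral>t. lim (\<lambda>n. q n t) \<partial>M)"
      proof (rule integral_dominated_convergence[where w = "\<lambda>_. 2 * real N"])
        show "AE t in M. (\<lambda>n. q n t) \<longlonglongrightarrow> lim (\<lambda>n. q n t)"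
          using conv by eventually_elim (auto simp: convergent_LIMSEQ_iff[symmetric] convergent_def)
        show "AE t in M. norm (q n t) \<le> 2 * real N" for n
        proof -
          have "s + l n \<in> {0..1}" "s \<in> {0..1}" using s l[of n] by auto
          from g_diff[OF this] show ?thesis
            using l(1)[of n] by (simp add: q_def field_simps)
        qed
      qed auto
      have "(\<integral>t. lim (\<lambda>n. q n t) \<partial>M) \<le> 0"
      proof -
        have "AE t in M. 0 \<le> - lim (\<lambda>n. q n t)"
          using conv by eventually_elim (auto simp: limI)
        then have "0 \<le> (\<integral>t. - lim (\<lambda>n. q n t) \<partial>M)" by (rule integral_nonneg_AE)
        then show ?thesis by simp
      qed
      then have "eventually (\<lambda>n. (\<integral>t. q n t \<partial>M) < e) sequentially"
        using e by (intro order_tendstoD(2)[OF tend]) auto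
      then obtain n where "(\<integral>t. q n t \<partial>M) < e" unfolding eventually_sequentially by blast
      moreover have "(\<integral>t. q n t \<partial>M) = (H (s + l n) - H s) / l n"
      proof -
        have "integrable M (g (s + l n))" "integrable M (g s)" using gi s l[of n] by auto
        then show ?thesis by (simp add: q_def H_def)
      qed
      ultimately have "H (s + l n) - H s \<le> e * l n" using l(1)[of n] by (simp add: field_simps)
      then show "\<exists>l>0. s + l \<le> 1 \<and> H (s + l) - H s \<le> e * l" using l[of n] by blast
    qed
    \<comment> \<open>The integral is at most its value 0 at s = 0, whereas \<open>g 1\<close> is
      positive on E. Hence E is a null set.\<close>
    then have "(\<integral>t. g 1 t \<partial>M) \<le> 0" by (simp add: H_def g_def)
    moreover have g1: "0 \<le> g 1 t" for t by (simp add: g_def E_def indicator_def)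
    ultimately have "(\<integral>t. g 1 t \<partial>M) = 0" using Bochner_Integration.integral_nonneg[of M "g 1"] by (simp add: antisym)
    then have "AE t in M. g 1 t = 0"
      using integral_nonneg_eq_0_iff_AE[OF gi[of 1]] g1 by simp
    then show ?thesis
      using AE_space
    proof eventually_elim
      case (elim t)
      then have "t \<notin> E" by (auto simp: g_def E_def)
      then show ?case using elim(2) by (simp add: E_def)
    qed
  qed
  then have "AE t in M. \<forall>N::nat. \<not> ((\<forall>s\<in>Q. \<forall>r\<in>Q. \<bar>h t s - h t r\<bar> \<le> real N * \<bar>s - r\<bar>) \<and> \<bar>A t\<bar> \<le> real N \<and> A t < h t 1 - h t 0)"
    by (simp add: AE_all_countable)
  then show ?thesis
    using Lip
  proof eventually_elim
    case (elim t)
    then obtain L where L: "L-lipschitz_on {0..1} (h t)" by blast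
    obtain N where N: "max L \<bar>A t\<bar> \<le> real N" using real_arch_simple by blast
    have "\<bar>h t s - h t r\<bar> \<le> real N * \<bar>s - r\<bar>" if "s \<in> Q" "r \<in> Q" for s r
    proof -
      have "\<bar>h t s - h t r\<bar> \<le> L * \<bar>s - r\<bar>"
        using lipschitz_onD[OF L, of s r] that by (simp add: dist_real_def Q_def)
      also have "\<dots> \<le> real N * \<bar>s - r\<bar>" using N by (intro mult_right_mono) auto
      finally show ?thesis .
    qed
    then have "\<not> A t < h t 1 - h t 0" using elim(1)[rule_format, of N] N by auto
    then show ?case by simp
  qed
qed


section \<open>Measurability up to null sets, and locally Lipschitz functions\<close>

text \<open>Completeness of Lebesgue measure: the part of a preimage inside the exceptional set is a
  subset of a null set and so measurable.\<close>

lemma borel_measurable_lebesgue_on_AE_eq: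
  fixes f g :: "real \<Rightarrow> 'b::{second_countable_topology, t2_space}"
  assumes f: "f \<in> borel_measurable (lebesgue_on S)" and S: "S \<in> sets lebesgue"
    and eq: "AE t in lebesgue_on S. f t = g t"
  shows "g \<in> borel_measurable (lebesgue_on S)"
proof (rule measurableI)
  obtain N where N: "negligible N" "\<And>t. t \<in> S - N \<Longrightarrow> f t = g t"
    using eq S by (subst (asm) AE_lebesgue_on_iff_negligible) auto
  fix A :: "'b set" assume A: "A \<in> sets borel"
  have "f -` A \<inter> S \<in> sets (lebesgue_on S)"
    using measurable_sets[OF f A] by (simp add: space_restrict_space)
  then have "f -` A \<inter> S \<in> sets lebesgue" using S by (simp add: sets_restrict_space_iff)
  moreover have "N \<in> sets lebesgue" using N(1) by (rule negligible_imp_sets)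
  moreover have "g -` A \<inter> S \<inter> N \<in> sets lebesgue"
    using negligible_subset[OF N(1)] by (intro negligible_imp_sets) auto
  moreover have "g -` A \<inter> S = (f -` A \<inter> S - N) \<union> (g -` A \<inter> S \<inter> N)" using N(2) by auto
  ultimately have "g -` A \<inter> S \<in> sets lebesgue" by (metis sets.Diff sets.Un)
  then show "g -` A \<inter> space (lebesgue_on S) \<in> sets (lebesgue_on S)"
    using S by (simp add: space_restrict_space sets_restrict_space_iff)
qed auto

lemma borel_measurable_lebesgue_on_AE_LIMSEQ:
  fixes f :: "nat \<Rightarrow> real \<Rightarrow> 'b::{banach, second_countable_topology}"
  assumes f: "\<And>n. f n \<in> borel_measurable (lebesgue_on S)" and S: "S \<in> sets lebesgue"
    and lim: "AE t in lebesgue_on S. (\<lambda>n. f n t) \<longlonglongrightarrow> g t"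
  shows "g \<in> borel_measurable (lebesgue_on S)"
proof (rule borel_measurable_lebesgue_on_AE_eq[OF _ S])
  show "(\<lambda>t. lim (\<lambda>n. f n t)) \<in> borel_measurable (lebesgue_on S)"
    using f by (rule borel_measurable_lim_metric)
  show "AE t in lebesgue_on S. lim (\<lambda>n. f n t) = g t"
    using lim by eventually_elim (rule limI)
qed

lemma countable_closure_UNIV:
  obtains D :: "'a::second_countable_topology set" where "countable D" "closure D = UNIV"
proof -
  obtain D :: "'a set" where D: "countable D" "\<And>X. open X \<Longrightarrow> X \<noteq> {} \<Longrightarrow> \<exists>x\<in>D. x \<in> X"
    using countable_dense_setE by blast
  have "- closure D = {}"
    using D(2)[of "- closure D"] closure_subset[of D] by blast
  then show thesis using that D(1) by blast
qed

text \<open>Compactness of the parameter interval turns local Lipschitz bounds into one constant.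
  The time parameter of \<open>local_lipschitz\<close> is a dummy confined to {0}.\<close>

lemma locally_Lipschitz_segment:
  fixes f :: "'a::real_normed_vector \<Rightarrow> real"
  assumes f: "locally_Lipschitz f"
  shows "\<exists>L. L-lipschitz_on {0..1} (\<lambda>s::real. f (x + s *\<^sub>R v))"
proof -
  let ?g = "\<lambda>(_::real) s::real. f (x + s *\<^sub>R v)"
  have "local_lipschitz {0} {0..1} ?g"
    unfolding local_lipschitz_def
  proof (intro ballI)
    fix s t :: real
    obtain r L where r: "r > 0" "L-lipschitz_on (ball (x + s *\<^sub>R v) r) f"
      using f unfolding locally_Lipschitz_def by blast
    \<comment> \<open>Moving the parameter by u moves the point by less than r; adding 1 to the norm
      includes v = 0.\<close>
    define u where "u = r / (2 * (norm v + 1))"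
    have u: "u > 0" "u * norm v < r"
    proof -
      have "norm v + 1 > 0" by (simp add: add_nonneg_pos)
      then show "u > 0" using r(1) by (simp add: u_def)
      have "r * norm v < r * (2 * (norm v + 1))" using r(1) by (intro mult_strict_left_mono) (smt (verit) norm_ge_zero)+
      then show "u * norm v < r" using \<open>norm v + 1 > 0\<close> by (simp add: u_def field_simps)
    qed
    have mem: "x + y *\<^sub>R v \<in> ball (x + s *\<^sub>R v) r" if "y \<in> cball s u" for y
    proof -
      have "dist (x + s *\<^sub>R v) (x + y *\<^sub>R v) = \<bar>s - y\<bar> * norm v"
        by (simp add: dist_norm flip: scaleR_diff_left)
      also have "\<dots> \<le> u * norm v" using that by (intro mult_right_mono) (auto simp: dist_real_def)
      finally show ?thesis using u(2) by simp
    qed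
    have "(L * norm v)-lipschitz_on (cball s u \<inter> {0..1}) (\<lambda>s. f (x + s *\<^sub>R v))"
    proof (rule lipschitz_onI)
      fix y z assume yz: "y \<in> cball s u \<inter> {0..1}" "z \<in> cball s u \<inter> {0..1}"
      have "dist (f (x + y *\<^sub>R v)) (f (x + z *\<^sub>R v)) \<le> L * dist (x + y *\<^sub>R v) (x + z *\<^sub>R v)"
        using yz by (intro lipschitz_onD[OF r(2)] mem) auto
      also have "dist (x + y *\<^sub>R v) (x + z *\<^sub>R v) = norm v * dist y z"
        by (simp add: dist_norm mult.commute flip: scaleR_diff_left)
      finally show "dist (f (x + y *\<^sub>R v)) (f (x + z *\<^sub>R v)) \<le> L * norm v * dist y z" by (simp add: mult.assoc)
    qed (use lipschitz_on_nonneg[OF r(2)] in simp)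
    then show "\<exists>u>0. \<exists>L. \<forall>t\<in>cball t u \<inter> {0}. L-lipschitz_on (cball s u \<inter> {0..1}) (\<lambda>s. f (x + s *\<^sub>R v))"
      using u(1) by blast
  qed
  then show ?thesis
    using local_lipschitz_compact_implies_lipschitz[of "{0::real}" "{0..1::real}" ?g] by auto
qed

lemma locally_Lipschitz_continuous_on:
  assumes "locally_Lipschitz f"
  shows "continuous_on S f"
proof (rule continuous_at_imp_continuous_on, rule ballI)
  fix x
  obtain r L where r: "r > 0" "L-lipschitz_on (ball x r) f"
    using assms unfolding locally_Lipschitz_def by blast
  from lipschitz_on_continuous_on[OF r(2)] show "isCont f x"
    using r(1) by (simp add: continuous_on_eq_continuous_at)
qed

section \<open>Existence of a minimizer\<close>

locale nonsmooth_problem = Delta2_function \<phi>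
  for \<phi> :: "'a::euclidean_space \<Rightarrow> real" +
  fixes T :: real and F :: "real \<Rightarrow> 'a \<Rightarrow> real" and b d :: "real \<Rightarrow> real"
    and c :: "'a \<Rightarrow> real" and \<phi>\<^sub>0 :: "'a \<Rightarrow> ereal"
  assumes T: "T > 0"
    and F_measurable: "\<And>x. (\<lambda>t. F t x) \<in> borel_measurable (lebesgue_on {0..T})"
    and F_regular: "AE t in lebesgue_on {0..T}. locally_Lipschitz (F t) \<and> clarke_regular (F t)"
    and b_integrable: "integrable (lebesgue_on {0..T}) b"
    and b_nonneg: "\<And>t. t \<in> {0..T} \<Longrightarrow> 0 \<le> b t"
    and c_bounded: "\<And>S. bounded S \<Longrightarrow> bounded (c ` S)"
    and F_bound: "\<And>x. AE t in lebesgue_on {0..T}. \<forall>\<xi> \<in> clarke_gradient (F t) x.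
           \<bar>F t x\<bar> + norm \<xi> \<le> c x * b t"
    and d_integrable: "integrable (lebesgue_on {0..T}) d"
    and d_nonzero: "AE t in lebesgue_on {0..T}. d t \<noteq> 0"
    and G_function_0: "G_function \<phi>\<^sub>0"
    and much_less: "\<phi>\<^sub>0 \<lless> (\<lambda>x. ereal (\<phi> x))"
    and F_growth: "\<And>x. AE t in lebesgue_on {0..T}. \<forall>\<xi> \<in> clarke_gradient (F t) x.
           conjugate (\<lambda>x. ereal (\<phi> x)) (\<xi> /\<^sub>R d t) \<le> \<phi>\<^sub>0 x + 1"
    and F_coercive: "((\<lambda>x. 1 / \<phi>\<^sub>0 (2 *\<^sub>R x) * ereal (LINT t|lebesgue_on {0..T}. F t x)) \<longlongrightarrow> \<infinity>) at_infinity"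
begin

abbreviation M :: "real measure" where "M \<equiv> lebesgue_on {0..T}"

text \<open>The values of \<open>\<phi>\<^sub>0\<close> are finite because
  \<open>\<phi>\<^sub>0\<close> is bounded by a constant plus the finite \<phi>. Real values make
  convexity and continuity of q available.\<close>

definition q :: "'a \<Rightarrow> real" where "q x = real_of_ereal (\<phi>\<^sub>0 x)"

sublocale M: finite_measure M
  by (rule finite_measure_lebesgue_on) simp

lemma AE_M_iff: "(AE t in M. P t) \<longleftrightarrow> (\<exists>N. negligible N \<and> (\<forall>t\<in>{0..T} - N. P t))"
  by (rule AE_lebesgue_on_iff_negligible) simp

lemma AE_in_interval: "AE t in M. t \<in> {0..T}"
  using AE_space[of M] by (simp add: space_restrict_space)

lemma q_le: "0 < k \<Longrightarrow> \<exists>C>0. \<forall>x. \<phi>\<^sub>0 x \<le> ereal (C + \<phi> (k *\<^sub>R x))"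
  using much_less unfolding much_less_def by auto

lemma \<phi>\<^sub>0_eq_q: "\<phi>\<^sub>0 x = ereal (q x)"
proof -
  obtain C where "\<phi>\<^sub>0 x \<le> ereal (C + \<phi> (1 *\<^sub>R x))" using q_le[of 1] by auto
  moreover have "0 \<le> \<phi>\<^sub>0 x" using G_function_0 unfolding G_function_def by blast
  ultimately show ?thesis unfolding q_def by (cases "\<phi>\<^sub>0 x") auto
qed

lemma q_much_less: "0 < k \<Longrightarrow> \<exists>C>0. \<forall>x. q x \<le> C + \<phi> (k *\<^sub>R x)"
proof -
  assume "0 < k"
  then obtain C where "C > 0" "\<And>x. \<phi>\<^sub>0 x \<le> ereal (C + \<phi> (k *\<^sub>R x))" using q_le by blast
  then show ?thesis by (intro exI[of _ C]) (simp add: \<phi>\<^sub>0_eq_q)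
qed

lemma q_nonneg: "0 \<le> q x" and q_zero: "q 0 = 0"
proof -
  have "0 \<le> \<phi>\<^sub>0 x" "\<phi>\<^sub>0 0 = 0"
    using G_function_0 unfolding G_function_def by blast+
  then show "0 \<le> q x" "q 0 = 0" by (simp_all add: \<phi>\<^sub>0_eq_q)
qed

lemma q_convex: "convex_on UNIV q"
proof (rule convex_onI)
  fix s :: real and x y assume "0 < s" "s < 1"
  then have "\<phi>\<^sub>0 ((1 - s) *\<^sub>R x + s *\<^sub>R y) \<le> ereal (1 - s) * \<phi>\<^sub>0 x + ereal s * \<phi>\<^sub>0 y"
    using G_function_0 unfolding G_function_def by blast
  then show "q ((1 - s) *\<^sub>R x + s *\<^sub>R y) \<le> (1 - s) * q x + s * q y"
    by (simp add: \<phi>\<^sub>0_eq_q)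
qed simp

lemma q_continuous_on: "continuous_on S q"
  using convex_on_continuous[OF open_UNIV q_convex] continuous_on_subset by blast

lemma q_shrink: "0 \<le> s \<Longrightarrow> s \<le> 1 \<Longrightarrow> q (s *\<^sub>R x) \<le> q x"
  using convex_onD[OF q_convex, of s 0 x] q_zero q_nonneg[of x] mult_left_le_one_le[of "q x" s] by simp

lemma q_add_le: "q (x + y) \<le> (q (2 *\<^sub>R x) + q (2 *\<^sub>R y)) / 2"
  using convex_onD[OF q_convex, of "1/2" "2 *\<^sub>R x" "2 *\<^sub>R y"] by simp

section \<open>From gradient bounds at single points to bounds on increments of F\<close>

lemma dir_le_b: "AE t in M. \<forall>v. dir (F t) x v \<le> c x * b t * norm v"
  using F_bound[of x] F_regular
proof eventually_elim
  case (elim t)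
  show ?case
  proof
    fix v
    obtain \<xi> where \<xi>: "\<xi> \<in> clarke_gradient (F t) x" "\<xi> \<bullet> v = dir (F t) x v"
      using clarke_gradient_attains_dir elim(2) by blast
    have "\<xi> \<bullet> v \<le> norm \<xi> * norm v" by (rule norm_cauchy_schwarz)
    also have "\<dots> \<le> c x * b t * norm v"
      using elim(1) \<xi>(1) by (intro mult_right_mono) force+
    finally show "dir (F t) x v \<le> c x * b t * norm v" by (simp add: \<xi>(2))
  qed
qed

text \<open>The hypothesis speaks about F only through elements of the Clarke gradient; attainment
  in direction 0 guarantees that there is one.\<close>

lemma abs_F_le: "AE t in M. \<bar>F t x\<bar> \<le> c x * b t"
  using F_bound[of x] F_regular
proof eventually_elim
  case (elim t)
  obtain \<xi> where "\<xi> \<in> clarke_gradient (F t) x" "\<xi> \<bullet> 0 = dir (F t) x 0"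
    using clarke_gradient_attains_dir elim(2) by blast
  then have "\<bar>F t x\<bar> + norm \<xi> \<le> c x * b t" using elim(1) by blast
  then show ?case using norm_ge_zero[of \<xi>] by linarith
qed

text \<open>Young's inequality for \<xi> / d t and v / K. The free scale K is chosen later, when
  \<open>sublinear_rescaling\<close> makes \<open>K * \<phi> (v / K)\<close> cheap. The sign of d t
  is absorbed by evenness of \<phi>.\<close>

lemma dir_le_d:
  assumes K: "0 < K"
  shows "AE t in M. \<forall>v. dir (F t) x v \<le> \<bar>d t\<bar> * K * (q x + 1 + \<phi> (v /\<^sub>R K))"
  using F_growth[of x] F_regular d_nonzero
proof eventually_elim
  case (elim t)
  show ?case
  proof
    fix v
    obtain \<xi> where \<xi>: "\<xi> \<in> clarke_gradient (F t) x" "\<xi> \<bullet> v = dir (F t) x v"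
      using clarke_gradient_attains_dir elim(2) by blast
    have cj: "cj (\<xi> /\<^sub>R d t) \<le> q x + 1"
      using elim(1) \<xi>(1) by (force simp: conjugate_eq_cj \<phi>\<^sub>0_eq_q)
    have "\<xi> \<bullet> v = d t * K * ((\<xi> /\<^sub>R d t) \<bullet> (v /\<^sub>R K))" using elim(3) K by (simp add: field_simps)
    also have "\<dots> \<le> \<bar>d t\<bar> * K * \<bar>(\<xi> /\<^sub>R d t) \<bullet> (v /\<^sub>R K)\<bar>"
      using K abs_ge_self[of "d t * K * ((\<xi> /\<^sub>R d t) \<bullet> (v /\<^sub>R K))"] by (simp only: abs_mult)
    also have "\<dots> \<le> \<bar>d t\<bar> * K * (q x + 1 + \<phi> (v /\<^sub>R K))"
      using young_abs[of "\<xi> /\<^sub>R d t" "v /\<^sub>R K"] cj K by (intro mult_left_mono) auto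
    finally show "dir (F t) x v \<le> \<bar>d t\<bar> * K * (q x + 1 + \<phi> (v /\<^sub>R K))" by (simp add: \<xi>(2))
  qed
qed

lemma F_increment_le:
  assumes A: "A \<in> borel_measurable M"
    and dir: "\<And>s. 0 \<le> s \<Longrightarrow> s < 1 \<Longrightarrow> AE t in M. dir (F t) (x + s *\<^sub>R v) v \<le> A t"
  shows "AE t in M. F t (x + v) - F t x \<le> A t"
proof -
  have "AE t in M. F t (x + 1 *\<^sub>R v) - F t (x + 0 *\<^sub>R v) \<le> A t"
  proof (rule M.AE_increment_le[OF F_measurable A])
    show "AE t in M. \<exists>L. L-lipschitz_on {0..1} (\<lambda>s::real. F t (x + s *\<^sub>R v))"
      using F_regular by eventually_elim (blast intro: locally_Lipschitz_segment)
    fix s :: real assume s: "0 \<le> s" "s < 1"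
    show "AE t in M. \<exists>D\<le>A t. ((\<lambda>l. (F t (x + (s + l) *\<^sub>R v) - F t (x + s *\<^sub>R v)) / l) \<longlongrightarrow> D) (at_right 0)"
      using F_regular dir[OF s]
    proof eventually_elim
      case (elim t)
      then show ?case
        using dir_tendsto[of "F t" "x + s *\<^sub>R v" v] by (auto simp: scaleR_add_left add.assoc)
    qed
  qed
  then show ?thesis by simp
qed

text \<open>Increments are bounded for pairs in a countable dense subset of the ball, with one null
  set for all pairs; continuity of F t extends the bounds to the ball. C bounds c there, and
  convexity keeps the segments inside.\<close>

lemma F_lipschitz:
  assumes "0 < R"
  obtains C where "0 \<le> C" "AE t in M. (C * b t)-lipschitz_on (ball 0 R) (F t) \<and> (\<forall>x\<in>ball 0 R. \<bar>F t x\<bar> \<le> C * b t)"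
proof -
  obtain C where C: "0 < C" "\<And>x. x \<in> ball 0 R \<Longrightarrow> \<bar>c x\<bar> \<le> C"
    using c_bounded[OF bounded_ball, of 0 R] unfolding bounded_pos by auto
  obtain D :: "'a set" where D: "countable D" and D': "closure D = UNIV"
    using countable_closure_UNIV by blast
  define B where "B = ball 0 R \<inter> D"
  have B: "countable B" unfolding B_def using D by (rule countable_Int2)
  have clB: "closure B = cball 0 R"
    unfolding B_def using closure_open_Int_superset[of "ball 0 R" D] \<open>0 < R\<close> D' by simp
  have "AE t in M. F t y - F t x \<le> C * b t * norm (y - x)" if xy: "x \<in> B" "y \<in> B" for x y
  proof -
    have bm: "(\<lambda>t. C * b t * norm (y - x)) \<in> borel_measurable M"
      using b_integrable by measurable
    have "AE t in M. dir (F t) (x + s *\<^sub>R (y - x)) (y - x) \<le> C * b t * norm (y - x)" if s: "0 \<le> s" "s < 1" for s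
      using dir_le_b[of "x + s *\<^sub>R (y - x)"] AE_in_interval
    proof eventually_elim
      case (elim t)
      have "(1 - s) *\<^sub>R x + s *\<^sub>R y \<in> ball 0 R"
        using xy s convex_ball[of "0::'a" R] unfolding B_def by (intro convexD) auto
      moreover have "(1 - s) *\<^sub>R x + s *\<^sub>R y = x + s *\<^sub>R (y - x)" by (simp add: algebra_simps)
      ultimately have "c (x + s *\<^sub>R (y - x)) \<le> C" using C(2) by (metis abs_le_D1)
      then have "c (x + s *\<^sub>R (y - x)) * b t * norm (y - x) \<le> C * b t * norm (y - x)"
        using b_nonneg[OF elim(2)] by (intro mult_right_mono) auto
      then show ?case using elim(1) by (auto intro: order_trans)
    qed
    from F_increment_le[OF bm this] show ?thesis by simp
  qed
  then have "AE t in M. \<forall>x\<in>B. \<forall>y\<in>B. F t y - F t x \<le> C * b t * norm (y - x)"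
    by (simp add: AE_ball_countable B)
  moreover have "AE t in M. \<forall>x\<in>B. \<bar>F t x\<bar> \<le> c x * b t"
    using abs_F_le by (simp add: AE_ball_countable B)
  ultimately have "AE t in M. (C * b t)-lipschitz_on (ball 0 R) (F t) \<and> (\<forall>x\<in>ball 0 R. \<bar>F t x\<bar> \<le> C * b t)"
    using F_regular AE_in_interval
  proof eventually_elim
    case (elim t)
    have cont: "continuous_on S (F t)" for S using elim(3) by (intro locally_Lipschitz_continuous_on) simp
    have "(C * b t)-lipschitz_on B (F t)"
    proof (rule lipschitz_onI)
      fix x y assume "x \<in> B" "y \<in> B"
      then have "F t y - F t x \<le> C * b t * norm (y - x)" "F t x - F t y \<le> C * b t * norm (y - x)"
        using elim(1) by (auto simp: norm_minus_commute)
      then show "dist (F t x) (F t y) \<le> C * b t * dist x y"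
        by (auto simp: dist_norm norm_minus_commute)
    qed (use C(1) b_nonneg[OF elim(4)] in simp)
    then have "(C * b t)-lipschitz_on (closure B) (F t)" using cont by (rule lipschitz_on_closure)
    then have "(C * b t)-lipschitz_on (ball 0 R) (F t)"
      unfolding clB by (rule lipschitz_on_subset) auto
    moreover have "\<bar>F t x\<bar> \<le> C * b t" if "x \<in> ball 0 R" for x
    proof -
      have "continuous_on (closure B) (\<lambda>x. \<bar>F t x\<bar>)" by (intro continuous_intros cont)
      moreover have "x \<in> closure B" using that by (auto simp: clB)
      ultimately show ?thesis
      proof (rule continuous_le_on_closure)
        fix y assume "y \<in> B"
        then have "\<bar>F t y\<bar> \<le> c y * b t" "c y \<le> C" using elim(2) C(2)[of y] by (auto simp: B_def abs_le_iff)
        then show "\<bar>F t y\<bar> \<le> C * b t"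
          using mult_right_mono[of "c y" C "b t"] b_nonneg[OF elim(4)] by linarith
      qed
    qed
    ultimately show ?case by blast
  qed
  with C(1) show thesis by (intro that[of C]) simp_all
qed

text \<open>The drop from x + v back to x is an increment in direction -v. Along the way the base
  point is x plus a fraction of v, so convexity bounds q there by the mean of its values at 2 x and
  2 v.\<close>

lemma F_lower_bound:
  assumes K: "0 < K"
  shows "AE t in M. \<forall>x v. F t x - \<bar>d t\<bar> * K * ((q (2 *\<^sub>R x) + q (2 *\<^sub>R v)) / 2 + 1 + \<phi> (v /\<^sub>R K)) \<le> F t (x + v)"
proof -
  let ?A = "\<lambda>x v t. \<bar>d t\<bar> * K * ((q (2 *\<^sub>R x) + q (2 *\<^sub>R v)) / 2 + 1 + \<phi> (v /\<^sub>R K))"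
  obtain D :: "'a set" where D: "countable D" and D': "closure D = UNIV"
    using countable_closure_UNIV by blast
  have "AE t in M. F t x - F t (x + v) \<le> ?A x v t" for x v
  proof -
    have Am: "?A x v \<in> borel_measurable M" using d_integrable by measurable
    have "AE t in M. dir (F t) ((x + v) + s *\<^sub>R (- v)) (- v) \<le> ?A x v t" if s: "0 \<le> s" "s < 1" for s
      using dir_le_d[OF K, of "(x + v) + s *\<^sub>R (- v)"]
    proof eventually_elim
      case (elim t)
      have "(x + v) + s *\<^sub>R (- v) = x + (1 - s) *\<^sub>R v" by (simp add: algebra_simps)
      then have "q ((x + v) + s *\<^sub>R (- v)) \<le> (q (2 *\<^sub>R x) + q (2 *\<^sub>R (1 - s) *\<^sub>R v)) / 2"
        by (simp only: q_add_le)
      also have "q (2 *\<^sub>R (1 - s) *\<^sub>R v) \<le> q (2 *\<^sub>R v)"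
        using q_shrink[of "1 - s" "2 *\<^sub>R v"] s by (simp add: mult.commute)
      finally have "\<bar>d t\<bar> * K * (q ((x + v) + s *\<^sub>R (- v)) + 1 + \<phi> ((- v) /\<^sub>R K)) \<le> ?A x v t"
        using K even[of "v /\<^sub>R K"] by (intro mult_left_mono) auto
      then show ?case using elim by (auto intro: order_trans)
    qed
    from F_increment_le[OF Am this] show ?thesis by simp
  qed
  then have "AE t in M. \<forall>x\<in>D. \<forall>v\<in>D. F t x - F t (x + v) \<le> ?A x v t"
    by (simp add: AE_ball_countable D)
  then show ?thesis
    using F_regular
  proof eventually_elim
    case (elim t)
    have cF: "continuous_on S (F t)" for S using elim(2) by (intro locally_Lipschitz_continuous_on) simp
    \<comment> \<open>Joint continuity in x and v carries the inequality from the countable set of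
      pairs to all pairs.\<close>
    let ?G = "\<lambda>p. ?A (fst p) (snd p) t - (F t (fst p) - F t (fst p + snd p))"
    have cont: "continuous_on (closure (D \<times> D)) ?G"
      by (intro continuous_intros continuous_on_compose2[OF cF[of UNIV]] continuous_on_compose2[OF q_continuous_on[of UNIV]]
          continuous_on_compose2[OF continuous_on[of UNIV]]) auto
    have "?G p \<ge> 0" for p
      by (rule continuous_ge_on_closure[OF cont]) (use elim(1) in \<open>auto simp: closure_Times D'\<close>)
    from this[of "(_, _)"] show ?case by (simp add: algebra_simps)
  qed
qed

text \<open>On each cell of a grid in time, u is frozen at the left grid point, which leaves
  countably many functions \<open>F t x\<close> with fixed x. Refining the grid converges by
  continuity of F t and u.\<close>

lemma superposition_measurable:
  assumes u: "continuous_on {0..T} u"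
  shows "(\<lambda>t. F t (u t)) \<in> borel_measurable M"
proof (rule borel_measurable_lebesgue_on_AE_LIMSEQ)
  let ?r = "\<lambda>n t. of_int \<lfloor>real (Suc n) * t\<rfloor> / real (Suc n)"
  show "(\<lambda>t. F t (u (?r n t))) \<in> borel_measurable M" for n
  proof (rule measurable_compose_countable[where f = "\<lambda>i t. F t (u (of_int i / real (Suc n)))"])
    show "(\<lambda>t. \<lfloor>real (Suc n) * t\<rfloor>) \<in> measurable M (count_space UNIV)"
    proof (rule measurable_compose[OF _ measurable_real_floor])
      show "(\<lambda>t. real (Suc n) * t) \<in> borel_measurable M"
        by (intro continuous_imp_measurable_on_sets_lebesgue continuous_intros) simp
    qed
  qed (rule F_measurable)
  have r: "?r n t \<in> {0..T}" "\<bar>?r n t - t\<bar> \<le> 1 / real (Suc n)" if "t \<in> {0..T}" for n t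
  proof -
    have "of_int \<lfloor>real (Suc n) * t\<rfloor> \<le> real (Suc n) * t" "real (Suc n) * t < of_int \<lfloor>real (Suc n) * t\<rfloor> + 1" by linarith+
    then have 1: "?r n t \<le> t" "t \<le> ?r n t + 1 / real (Suc n)" by (simp_all add: field_simps)
    moreover have "0 \<le> ?r n t" using that by simp
    ultimately show "?r n t \<in> {0..T}" using that by auto
    show "\<bar>?r n t - t\<bar> \<le> 1 / real (Suc n)" using 1 by (simp add: abs_le_iff)
  qed
  show "AE t in M. (\<lambda>n. F t (u (?r n t))) \<longlonglongrightarrow> F t (u t)"
    using F_regular AE_in_interval
  proof eventually_elim
    case (elim t)
    have "(\<lambda>n. ?r n t - t) \<longlonglongrightarrow> 0"
      by (rule Lim_null_comparison[OF _ LIMSEQ_Suc[OF lim_const_over_n[of 1]]]) (use r(2)[OF elim(2)] in simp)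
    then have lim: "(\<lambda>n. ?r n t) \<longlonglongrightarrow> t" by (rule LIM_zero_cancel)
    have "continuous_on UNIV (F t)" using elim(1) by (intro locally_Lipschitz_continuous_on) simp
    from continuous_on_compose2[OF this u subset_UNIV]
    have "continuous_on {0..T} (\<lambda>s. F t (u s))" .
    from continuous_on_tendsto_compose[OF this lim elim(2) always_eventually]
    show ?case using r(1)[OF elim(2)] by blast
  qed
qed simp

end


section \<open>Jensen's inequality and coercivity of the action\<close>

lemma integrable_lebesgue_on_iff:
  fixes f :: "real \<Rightarrow> 'b::euclidean_space"
  assumes "S \<in> sets lebesgue"
  shows "integrable (lebesgue_on S) f \<longleftrightarrow> f absolutely_integrable_on S"
  using assms by (simp add: integrable_restrict_space set_integrable_def)

context nonsmooth_problem
begin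

abbreviation W :: "(real \<Rightarrow> 'a) set" where "W \<equiv> periodic_Orlicz_Sobolev_space T (\<lambda>x. ereal (\<phi> x))"

abbreviation energy :: "(real \<Rightarrow> 'a) \<Rightarrow> real" where
  "energy u \<equiv> (\<integral>t. \<phi> (weak_deriv T u t) \<partial>M)"

lemma integrable_M_iff:
  fixes f :: "real \<Rightarrow> 'b::euclidean_space"
  shows "integrable M f \<longleftrightarrow> f absolutely_integrable_on {0..T}"
  by (rule integrable_lebesgue_on_iff) simp

lemma integral_M_eq:
  fixes f :: "real \<Rightarrow> 'b::euclidean_space"
  shows "integrable M f \<Longrightarrow> (\<integral>t. f t \<partial>M) = integral {0..T} f"
  by (rule lebesgue_integral_eq_integral) auto

lemma integrable_M_sub:
  fixes f :: "real \<Rightarrow> 'b::euclidean_space"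
  assumes "integrable M f" "0 \<le> s" "t \<le> T"
  shows "f integrable_on {s..t}"
proof -
  have "f integrable_on {0..T}"
    using assms(1) unfolding integrable_M_iff absolutely_integrable_on_def by blast
  then show ?thesis by (rule integrable_on_subinterval) (use assms in auto)
qed

lemma weak_deriv_integrable:
  assumes "absolutely_continuous_on 0 T u"
  shows "integrable M (weak_deriv T u)"
  using absolutely_continuous_on_FTC(2)[OF T assms] by (simp add: integrable_M_iff)

lemma \<phi>_measurable [measurable]: "\<phi> \<in> borel_measurable borel"
  by (intro borel_measurable_continuous_onI continuous_on)

lemma dilation_integrable:
  assumes u: "u \<in> borel_measurable M" and i: "integrable M (\<lambda>t. \<phi> (l *\<^sub>R u t))" and l: "l \<noteq> 0"
  shows "integrable M (\<lambda>t. \<phi> (k *\<^sub>R u t))"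
proof -
  obtain A B where AB: "A \<ge> 0" "B \<ge> 0" "\<And>z. \<phi> ((k / l) *\<^sub>R z) \<le> A * \<phi> z + B" using dilation[of "k / l"] by blast
  show ?thesis
  proof (rule Bochner_Integration.integrable_bound)
    show "integrable M (\<lambda>t. A * \<phi> (l *\<^sub>R u t) + B)" using i by simp
    show "(\<lambda>t. \<phi> (k *\<^sub>R u t)) \<in> borel_measurable M" using u by measurable
    show "AE t in M. norm (\<phi> (k *\<^sub>R u t)) \<le> norm (A * \<phi> (l *\<^sub>R u t) + B)"
    proof (rule AE_I2)
      fix t
      have "\<phi> (k *\<^sub>R u t) \<le> A * \<phi> (l *\<^sub>R u t) + B" using AB(3)[of "l *\<^sub>R u t"] l by simp
      then show "norm (\<phi> (k *\<^sub>R u t)) \<le> norm (A * \<phi> (l *\<^sub>R u t) + B)"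
        using nonneg[of "k *\<^sub>R u t"] by simp
    qed
  qed
qed

text \<open>Under the doubling condition the Orlicz space is the set of functions with finite
  modular: integrability at one nonzero scale l gives it at every scale, in particular at 1.\<close>

lemma W_iff:
  "u \<in> W \<longleftrightarrow> absolutely_continuous_on 0 T u \<and> u 0 = u T \<and> integrable M (\<lambda>t. \<phi> (weak_deriv T u t))"
proof
  assume u: "u \<in> W"
  then have ac: "absolutely_continuous_on 0 T u" and per: "u 0 = u T" and O: "weak_deriv T u \<in> Orlicz_space T (\<lambda>x. ereal (\<phi> x))"
    by (auto simp: periodic_Orlicz_Sobolev_space_def Orlicz_Sobolev_space_def)
  obtain l where m: "weak_deriv T u \<in> borel_measurable M" and l: "0 < l" "(\<integral>\<^sup>+t. ennreal (\<phi> (l *\<^sub>R weak_deriv T u t)) \<partial>M) < \<infinity>"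
    using O unfolding Orlicz_space_def by (auto simp: e2ennreal_ereal)
  have "integrable M (\<lambda>t. \<phi> (l *\<^sub>R weak_deriv T u t))"
  proof (rule integrableI_nonneg)
    show "(\<lambda>t. \<phi> (l *\<^sub>R weak_deriv T u t)) \<in> borel_measurable M" using m by measurable
  qed (use l nonneg in auto)
  from dilation_integrable[OF m this, of 1]
  have "integrable M (\<lambda>t. \<phi> (1 *\<^sub>R weak_deriv T u t))"
    using l(1) by simp
  then show "absolutely_continuous_on 0 T u \<and> u 0 = u T \<and> integrable M (\<lambda>t. \<phi> (weak_deriv T u t))"
    using ac per by simp
next
  assume *: "absolutely_continuous_on 0 T u \<and> u 0 = u T \<and> integrable M (\<lambda>t. \<phi> (weak_deriv T u t))"
  then have "weak_deriv T u \<in> borel_measurable M"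
    by (intro borel_measurable_integrable weak_deriv_integrable) simp
  moreover have "(\<integral>\<^sup>+t. e2ennreal (ereal (\<phi> (1 *\<^sub>R weak_deriv T u t))) \<partial>M) < \<infinity>"
    using * nonneg by (simp add: nn_integral_eq_integral e2ennreal_ereal)
  ultimately have "weak_deriv T u \<in> Orlicz_space T (\<lambda>x. ereal (\<phi> x))"
    unfolding Orlicz_space_def by (blast intro: zero_less_one)
  then show "u \<in> W"
    using * unfolding periodic_Orlicz_Sobolev_space_def Orlicz_Sobolev_space_def by blast
qed

lemma W_continuous_on: "u \<in> W \<Longrightarrow> continuous_on {0..T} u"
  using W_iff absolutely_continuous_on_imp_uniformly_continuous_on uniformly_continuous_imp_continuous by blast

lemma energy_nonneg: "0 \<le> energy u"
  using nonneg by (intro Bochner_Integration.integral_nonneg)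

text \<open>The affine function supporting \<phi> at the mean slope z is integrated over {s..t}; its
  linear part integrates to the increment of u.\<close>

lemma jensen:
  assumes u: "u \<in> W" and st: "0 \<le> s" "s < t" "t \<le> T"
  shows "(t - s) * \<phi> ((u t - u s) /\<^sub>R (t - s)) \<le> integral {s..t} (\<lambda>r. \<phi> (weak_deriv T u r))"
proof -
  define z where "z = (u t - u s) /\<^sub>R (t - s)"
  define g where "g = grad \<phi> z"
  have "(weak_deriv T u has_integral u t - u s) {s..t}"
    using u st by (intro absolutely_continuous_on_FTC(3)[OF T]) (auto simp: W_iff)
  from has_integral_linear[OF this bounded_linear_inner_right[of g]]
  have 1: "((\<lambda>r. g \<bullet> weak_deriv T u r) has_integral g \<bullet> (u t - u s)) {s..t}" by (simp add: o_def)
  have 2: "((\<lambda>r. \<phi> z - g \<bullet> z) has_integral (t - s) * (\<phi> z - g \<bullet> z)) {s..t}"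
    using has_integral_const_real[of "\<phi> z - g \<bullet> z" s t] st by simp
  have "(t - s) * (g \<bullet> z) = g \<bullet> (u t - u s)" using st by (simp add: z_def)
  then have 3: "((\<lambda>r. g \<bullet> weak_deriv T u r + (\<phi> z - g \<bullet> z)) has_integral (t - s) * \<phi> z) {s..t}"
    using has_integral_add[OF 1 2] by (simp add: right_diff_distrib)
  have "(\<lambda>r. \<phi> (weak_deriv T u r)) integrable_on {s..t}"
    using u st by (intro integrable_M_sub) (auto simp: W_iff)
  then show ?thesis
    unfolding z_def[symmetric]
  proof (rule has_integral_le[OF 3 integrable_integral])
    fix r
    show "g \<bullet> weak_deriv T u r + (\<phi> z - g \<bullet> z) \<le> \<phi> (weak_deriv T u r)"
      using grad_le[of z "weak_deriv T u r - z"] by (simp add: inner_diff_right g_def)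
  qed
qed

lemma integral_le_energy:
  assumes u: "u \<in> W" and st: "0 \<le> s" "t \<le> T"
  shows "integral {s..t} (\<lambda>r. \<phi> (weak_deriv T u r)) \<le> energy u"
proof -
  have i: "integrable M (\<lambda>r. \<phi> (weak_deriv T u r))" using u by (simp add: W_iff)
  then show ?thesis
    unfolding integral_M_eq[OF i]
    using st nonneg by (intro integral_subset_le integrable_M_sub) auto
qed

text \<open>Superlinearity with slope 1 / e, applied to the mean slope. The constant C depends on e
  alone, so the estimate makes sets of bounded energy equi-absolutely continuous.\<close>

lemma increment_le:
  assumes "0 < e"
  obtains C where "0 \<le> C" "\<And>u s t. u \<in> W \<Longrightarrow> 0 \<le> s \<Longrightarrow> s \<le> t \<Longrightarrow> t \<le> T \<Longrightarrow>
    norm (u t - u s) \<le> e * integral {s..t} (\<lambda>r. \<phi> (weak_deriv T u r)) + C * (t - s)"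
proof -
  obtain C where C: "0 \<le> C" "\<And>z. 1 / e * norm z \<le> \<phi> z + C" using superlinear[of "1 / e"] by blast
  have "norm (u t - u s) \<le> e * integral {s..t} (\<lambda>r. \<phi> (weak_deriv T u r)) + (e * C) * (t - s)"
    if u: "u \<in> W" and st: "0 \<le> s" "s \<le> t" "t \<le> T" for u s t
  proof (cases "s = t")
    case False
    then have lt: "s < t" using st by simp
    let ?z = "(u t - u s) /\<^sub>R (t - s)"
    have "norm (u t - u s) = (t - s) * norm ?z" using lt by simp
    also have "\<dots> \<le> (t - s) * (e * (\<phi> ?z + C))"
      using C(2)[of ?z] lt \<open>0 < e\<close> by (intro mult_left_mono) (auto simp: field_simps)
    also have "\<dots> = e * ((t - s) * \<phi> ?z) + (e * C) * (t - s)" by (simp add: algebra_simps)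
    also have "\<dots> \<le> e * integral {s..t} (\<lambda>r. \<phi> (weak_deriv T u r)) + (e * C) * (t - s)"
      using jensen[OF u st(1) lt st(3)] \<open>0 < e\<close> by simp
    finally show ?thesis .
  qed simp
  then show thesis using that[of "e * C"] C(1) \<open>0 < e\<close> by simp
qed

text \<open>Jensen on {0..t} controls the slope over length t; convexity permits replacing t by the
  larger T, which makes the bound uniform in t.\<close>

lemma shrink_increment_le:
  assumes u: "u \<in> W" and t: "t \<in> {0..T}"
  shows "\<phi> ((u t - u 0) /\<^sub>R T) \<le> energy u / T"
proof (cases "t = 0")
  case True
  then show ?thesis using T energy_nonneg by (simp add: zero)
next
  case False
  then have t0: "0 < t" using t by simp
  let ?z = "(u t - u 0) /\<^sub>R t"
  have eq: "(u t - u 0) /\<^sub>R T = (t / T) *\<^sub>R ?z" using t0 by (simp add: divide_inverse)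
  have "\<phi> ((u t - u 0) /\<^sub>R T) \<le> (t / T) * \<phi> ?z"
    unfolding eq using t t0 T by (intro shrink) auto
  also have "\<dots> = (t * \<phi> ?z) / T" by simp
  also have "\<dots> \<le> energy u / T"
    using jensen[OF u, of 0 t] integral_le_energy[OF u, of 0 t] t t0 T by (intro divide_right_mono) auto
  finally show ?thesis .
qed

lemma F_integrable:
  assumes u: "continuous_on {0..T} u"
  shows "integrable M (\<lambda>t. F t (u t))"
proof -
  have "bounded (u ` {0..T})" using u by (intro compact_imp_bounded compact_continuous_image) auto
  then obtain R where R: "R > 0" "\<And>t. t \<in> {0..T} \<Longrightarrow> norm (u t) < R"
    unfolding bounded_pos_less by auto
  obtain C where "AE t in M. (C * b t)-lipschitz_on (ball 0 R) (F t) \<and> (\<forall>x\<in>ball 0 R. \<bar>F t x\<bar> \<le> C * b t)"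
    using F_lipschitz[OF R(1)] by blast
  then have ae: "AE t in M. norm (F t (u t)) \<le> norm (C * b t)"
    using AE_in_interval
  proof eventually_elim
    case (elim t)
    then have "\<bar>F t (u t)\<bar> \<le> C * b t" using R(2)[of t] by auto
    then show ?case by simp
  qed
  have "integrable M (\<lambda>t. C * b t)" using b_integrable by simp
  from Bochner_Integration.integrable_bound[OF this superposition_measurable[OF u] ae]
  show ?thesis .
qed

lemma q_bounded_on_ball: "\<exists>B. \<forall>x\<in>cball 0 R. q x \<le> B"
proof -
  have "bounded (q ` cball 0 R)"
    by (intro compact_imp_bounded compact_continuous_image q_continuous_on compact_cball)
  then obtain B where "\<forall>y\<in>q ` cball 0 R. norm y \<le> B" unfolding bounded_iff by blast
  then have "\<forall>x\<in>cball 0 R. q x \<le> B" using abs_le_D1 unfolding real_norm_def by blast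
  then show ?thesis ..
qed

lemma q_at_infinity: "filterlim q at_top at_infinity"
proof -
  have "(\<phi>\<^sub>0 \<longlongrightarrow> \<infinity>) at_infinity"
    using G_function_0 unfolding G_function_def by blast
  moreover have "\<phi>\<^sub>0 = (\<lambda>x. ereal (q x))" by (rule ext) (rule \<phi>\<^sub>0_eq_q)
  ultimately have "((\<lambda>x. ereal (q x)) \<longlongrightarrow> \<infinity>) at_infinity" by (simp only:)
  then show ?thesis unfolding tendsto_PInfty filterlim_at_top_dense by simp
qed

text \<open>For large x the integral exceeds C + 1 times \<open>q (2 x)\<close>, so at least one
  copy of \<open>q (2 x)\<close> remains, and it tends to infinity.\<close>

lemma mean_F_coercive:
  "filterlim (\<lambda>x. (\<integral>t. F t x \<partial>M) - C * q (2 *\<^sub>R x)) at_top at_infinity"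
proof -
  have q2: "filterlim (\<lambda>x. q (2 *\<^sub>R x)) at_top at_infinity"
  proof (rule filterlim_compose[OF q_at_infinity])
    show "filterlim (\<lambda>x::'a. 2 *\<^sub>R x) at_infinity at_infinity"
      unfolding filterlim_at_infinity[OF order_refl] eventually_at_infinity
    proof (intro allI impI)
      fix r :: real
      show "\<exists>b. \<forall>x::'a. b \<le> norm x \<longrightarrow> r \<le> norm (2 *\<^sub>R x)"
        by (intro exI[of _ "\<bar>r\<bar>"]) auto
    qed
  qed
  have "eventually (\<lambda>x. 1 / \<phi>\<^sub>0 (2 *\<^sub>R x) * ereal (\<integral>t. F t x \<partial>M) > ereal (C + 1)) at_infinity"
    using F_coercive unfolding tendsto_PInfty by blast
  moreover have "eventually (\<lambda>x. q (2 *\<^sub>R x) > 0) at_infinity"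
    using q2 unfolding filterlim_at_top_dense by blast
  ultimately have "eventually (\<lambda>x. q (2 *\<^sub>R x) \<le> (\<integral>t. F t x \<partial>M) - C * q (2 *\<^sub>R x)) at_infinity"
  proof eventually_elim
    case (elim x)
    have "1 / \<phi>\<^sub>0 (2 *\<^sub>R x) = ereal (1 / q (2 *\<^sub>R x))"
      using elim(2) by (simp add: \<phi>\<^sub>0_eq_q one_ereal_def)
    then have "C + 1 < 1 / q (2 *\<^sub>R x) * (\<integral>t. F t x \<partial>M)" using elim(1) by simp
    then have "(C + 1) * q (2 *\<^sub>R x) < (\<integral>t. F t x \<partial>M)" using elim(2) by (simp add: field_simps)
    then show ?case by (simp add: algebra_simps)
  qed
  then show ?thesis by (rule filterlim_at_top_mono[OF q2])
qed

text \<open>Two terms of \<open>F_lower_bound\<close> grow with the energy: the one with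
  \<open>\<phi> (v / K)\<close> and the one with \<open>q (2 v)\<close>. The constants make each
  cost at most a quarter of it.\<close>

lemma action_lower_bound:
  obtains C1 C2 where "\<And>u. u \<in> W \<Longrightarrow>
    energy u / 2 + ((\<integral>t. F t (u 0) \<partial>M) - C1 * q (2 *\<^sub>R u 0)) - C2 \<le> action T \<phi> F u"
proof -
  define N where "N = (\<integral>t. \<bar>d t\<bar> \<partial>M)"
  have N: "0 \<le> N" unfolding N_def by simp
  \<comment> \<open>N is the total mass of d, so the rescaled \<phi> term costs at most N \<theta>,
    which is at most 1/4 of the energy.\<close>
  define \<theta> where "\<theta> = 1 / (4 * (N + 1))"
  have \<theta>: "0 < \<theta>" "N * \<theta> \<le> 1 / 4" using N by (auto simp: \<theta>_def field_simps)
  obtain R C where R: "R > 0" "C \<ge> 0" "\<And>z. R * \<phi> (z /\<^sub>R R) \<le> \<theta> * \<phi> z + C"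
    using sublinear_rescaling[OF \<theta>(1)] by blast
  \<comment> \<open>The factor T matches \<open>shrink_increment_le\<close>, which bounds \<phi> at
    v / T; the factor R is the scale of \<open>sublinear_rescaling\<close>.\<close>
  define K where "K = T * R"
  have K: "0 < K" using T R by (simp add: K_def)
  \<comment> \<open>With this s the q term costs N K s / (2 T) times the energy, which is at most a
    quarter. The bound s \<le> 1 is needed for \<open>shrink\<close>.\<close>
  define s where "s = min 1 (T / (2 * K * (N + 1)))"
  have s: "0 < s" "s \<le> 1" "N * K * s \<le> T / 2"
  proof -
    show "0 < s" "s \<le> 1" using T K N by (auto simp: s_def)
    have "N * K * s \<le> N * K * (T / (2 * K * (N + 1)))"
      using N K by (intro mult_left_mono) (auto simp: s_def)
    also have "N * K * (T / (2 * K * n)) = (N / n) * (T / 2)" if "0 < n" for n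
      using K that by (simp add: field_simps)
    then have "N * K * (T / (2 * K * (N + 1))) = (N / (N + 1)) * (T / 2)" using N by simp
    also have "\<dots> \<le> 1 * (T / 2)" using N T by (intro mult_right_mono) auto
    finally show "N * K * s \<le> T / 2" by simp
  qed
  \<comment> \<open>The scale s / (2 T) sends 2 v to s times v / T, whose \<phi> is at most s times
    the energy divided by T.\<close>
  obtain C' where C': "C' > 0" "\<And>x. q x \<le> C' + \<phi> ((s / (2 * T)) *\<^sub>R x)"
    using q_much_less[of "s / (2 * T)"] s T by auto
  define C1 where "C1 = N * K / 2"
  define C2 where "C2 = N * (K * C' / 2 + K + T * C)"
  have "energy u / 2 + ((\<integral>t. F t (u 0) \<partial>M) - C1 * q (2 *\<^sub>R u 0)) - C2 \<le> action T \<phi> F u" if u: "u \<in> W" for u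
  proof -
    let ?E = "energy u"
    define B where "B = K * q (2 *\<^sub>R u 0) / 2 + K * (C' + s * ?E / T) / 2 + K + (\<theta> * ?E + T * C)"
    have bound: "K * ((q (2 *\<^sub>R u 0) + q (2 *\<^sub>R (u t - u 0))) / 2 + 1 + \<phi> ((u t - u 0) /\<^sub>R K)) \<le> B" if t: "t \<in> {0..T}" for t
    proof -
      let ?z = "(u t - u 0) /\<^sub>R T"
      have z: "\<phi> ?z \<le> ?E / T" by (rule shrink_increment_le[OF u t])
      have "K * \<phi> ((u t - u 0) /\<^sub>R K) = T * (R * \<phi> (?z /\<^sub>R R))" by (simp add: K_def mult.commute)
      also have "\<dots> \<le> T * (\<theta> * \<phi> ?z + C)" using T by (intro mult_left_mono R(3)) simp
      also have "\<dots> \<le> T * (\<theta> * (?E / T) + C)"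
        using z \<theta>(1) T by (intro mult_left_mono add_right_mono) auto
      also have "\<dots> = \<theta> * ?E + T * C" using T by (simp add: field_simps)
      finally have 1: "K * \<phi> ((u t - u 0) /\<^sub>R K) \<le> \<theta> * ?E + T * C" .
      have "(s / (2 * T)) *\<^sub>R 2 *\<^sub>R (u t - u 0) = s *\<^sub>R ?z" by (simp add: field_simps)
      then have "q (2 *\<^sub>R (u t - u 0)) \<le> C' + \<phi> (s *\<^sub>R ?z)" by (metis C'(2))
      also have "\<phi> (s *\<^sub>R ?z) \<le> s * \<phi> ?z" using s by (intro shrink) auto
      also have "s * \<phi> ?z \<le> s * (?E / T)" using z s by (intro mult_left_mono) auto
      finally have 2: "K * q (2 *\<^sub>R (u t - u 0)) \<le> K * (C' + s * ?E / T)"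
        using K by (intro mult_left_mono) auto
      have "K * ((x + y) / 2 + 1 + z) = K * x / 2 + K * y / 2 + K + K * z" for x y z
        by (simp add: field_simps)
      moreover have "K * q (2 *\<^sub>R (u t - u 0)) / 2 \<le> K * (C' + s * ?E / T) / 2"
        using 2 by (rule divide_right_mono) simp
      ultimately show ?thesis unfolding B_def by (simp only:) (intro add_mono order_refl 1)
    qed
    have "AE t in M. F t (u 0) - \<bar>d t\<bar> * B \<le> F t (u t)"
      using F_lower_bound[OF K] AE_in_interval
    proof eventually_elim
      case (elim t)
      have "F t (u 0) - \<bar>d t\<bar> * K * ((q (2 *\<^sub>R u 0) + q (2 *\<^sub>R (u t - u 0))) / 2 + 1 + \<phi> ((u t - u 0) /\<^sub>R K)) \<le> F t (u 0 + (u t - u 0))"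
        using elim(1) by blast
      moreover have "\<bar>d t\<bar> * (K * ((q (2 *\<^sub>R u 0) + q (2 *\<^sub>R (u t - u 0))) / 2 + 1 + \<phi> ((u t - u 0) /\<^sub>R K))) \<le> \<bar>d t\<bar> * B"
        using bound[OF elim(2)] by (intro mult_left_mono) auto
      ultimately show ?case by (simp add: mult.assoc)
    qed
    then have "(\<integral>t. F t (u 0) - \<bar>d t\<bar> * B \<partial>M) \<le> (\<integral>t. F t (u t) \<partial>M)"
      using F_integrable[of "\<lambda>_. u 0"] F_integrable[OF W_continuous_on[OF u]] d_integrable
      by (intro integral_mono_AE) auto
    moreover have "(\<integral>t. F t (u 0) - \<bar>d t\<bar> * B \<partial>M) = (\<integral>t. F t (u 0) \<partial>M) - N * B"
      using F_integrable[of "\<lambda>_. u 0"] d_integrable by (simp add: N_def)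
    moreover have "N * B \<le> ?E / 2 + C1 * q (2 *\<^sub>R u 0) + C2"
    proof -
      have "N * K * s * (?E / (2 * T)) \<le> T / 2 * (?E / (2 * T))"
        using s(3) energy_nonneg T by (intro mult_right_mono) auto
      also have "\<dots> = ?E / 4" using T by simp
      finally have 1: "N * K * s * (?E / (2 * T)) \<le> ?E / 4" .
      have 2: "N * \<theta> * ?E \<le> 1 / 4 * ?E" using \<theta>(2) energy_nonneg by (intro mult_right_mono) auto
      have "N * B = C1 * q (2 *\<^sub>R u 0) + C2 + N * K * s * (?E / (2 * T)) + N * \<theta> * ?E"
        by (simp add: B_def C1_def C2_def algebra_simps add_divide_distrib)
      then show ?thesis using 1 2 by linarith
    qed
    ultimately show ?thesis unfolding action_def by simp
  qed
  then show thesis by (rule that)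
qed

text \<open>The lower bound splits into half the energy and a function of u 0 alone. The latter is
  bounded below, by coercivity outside a ball and by \<open>F_lipschitz\<close> inside, so each part
  is bounded once the action is.\<close>

lemma action_coercive:
  obtains R where "0 < R" "\<And>u. u \<in> W \<Longrightarrow> action T \<phi> F u \<le> A \<Longrightarrow> energy u \<le> R \<and> norm (u 0) \<le> R"
    and "\<exists>m. \<forall>u\<in>W. m \<le> action T \<phi> F u"
proof -
  obtain C1 C2 where C: "\<And>u. u \<in> W \<Longrightarrow>
    energy u / 2 + ((\<integral>t. F t (u 0) \<partial>M) - C1 * q (2 *\<^sub>R u 0)) - C2 \<le> action T \<phi> F u"
    using action_lower_bound by blast
  let ?H = "\<lambda>x. (\<integral>t. F t x \<partial>M) - C1 * q (2 *\<^sub>R x)"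
  have "\<exists>r>0. \<forall>x. norm x \<ge> r \<longrightarrow> ?H x \<ge> B" for B
    using mean_F_coercive[of C1] unfolding filterlim_at_top eventually_at_infinity_pos by blast
  note large = this
  have "\<exists>B. \<forall>x. B \<le> ?H x"
  proof -
    obtain r where r: "r > 0" "\<And>x. norm x \<ge> r \<Longrightarrow> ?H x \<ge> 0" using large[of 0] by blast
    obtain D where D: "AE t in M. (D * b t)-lipschitz_on (ball 0 r) (F t) \<and> (\<forall>x\<in>ball 0 r. \<bar>F t x\<bar> \<le> D * b t)"
      using F_lipschitz[OF r(1)] by blast
    obtain Q where Q: "\<And>x. x \<in> cball 0 (2 * r) \<Longrightarrow> q x \<le> Q" using q_bounded_on_ball by blast
    define B where "B = (\<integral>t. D * b t \<partial>M) + \<bar>C1\<bar> * Q"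
    have low: "- B \<le> ?H x" if x: "norm x < r" for x
    proof -
      have "AE t in M. - (D * b t) \<le> F t x"
        using D by eventually_elim (use x in \<open>auto simp: abs_le_iff minus_le_iff\<close>)
      then have "(\<integral>t. - (D * b t) \<partial>M) \<le> (\<integral>t. F t x \<partial>M)"
        using F_integrable[of "\<lambda>_. x"] b_integrable by (intro integral_mono_AE) auto
      moreover have "C1 * q (2 *\<^sub>R x) \<le> \<bar>C1\<bar> * q (2 *\<^sub>R x)" using q_nonneg by (intro mult_right_mono) auto
      moreover have "\<bar>C1\<bar> * q (2 *\<^sub>R x) \<le> \<bar>C1\<bar> * Q" using Q[of "2 *\<^sub>R x"] x by (intro mult_left_mono) auto
      ultimately show ?thesis by (simp add: B_def)
    qed
    have "- \<bar>B\<bar> \<le> ?H x" for x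
      using low[of x] r(2)[of x] by (cases "norm x < r") auto
    then show ?thesis by blast
  qed
  then obtain B where B: "\<And>x. B \<le> ?H x" by blast
  have bb: "\<exists>m. \<forall>u\<in>W. m \<le> action T \<phi> F u"
  proof (intro exI ballI)
    fix u assume "u \<in> W"
    then show "B - C2 \<le> action T \<phi> F u" using C[of u] B[of "u 0"] energy_nonneg[of u] by linarith
  qed
  obtain r where r: "r > 0" "\<And>x. norm x \<ge> r \<Longrightarrow> ?H x \<ge> A + C2 + 1" using large by blast
  have E: "energy u \<le> 2 * (A + C2 - B)" if "u \<in> W" "action T \<phi> F u \<le> A" for u
    using C[OF that(1)] B[of "u 0"] that(2) by (simp add: field_simps)
  have N: "norm (u 0) \<le> r" if "u \<in> W" "action T \<phi> F u \<le> A" for u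
    using C[OF that(1)] r(2)[of "u 0"] that(2) energy_nonneg[of u] by (cases "norm (u 0) \<ge> r") auto
  show thesis
  proof (rule that[OF _ _ bb])
    show "0 < max r (2 * (A + C2 - B))" using r(1) by simp
    show "energy u \<le> max r (2 * (A + C2 - B)) \<and> norm (u 0) \<le> max r (2 * (A + C2 - B))"
      if "u \<in> W" "action T \<phi> F u \<le> A" for u
      using E[OF that] N[OF that] by auto
  qed
qed

end


section \<open>Lower semicontinuity of the energy through partitions\<close>

text \<open>As t lies between l n and r n, the remainders at the two ends add up to a small multiple
  of the full length. Either end may equal t, so one-sided quotients are included.\<close>

lemma has_vector_derivative_straddle:
  fixes u :: "real \<Rightarrow> 'b::real_normed_vector"
  assumes u: "(u has_vector_derivative D) (at t within S)"
    and mem: "\<And>n. l n \<in> S" "\<And>n. r n \<in> S"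
    and le: "\<And>n. l n \<le> t" "\<And>n. t \<le> r n" "\<And>n. l n < r n"
    and lim: "l \<longlonglongrightarrow> t" "r \<longlonglongrightarrow> t"
  shows "(\<lambda>n. (u (r n) - u (l n)) /\<^sub>R (r n - l n)) \<longlonglongrightarrow> D"
proof (rule LIMSEQ_I)
  fix e :: real assume e: "0 < e"
  then have "0 < e / 2" by simp
  then obtain d where d: "d > 0" "\<And>y. y \<in> S \<Longrightarrow> norm (y - t) < d \<Longrightarrow> norm (u y - u t - (y - t) *\<^sub>R D) \<le> e / 2 * norm (y - t)"
    using u unfolding has_vector_derivative_def has_derivative_within_alt by meson
  have "eventually (\<lambda>n. norm (l n - t) < d) sequentially" "eventually (\<lambda>n. norm (r n - t) < d) sequentially"
    using tendstoD[OF lim(1) d(1)] tendstoD[OF lim(2) d(1)] by (simp_all add: dist_norm)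
  then have "eventually (\<lambda>n. norm ((u (r n) - u (l n)) /\<^sub>R (r n - l n) - D) < e) sequentially"
  proof eventually_elim
    case (elim n)
    have pos: "0 < r n - l n" using le by simp
    have "norm ((u (r n) - u t - (r n - t) *\<^sub>R D) - (u (l n) - u t - (l n - t) *\<^sub>R D))
      \<le> e / 2 * norm (r n - t) + e / 2 * norm (l n - t)"
      using d(2)[OF mem(1) elim(1)] d(2)[OF mem(2) elim(2)] norm_triangle_ineq4 by (meson add_mono order_trans)
    also have "\<dots> = e / 2 * ((r n - t) + (t - l n))"
      using le(1)[of n] le(2)[of n] by (simp only: distrib_left) simp
    also have "\<dots> = e / 2 * (r n - l n)" by simp
    finally have "norm ((u (r n) - u (l n)) - (r n - l n) *\<^sub>R D) \<le> e / 2 * (r n - l n)"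
      by (simp add: algebra_simps)
    moreover have "norm ((u (r n) - u (l n)) - (r n - l n) *\<^sub>R D) = (r n - l n) * norm ((u (r n) - u (l n)) /\<^sub>R (r n - l n) - D)"
    proof -
      have "(u (r n) - u (l n)) - (r n - l n) *\<^sub>R D = (r n - l n) *\<^sub>R ((u (r n) - u (l n)) /\<^sub>R (r n - l n) - D)"
        using pos by (simp add: scaleR_diff_right)
      then show ?thesis using pos by simp
    qed
    ultimately have "(r n - l n) * norm ((u (r n) - u (l n)) /\<^sub>R (r n - l n) - D) \<le> (r n - l n) * (e / 2)"
      by (simp add: mult.commute)
    then have "norm ((u (r n) - u (l n)) /\<^sub>R (r n - l n) - D) \<le> e / 2" using pos by simp
    then show ?case using e by simp
  qed
  then show "\<exists>no. \<forall>n\<ge>no. norm ((u (r n) - u (l n)) /\<^sub>R (r n - l n) - D) < e"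
    unfolding eventually_sequentially .
qed

context nonsmooth_problem
begin

lemma weak_deriv_eq:
  assumes "(v has_vector_derivative D) (at t within {0..T})" "t \<in> {0..T}"
  shows "weak_deriv T v t = D"
  using assms T by (intro vector_derivative_within_cbox[of 0 T, unfolded cbox_interval]) auto

definition node :: "nat \<Rightarrow> nat \<Rightarrow> real" where "node N i = T * real i / real N"

definition quotient :: "nat \<Rightarrow> (real \<Rightarrow> 'a) \<Rightarrow> nat \<Rightarrow> 'a" where
  "quotient N u i = (u (node N (Suc i)) - u (node N i)) /\<^sub>R (node N (Suc i) - node N i)"

definition partition_energy :: "nat \<Rightarrow> (real \<Rightarrow> 'a) \<Rightarrow> real" where
  "partition_energy N u = (\<Sum>i<N. (node N (Suc i) - node N i) * \<phi> (quotient N u i))"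

text \<open>At t = T the index is N, whose cell lies beyond T. This single point is discarded
  whenever the function is integrated or its limit is taken.\<close>

definition step_quotient :: "nat \<Rightarrow> (real \<Rightarrow> 'a) \<Rightarrow> real \<Rightarrow> 'a" where
  "step_quotient N u t = quotient N u (nat \<lfloor>real N * t / T\<rfloor>)"

lemma node_simps: "node N 0 = 0" "0 < N \<Longrightarrow> node N N = T" "0 \<le> node N i"
  "0 < N \<Longrightarrow> node N i < node N (Suc i)" "i \<le> N \<Longrightarrow> node N i \<le> T"
  "node N (Suc i) - node N i = T / real N"
proof -
  show "i \<le> N \<Longrightarrow> node N i \<le> T"
    using T by (cases "N = 0") (auto simp: node_def field_simps)
qed (use T in \<open>auto simp: node_def divide_simps algebra_simps\<close>)

lemma partition_energy_le:
  assumes u: "u \<in> W" and N: "0 < N"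
  shows "partition_energy N u \<le> energy u"
proof -
  let ?f = "\<lambda>r. \<phi> (weak_deriv T u r)"
  have i: "integrable M ?f" using u by (simp add: W_iff)
  have "(\<Sum>i<k. (node N (Suc i) - node N i) * \<phi> (quotient N u i)) \<le> integral {0..node N k} ?f" if "k \<le> N" for k
    using that
  proof (induction k)
    case 0
    then show ?case by (simp add: node_simps)
  next
    case (Suc k)
    have "(node N (Suc k) - node N k) * \<phi> (quotient N u k) \<le> integral {node N k..node N (Suc k)} ?f"
      unfolding quotient_def using Suc.prems N by (intro jensen[OF u] node_simps)
    moreover have "integral {0..node N k} ?f + integral {node N k..node N (Suc k)} ?f = integral {0..node N (Suc k)} ?f"
      using node_simps(3,4)[of N k] N Suc.prems node_simps(5)[of "Suc k" N]
      by (intro Henstock_Kurzweil_Integration.integral_combine integrable_M_sub[OF i]) auto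
    ultimately show ?case using Suc by simp
  qed
  from this[of N] show ?thesis
    unfolding partition_energy_def integral_M_eq[OF i] using N by (simp add: node_simps)
qed

lemma step_quotient_eq:
  assumes N: "0 < N" and t: "node N i \<le> t" "t < node N (Suc i)"
  shows "step_quotient N u t = quotient N u i"
proof -
  have "real i \<le> real N * t / T" "real N * t / T < real i + 1"
    using t N T by (simp_all add: node_def field_simps)
  then have "\<lfloor>real N * t / T\<rfloor> = int i" by (simp add: floor_eq_iff)
  then show ?thesis by (simp add: step_quotient_def)
qed

lemma step_quotient_has_integral:
  assumes N: "0 < N"
  shows "((\<lambda>t. \<phi> (step_quotient N u t)) has_integral partition_energy N u) {0..T}"
proof -
  have "((\<lambda>t. \<phi> (step_quotient N u t)) has_integral (\<Sum>i<k. (node N (Suc i) - node N i) * \<phi> (quotient N u i))) {0..node N k}" for k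
  proof (induction k)
    case 0
    then show ?case by (simp add: node_simps has_integral_refl)
  next
    case (Suc k)
    have lt: "node N k < node N (Suc k)" using N by (rule node_simps)
    have "((\<lambda>t. \<phi> (quotient N u k)) has_integral (node N (Suc k) - node N k) * \<phi> (quotient N u k)) {node N k..node N (Suc k)}"
      using has_integral_const_real[of "\<phi> (quotient N u k)" "node N k" "node N (Suc k)"] lt by simp
    \<comment> \<open>The right node already belongs to the next cell; changing one point does not
      affect the integral.\<close>
    then have "((\<lambda>t. \<phi> (step_quotient N u t)) has_integral (node N (Suc k) - node N k) * \<phi> (quotient N u k)) {node N k..node N (Suc k)}"
      by (rule has_integral_spike_finite[of "{node N (Suc k)}", rotated 2]) (auto simp: step_quotient_eq[OF N])
    from has_integral_combine[OF node_simps(3) less_imp_le[OF lt] Suc this]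
    show ?case by simp
  qed
  from this[of N] show ?thesis unfolding partition_energy_def using N by (simp add: node_simps)
qed

lemma step_quotient_tendsto:
  assumes u: "(u has_vector_derivative D) (at t within {0..T})" and t: "0 \<le> t" "t < T"
  shows "(\<lambda>n. step_quotient (Suc n) u t) \<longlonglongrightarrow> D"
proof -
  define i where "i n = nat \<lfloor>real (Suc n) * t / T\<rfloor>" for n
  define l where "l n = node (Suc n) (i n)" for n
  define r where "r n = node (Suc n) (Suc (i n))" for n
  have i: "real (i n) \<le> real (Suc n) * t / T" "real (Suc n) * t / T < real (i n) + 1" for n
  proof -
    have "0 \<le> real (Suc n) * t / T" using t T by simp
    then have "real (i n) = of_int \<lfloor>real (Suc n) * t / T\<rfloor>" unfolding i_def by simp
    then show "real (i n) \<le> real (Suc n) * t / T" "real (Suc n) * t / T < real (i n) + 1" by linarith+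
  qed
  have lr: "l n \<le> t" "t < r n" "r n - l n = T / real (Suc n)" for n
  proof -
    show "l n \<le> t" using i(1)[of n] T by (simp add: l_def node_def field_simps)
    show "t < r n" using i(2)[of n] T by (simp add: r_def node_def field_simps)
    show "r n - l n = T / real (Suc n)" unfolding l_def r_def by (rule node_simps)
  qed
  have iN: "i n < Suc n" for n
  proof -
    have "real (Suc n) * (t / T) < real (Suc n) * 1" using t T by (intro mult_strict_left_mono) auto
    then have "real (Suc n) * t / T < real (Suc n)" by (simp only: times_divide_eq_right mult_1_right)
    then have "real (i n) < real (Suc n)" using i(1)[of n] by linarith
    then show ?thesis by simp
  qed
  have mem: "l n \<in> {0..T}" "r n \<in> {0..T}" for n
    unfolding l_def r_def atLeastAtMost_iff
    by (intro conjI node_simps(3) node_simps(5) less_imp_le[OF iN] Suc_leI[OF iN])+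
  have h0: "(\<lambda>n. T / real (Suc n)) \<longlonglongrightarrow> 0" by (rule LIMSEQ_Suc[OF lim_const_over_n])
  have "(\<lambda>n. l n - t) \<longlonglongrightarrow> 0"
  proof (rule Lim_null_comparison[OF _ h0], rule always_eventually, rule allI)
    fix n show "norm (l n - t) \<le> T / real (Suc n)" using lr[of n] by simp
  qed
  moreover have "(\<lambda>n. r n - t) \<longlonglongrightarrow> 0"
  proof (rule Lim_null_comparison[OF _ h0], rule always_eventually, rule allI)
    fix n show "norm (r n - t) \<le> T / real (Suc n)" using lr[of n] by simp
  qed
  ultimately have lim: "l \<longlonglongrightarrow> t" "r \<longlonglongrightarrow> t" by (auto intro: LIM_zero_cancel)
  have less: "t \<le> r n" "l n < r n" for n using lr[of n] by linarith+
  have "(\<lambda>n. (u (r n) - u (l n)) /\<^sub>R (r n - l n)) \<longlonglongrightarrow> D"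
    by (rule has_vector_derivative_straddle[OF u mem lr(1) less lim])
  then show ?thesis
    unfolding step_quotient_def quotient_def l_def r_def i_def by simp
qed

text \<open>Fatou's lemma is applied to nonnegative extended integrals because integrability of the
  limit is itself part of the claim: it places the limit of a minimizing sequence in W.\<close>

lemma energy_le_of_partition_energy:
  assumes ac: "absolutely_continuous_on 0 T u" and L: "\<And>N. 0 < N \<Longrightarrow> partition_energy N u \<le> L"
  shows "integrable M (\<lambda>t. \<phi> (weak_deriv T u t))" "energy u \<le> L"
proof -
  let ?f = "\<lambda>n t. \<phi> (step_quotient (Suc n) u t)"
  have fi: "integrable M (?f n)" for n
    unfolding integrable_M_iff using step_quotient_has_integral[of "Suc n" u] nonneg
    by (intro nonnegative_absolutely_integrable_1) auto
  have "(\<integral>t. ?f n t \<partial>M) = partition_energy (Suc n) u" for n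
    using integral_M_eq[OF fi] integral_unique[OF step_quotient_has_integral[of "Suc n" u]] by simp
  then have nn: "(\<integral>\<^sup>+t. ennreal (?f n t) \<partial>M) \<le> ennreal L" for n
    using L[of "Suc n"] nonneg by (subst nn_integral_eq_integral[OF fi]) (auto intro!: ennreal_leI)
  have dm: "weak_deriv T u \<in> borel_measurable M"
    using weak_deriv_integrable[OF ac] by (rule borel_measurable_integrable)
  then have m: "(\<lambda>t. \<phi> (weak_deriv T u t)) \<in> borel_measurable M" by measurable
  have "AE t in M. t \<noteq> T"
    unfolding AE_M_iff by (intro exI[of _ "{T}"]) auto
  then have lim: "AE t in M. (\<lambda>n. ?f n t) \<longlonglongrightarrow> \<phi> (weak_deriv T u t)"
    using absolutely_continuous_on_FTC(1)[OF T ac] AE_in_interval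
  proof eventually_elim
    case (elim t)
    then have "(\<lambda>n. step_quotient (Suc n) u t) \<longlonglongrightarrow> weak_deriv T u t"
      by (intro step_quotient_tendsto) auto
    from continuous_on_tendsto_compose[OF continuous_on[of UNIV] this] show ?case by simp
  qed
  have "(\<integral>\<^sup>+t. ennreal (\<phi> (weak_deriv T u t)) \<partial>M) = (\<integral>\<^sup>+t. liminf (\<lambda>n. ennreal (?f n t)) \<partial>M)"
  proof (rule nn_integral_cong_AE)
    show "AE t in M. ennreal (\<phi> (weak_deriv T u t)) = liminf (\<lambda>n. ennreal (?f n t))"
      using lim
    proof eventually_elim
      case (elim t)
      from tendsto_ennrealI[OF this] show ?case by (intro lim_imp_Liminf[symmetric]) auto
    qed
  qed
  also have "\<dots> \<le> liminf (\<lambda>n. \<integral>\<^sup>+t. ennreal (?f n t) \<partial>M)"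
    using fi by (intro nn_integral_liminf) (auto intro: borel_measurable_integrable)
  also have "\<dots> \<le> limsup (\<lambda>n. \<integral>\<^sup>+t. ennreal (?f n t) \<partial>M)" by (rule Liminf_le_Limsup) simp
  also have "\<dots> \<le> ennreal L" using nn by (intro Limsup_bounded) auto
  finally have le: "(\<integral>\<^sup>+t. ennreal (\<phi> (weak_deriv T u t)) \<partial>M) \<le> ennreal L" .
  then show i: "integrable M (\<lambda>t. \<phi> (weak_deriv T u t))"
    using nonneg by (intro integrableI_nonneg[OF m]) (auto intro: le_less_trans)
  \<comment> \<open>\<open>ennreal L\<close> truncates negative L to 0, so the return to real
    integrals requires L to be nonnegative.\<close>
  have "0 \<le> partition_energy 1 u"
    unfolding partition_energy_def using nonneg T by (intro sum_nonneg mult_nonneg_nonneg) (auto simp: node_simps)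
  then have "0 \<le> L" using L[of 1] by simp
  then show "energy u \<le> L"
    using le nonneg by (simp add: nn_integral_eq_integral[OF i])
qed

section \<open>Compactness and existence of a minimizer\<close>

text \<open>For a fixed division the sums of increments are finite and converge pointwise. By
  \<open>increment_le\<close> they are bounded by \<epsilon> R plus C times the total length, with C
  independent of n, so one \<delta> serves the whole sequence.\<close>

lemma absolutely_continuous_on_limit:
  assumes u: "\<And>n. u n \<in> W" and R: "\<And>n. energy (u n) \<le> R"
    and lim: "\<And>t. t \<in> {0..T} \<Longrightarrow> (\<lambda>n. u n t) \<longlonglongrightarrow> v t"
  shows "absolutely_continuous_on 0 T v"
  unfolding absolutely_continuous_on_def
proof (intro allI impI)
  fix e :: real assume e: "0 < e"
  have R0: "0 \<le> R" using R[of 0] energy_nonneg[of "u 0"] by simp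
  define \<epsilon> where "\<epsilon> = e / (4 * (R + 1))"
  have \<epsilon>: "0 < \<epsilon>" "\<epsilon> * R \<le> e / 4" using e R0 by (auto simp: \<epsilon>_def field_simps)
  obtain C where C: "0 \<le> C" "\<And>u s t. u \<in> W \<Longrightarrow> 0 \<le> s \<Longrightarrow> s \<le> t \<Longrightarrow> t \<le> T \<Longrightarrow>
    norm (u t - u s) \<le> \<epsilon> * integral {s..t} (\<lambda>r. \<phi> (weak_deriv T u r)) + C * (t - s)"
    using increment_le[OF \<epsilon>(1)] by blast
  show "\<exists>\<delta>>0. \<forall>d s. d division_of s \<and> s \<subseteq> {0..T} \<and> (\<Sum>k\<in>d. Sup k - Inf k) < \<delta>
        \<longrightarrow> (\<Sum>k\<in>d. norm (v (Sup k) - v (Inf k))) < e"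
  proof (intro exI[of _ "e / (4 * (C + 1))"] conjI allI impI)
    show "0 < e / (4 * (C + 1))" using e C(1) by simp
    fix d s assume "d division_of s \<and> s \<subseteq> {0..T} \<and> (\<Sum>k\<in>d. Sup k - Inf k) < e / (4 * (C + 1))"
    then have d: "d division_of s" "s \<subseteq> {0..T}" "(\<Sum>k\<in>d. Sup k - Inf k) < e / (4 * (C + 1))" by auto
    have k: "k = {Inf k..Sup k}" "0 \<le> Inf k" "Inf k \<le> Sup k" "Sup k \<le> T" if "k \<in> d" for k
      using nonoverlapping_division[OF d(1,2)] that by (auto simp: nonoverlapping_def)
    have "(\<Sum>k\<in>d. norm (u n (Sup k) - u n (Inf k))) \<le> e / 2" for n
    proof -
      let ?f = "\<lambda>r. \<phi> (weak_deriv T (u n) r)"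
      have i: "integrable M ?f" using u by (simp add: W_iff)
      have "(\<Sum>k\<in>d. norm (u n (Sup k) - u n (Inf k))) \<le> (\<Sum>k\<in>d. \<epsilon> * integral k ?f + C * (Sup k - Inf k))"
      proof (rule sum_mono)
        fix k assume "k \<in> d"
        note kk = k[OF this]
        from C(2)[OF u kk(2-4), of n]
        show "norm (u n (Sup k) - u n (Inf k)) \<le> \<epsilon> * integral k ?f + C * (Sup k - Inf k)"
          unfolding kk(1)[symmetric] .
      qed
      also have "\<dots> = \<epsilon> * (\<Sum>k\<in>d. integral k ?f) + C * (\<Sum>k\<in>d. Sup k - Inf k)"
        by (simp add: sum.distrib sum_distrib_left)
      also have "\<dots> \<le> \<epsilon> * R + C * (e / (4 * (C + 1)))"
      proof (intro add_mono mult_left_mono)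
        have "(\<Sum>k\<in>d. integral k ?f) \<le> integral {0..T} ?f"
          using nonneg integrable_M_sub[OF i, of 0 T] by (intro division_sum_integral_le[OF d(1,2)]) auto
        also have "\<dots> \<le> R" using R[of n] integral_M_eq[OF i] by simp
        finally show "(\<Sum>k\<in>d. integral k ?f) \<le> R" .
      qed (use d(3) \<epsilon>(1) C(1) in auto)
      also have "C * (e / (4 * (C + 1))) \<le> e / 4" using C(1) e by (simp add: field_simps)
      finally show ?thesis using \<epsilon>(2) by linarith
    qed
    moreover have "(\<lambda>n. \<Sum>k\<in>d. norm (u n (Sup k) - u n (Inf k))) \<longlonglongrightarrow> (\<Sum>k\<in>d. norm (v (Sup k) - v (Inf k)))"
    proof (intro tendsto_sum tendsto_norm tendsto_diff lim)
      fix j assume "j \<in> d"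
      from k(2-4)[OF this] show "Sup j \<in> {0..T}" "Inf j \<in> {0..T}" by auto
    qed
    ultimately have "(\<Sum>k\<in>d. norm (v (Sup k) - v (Inf k))) \<le> e / 2"
      by (intro LIMSEQ_le_const2) auto
    then show "(\<Sum>k\<in>d. norm (v (Sup k) - v (Inf k))) < e" using e by simp
  qed
qed

lemma integral_F_tendsto:
  assumes u: "\<And>n. continuous_on {0..T} (u n)" and R: "\<And>n t. t \<in> {0..T} \<Longrightarrow> norm (u n t) < R"
    and v: "continuous_on {0..T} v" and lim: "\<And>t. t \<in> {0..T} \<Longrightarrow> (\<lambda>n. u n t) \<longlonglongrightarrow> v t"
  shows "(\<lambda>n. \<integral>t. F t (u n t) \<partial>M) \<longlonglongrightarrow> (\<integral>t. F t (v t) \<partial>M)"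
proof -
  have "0 < R" using le_less_trans[OF norm_ge_zero R[of 0 0]] T by simp
  then obtain C where C: "AE t in M. (C * b t)-lipschitz_on (ball 0 R) (F t) \<and> (\<forall>x\<in>ball 0 R. \<bar>F t x\<bar> \<le> C * b t)"
    using F_lipschitz by blast
  show ?thesis
  proof (rule integral_dominated_convergence[where w = "\<lambda>t. C * b t"])
    show "(\<lambda>t. F t (v t)) \<in> borel_measurable M" by (rule superposition_measurable[OF v])
    show "(\<lambda>t. F t (u n t)) \<in> borel_measurable M" for n by (rule superposition_measurable[OF u])
    show "integrable M (\<lambda>t. C * b t)" using b_integrable by simp
    show "AE t in M. norm (F t (u n t)) \<le> C * b t" for n
      using C AE_in_interval by eventually_elim (use R in auto)
    show "AE t in M. (\<lambda>n. F t (u n t)) \<longlonglongrightarrow> F t (v t)"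
      using F_regular AE_in_interval
    proof eventually_elim
      case (elim t)
      then have "continuous_on UNIV (F t)" by (intro locally_Lipschitz_continuous_on) simp
      from continuous_on_tendsto_compose[OF this lim[OF elim(2)]] show ?case by simp
    qed
  qed
qed

lemma zero_in_W: "(\<lambda>_. 0) \<in> W"
proof -
  have "weak_deriv T (\<lambda>_. 0 :: 'a) t = 0" if "t \<in> {0..T}" for t
    using that by (intro weak_deriv_eq) auto
  then have "integrable M (\<lambda>t. \<phi> (weak_deriv T (\<lambda>_. 0) t)) \<longleftrightarrow> integrable M (\<lambda>t. 0 :: real)"
    by (intro Bochner_Integration.integrable_cong refl) (auto simp: zero space_restrict_space)
  moreover have "absolutely_continuous_on 0 T (\<lambda>_. 0 :: 'a)"
    unfolding absolutely_continuous_on_def by (auto intro!: exI[of _ 1])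
  ultimately show ?thesis by (simp add: W_iff)
qed

theorem minimizer_exists:
  obtains u where "u \<in> W" "\<And>v. v \<in> W \<Longrightarrow> action T \<phi> F u \<le> action T \<phi> F v"
proof -
  let ?I = "action T \<phi> F"
  have "\<exists>m. \<forall>u\<in>W. m \<le> ?I u" by (rule action_coercive)
  then obtain m0 where m0: "\<And>u. u \<in> W \<Longrightarrow> m0 \<le> ?I u" by blast
  define m where "m = Inf (?I ` W)"
  have bdd: "bdd_below (?I ` W)" using m0 by (intro bdd_belowI2)
  have ne: "?I ` W \<noteq> {}" using zero_in_W by blast
  have m: "m \<le> ?I u" if "u \<in> W" for u unfolding m_def using bdd that by (intro cInf_lower) auto
  have "\<exists>u. u \<in> W \<and> ?I u < m + 1 / real (Suc n)" for n
  proof -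
    have "m < m + 1 / real (Suc n)" by simp
    then obtain y where "y \<in> ?I ` W" "y < m + 1 / real (Suc n)"
      unfolding m_def using cInf_lessD[OF ne] by blast
    then show ?thesis by blast
  qed
  then obtain u where u: "\<And>n. u n \<in> W" "\<And>n. ?I (u n) < m + 1 / real (Suc n)" by metis
  have I1: "?I (u n) \<le> m + 1" for n
  proof -
    have "1 / real (Suc n) \<le> 1" by simp
    then show ?thesis using u(2)[of n] by linarith
  qed
  obtain R where R: "0 < R" "\<And>u. u \<in> W \<Longrightarrow> ?I u \<le> m + 1 \<Longrightarrow> energy u \<le> R \<and> norm (u 0) \<le> R"
    by (rule action_coercive[of "m + 1"]) blast
  have E: "energy (u n) \<le> R" "norm (u n 0) \<le> R" for n using R(2)[OF u(1) I1] by auto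
  \<comment> \<open>Equicontinuity: first e is chosen small against the bound R on the energies,
    then the distance of the times small against C.\<close>
  have equi: "\<exists>C\<ge>0. \<forall>n s t. s \<in> {0..T} \<and> t \<in> {0..T} \<longrightarrow> norm (u n t - u n s) \<le> e * R + C * \<bar>t - s\<bar>" if e: "0 < e" for e
  proof -
    obtain C where C: "0 \<le> C" "\<And>u s t. u \<in> W \<Longrightarrow> 0 \<le> s \<Longrightarrow> s \<le> t \<Longrightarrow> t \<le> T \<Longrightarrow>
      norm (u t - u s) \<le> e * integral {s..t} (\<lambda>r. \<phi> (weak_deriv T u r)) + C * (t - s)"
      using increment_le[OF e] by blast
    have *: "norm (u n t - u n s) \<le> e * R + C * (t - s)" if st: "0 \<le> s" "s \<le> t" "t \<le> T" for n s t
    proof -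
      have "integral {s..t} (\<lambda>r. \<phi> (weak_deriv T (u n) r)) \<le> R"
        using integral_le_energy[OF u(1), of s t n] E(1)[of n] st by linarith
      then have "e * integral {s..t} (\<lambda>r. \<phi> (weak_deriv T (u n) r)) \<le> e * R" using e by simp
      then show ?thesis using C(2)[OF u(1)[of n] st] by linarith
    qed
    have "norm (u n t - u n s) \<le> e * R + C * \<bar>t - s\<bar>" if "s \<in> {0..T}" "t \<in> {0..T}" for n s t
    proof (cases "s \<le> t")
      case True then show ?thesis using *[of s t n] that by simp
    next
      case False then show ?thesis using *[of t s n] that by (simp add: norm_minus_commute)
    qed
    then show ?thesis using C(1) by blast
  qed
  obtain C1 where C1: "C1 \<ge> 0" "\<And>n s t. s \<in> {0..T} \<Longrightarrow> t \<in> {0..T} \<Longrightarrow> norm (u n t - u n s) \<le> 1 * R + C1 * \<bar>t - s\<bar>"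
    using equi[OF zero_less_one] by blast
  define B where "B = 2 * R + C1 * T"
  have bound: "norm (u n t) \<le> B" if t: "t \<in> {0..T}" for n t
  proof -
    have "norm (u n t) \<le> norm (u n 0) + norm (u n t - u n 0)" by (metis add.commute norm_triangle_sub)
    moreover have "C1 * \<bar>t - 0\<bar> \<le> C1 * T" using t C1(1) by (intro mult_left_mono) auto
    ultimately show ?thesis using C1(2)[of 0 t n] t E(2)[of n] T by (simp add: B_def)
  qed
  have eqc: "\<exists>d>0. \<forall>n y. y \<in> {0..T} \<and> norm (x - y) < d \<longrightarrow> norm (u n x - u n y) < e"
    if x: "x \<in> {0..T}" and e: "0 < e" for x e
  proof -
    have "0 < e / (2 * (R + 1))" using e R(1) by simp
    from equi[OF this] obtain C where C: "C \<ge> 0"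
      "\<And>n s t. s \<in> {0..T} \<Longrightarrow> t \<in> {0..T} \<Longrightarrow> norm (u n t - u n s) \<le> e / (2 * (R + 1)) * R + C * \<bar>t - s\<bar>" by blast
    have 1: "e / (2 * (R + 1)) * R < e / 2" using e R(1) by (simp add: field_simps)
    have "norm (u n x - u n y) < e" if y: "y \<in> {0..T}" "norm (x - y) < e / (2 * (C + 1))" for n y
    proof -
      have "C * \<bar>x - y\<bar> \<le> C * (e / (2 * (C + 1)))" using y C(1) by (intro mult_left_mono) auto
      also have "\<dots> \<le> e / 2" using C(1) e by (simp add: field_simps)
      finally show ?thesis using C(2)[OF y(1) x, of n] 1 by linarith
    qed
    moreover have "0 < e / (2 * (C + 1))" using e C(1) by simp
    ultimately show ?thesis by blast
  qed
  obtain v and k :: "nat \<Rightarrow> nat" where v: "continuous_on {0..T} v" and k: "strict_mono k"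
    and unif: "\<And>e. 0 < e \<Longrightarrow> \<exists>N. \<forall>n x. n \<ge> N \<and> x \<in> {0..T} \<longrightarrow> norm (u (k n) x - v x) < e"
    using Arzela_Ascoli[of "{0..T}" u B, OF compact_Icc bound eqc] by blast
  have lim: "(\<lambda>n. u (k n) t) \<longlonglongrightarrow> v t" if t: "t \<in> {0..T}" for t
  proof (rule LIMSEQ_I)
    fix e :: real assume "0 < e"
    from unif[OF this] show "\<exists>no. \<forall>n\<ge>no. norm (u (k n) t - v t) < e" using t by blast
  qed
  have ac: "absolutely_continuous_on 0 T v"
    using u(1) E(1) lim by (intro absolutely_continuous_on_limit[of "\<lambda>n. u (k n)" R])
  have per: "v 0 = v T"
  proof (rule LIMSEQ_unique)
    show "(\<lambda>n. u (k n) 0) \<longlonglongrightarrow> v 0" using T by (intro lim) simp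
    have "u (k n) 0 = u (k n) T" for n using u(1)[of "k n"] by (simp add: W_iff)
    then show "(\<lambda>n. u (k n) 0) \<longlonglongrightarrow> v T" using T by (simp add: lim)
  qed
  have limF: "(\<lambda>n. \<integral>t. F t (u (k n) t) \<partial>M) \<longlonglongrightarrow> (\<integral>t. F t (v t) \<partial>M)"
  proof (rule integral_F_tendsto[OF W_continuous_on[OF u(1)] _ v lim])
    show "norm (u (k n) t) < B + 1" if "t \<in> {0..T}" for n t using bound[OF that, of "k n"] by simp
  qed
  have "(\<lambda>n. ?I (u n)) \<longlonglongrightarrow> m"
  proof (rule tendsto_sandwich)
    show "eventually (\<lambda>n. m \<le> ?I (u n)) sequentially" using m u(1) by simp
    show "eventually (\<lambda>n. ?I (u n) \<le> m + 1 / real (Suc n)) sequentially"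
      using u(2) by (intro always_eventually allI less_imp_le)
    show "(\<lambda>n. m + 1 / real (Suc n)) \<longlonglongrightarrow> m"
      using tendsto_add[OF tendsto_const LIMSEQ_Suc[OF lim_const_over_n[of "1::real"]], of m] by simp
  qed simp
  then have "(\<lambda>n. ?I (u (k n))) \<longlonglongrightarrow> m" using LIMSEQ_subseq_LIMSEQ[OF _ k] by (simp add: o_def)
  \<comment> \<open>Since the actions and the integrals of F converge along the subsequence, so do
    the energies. Their limit bounds every partition energy of v, and with this bound the action of
    v is at most m.\<close>
  from tendsto_diff[OF this limF]
  have limE: "(\<lambda>n. energy (u (k n))) \<longlonglongrightarrow> m - (\<integral>t. F t (v t) \<partial>M)" by (simp add: action_def)
  have part: "partition_energy N v \<le> m - (\<integral>t. F t (v t) \<partial>M)" if N: "0 < N" for N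
  proof (rule LIMSEQ_le[OF _ limE])
    show "(\<lambda>n. partition_energy N (u (k n))) \<longlonglongrightarrow> partition_energy N v"
      unfolding partition_energy_def
    proof (intro tendsto_sum tendsto_mult tendsto_const)
      fix i assume "i \<in> {..<N}"
      then have "node N i \<in> {0..T}" "node N (Suc i) \<in> {0..T}"
        using node_simps(3,5) by (auto simp: Suc_leI less_imp_le)
      then have "(\<lambda>n. quotient N (u (k n)) i) \<longlonglongrightarrow> quotient N v i"
        unfolding quotient_def by (intro tendsto_intros lim)
      from continuous_on_tendsto_compose[OF continuous_on[of UNIV] this]
      show "(\<lambda>n. \<phi> (quotient N (u (k n)) i)) \<longlonglongrightarrow> \<phi> (quotient N v i)" by simp
    qed
    show "\<exists>N'. \<forall>n\<ge>N'. partition_energy N (u (k n)) \<le> energy (u (k n))"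
      using partition_energy_le[OF u(1) N] by blast
  qed
  note en = energy_le_of_partition_energy[OF ac part]
  have "v \<in> W" using ac per en(1) by (simp add: W_iff)
  moreover have "?I v \<le> ?I w" if "w \<in> W" for w
    using en(2) m[OF that] by (simp add: action_def)
  ultimately show thesis by (rule that)
qed

end


lemma (in Delta2_function) scale_mono:
  assumes "\<bar>r\<bar> \<le> R"
  shows "\<phi> (r *\<^sub>R w) \<le> \<phi> (R *\<^sub>R w)"
proof (cases "R = 0")
  case False
  then have R: "R > 0" using assms by simp
  have "\<phi> (r *\<^sub>R w) = \<phi> (\<bar>r\<bar> *\<^sub>R w)" using even[of "r *\<^sub>R w"] by (cases "r \<ge> 0") auto
  also have "\<bar>r\<bar> *\<^sub>R w = (\<bar>r\<bar> / R) *\<^sub>R (R *\<^sub>R w)" using R by simp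
  also have "\<phi> \<dots> \<le> (\<bar>r\<bar> / R) * \<phi> (R *\<^sub>R w)" using R assms by (intro shrink) auto
  also have "\<dots> \<le> 1 * \<phi> (R *\<^sub>R w)" using R assms nonneg by (intro mult_right_mono) auto
  finally show ?thesis by simp
qed (use assms in simp)

section \<open>The Euler--Lagrange inclusion\<close>

locale nonsmooth_minimizer = nonsmooth_problem +
  fixes u :: "real \<Rightarrow> 'a"
  assumes u: "u \<in> periodic_Orlicz_Sobolev_space T (\<lambda>x. ereal (\<phi> x))"
    and minimal: "\<And>v. v \<in> periodic_Orlicz_Sobolev_space T (\<lambda>x. ereal (\<phi> x)) \<Longrightarrow> action T \<phi> F u \<le> action T \<phi> F v"
begin

abbreviation du :: "real \<Rightarrow> 'a" where "du \<equiv> weak_deriv T u"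

definition p :: "real \<Rightarrow> 'a" where "p t = grad \<phi> (du t)"

definition g :: "'a \<Rightarrow> real \<Rightarrow> real" where "g w t = dir (F t) (u t) w"

lemma u_ac: "absolutely_continuous_on 0 T u" and u_per: "u 0 = u T"
  and du_energy: "integrable M (\<lambda>t. \<phi> (du t))"
  using u by (simp_all add: W_iff)

lemma u_continuous_on: "continuous_on {0..T} u"
  using u by (rule W_continuous_on)

lemma du_measurable [measurable]: "du \<in> borel_measurable M"
  using weak_deriv_integrable[OF u_ac] by (rule borel_measurable_integrable)

section \<open>First variation along nonnegative multipliers\<close>

text \<open>Midpoint convexity separates the two summands at the price of a factor 2, which the
  doubling condition absorbs for du. Bounded perturbations of the derivative thus keep finite
  energy.\<close>

lemma du_add_integrable:
  assumes m: "m \<in> borel_measurable M" and B: "\<And>t. \<bar>m t\<bar> \<le> B"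
  shows "integrable M (\<lambda>t. \<phi> (du t + m t *\<^sub>R w))"
proof (rule Bochner_Integration.integrable_bound)
  have "integrable M (\<lambda>t. \<phi> (2 *\<^sub>R du t))"
    by (rule dilation_integrable[OF du_measurable, of 1]) (simp_all add: du_energy)
  then show "integrable M (\<lambda>t. (\<phi> (2 *\<^sub>R du t) + \<phi> ((2 * B) *\<^sub>R w)) / 2)" by simp
  show "(\<lambda>t. \<phi> (du t + m t *\<^sub>R w)) \<in> borel_measurable M" using m by measurable
  show "AE t in M. norm (\<phi> (du t + m t *\<^sub>R w)) \<le> norm ((\<phi> (2 *\<^sub>R du t) + \<phi> ((2 * B) *\<^sub>R w)) / 2)"
  proof (rule AE_I2)
    fix t
    have "\<phi> (du t + m t *\<^sub>R w) \<le> (\<phi> (2 *\<^sub>R du t) + \<phi> (2 *\<^sub>R m t *\<^sub>R w)) / 2" by (rule add_le)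
    moreover have "\<phi> ((2 * m t) *\<^sub>R w) \<le> \<phi> ((2 * B) *\<^sub>R w)"
      using B[of t] by (intro scale_mono) (simp add: abs_mult)
    ultimately show "norm (\<phi> (du t + m t *\<^sub>R w)) \<le> norm ((\<phi> (2 *\<^sub>R du t) + \<phi> ((2 * B) *\<^sub>R w)) / 2)"
      using nonneg[of "du t + m t *\<^sub>R w"] nonneg[of "2 *\<^sub>R du t"] nonneg[of "(2 * B) *\<^sub>R w"] by simp
  qed
qed

lemma step_tendsto: "filterlim (\<lambda>n. 1 / real (Suc n)) (at_right 0) sequentially"
  unfolding filterlim_at using LIMSEQ_Suc[OF lim_const_over_n[of "1::real"]] by (simp add: always_eventually)

text \<open>A pointwise limit of difference quotients of the continuous \<phi>, taken along the
  steps 1 / (n + 1).\<close>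

lemma grad_inner_measurable: "(\<lambda>x. grad \<phi> x \<bullet> w) \<in> borel_measurable borel"
proof (rule borel_measurable_LIMSEQ_real)
  show "(\<lambda>n. (\<phi> (x + (1 / real (Suc n)) *\<^sub>R w) - \<phi> x) / (1 / real (Suc n))) \<longlonglongrightarrow> grad \<phi> x \<bullet> w" for x
    by (rule filterlim_compose[OF directional step_tendsto])
  show "(\<lambda>x. (\<phi> (x + (1 / real (Suc n)) *\<^sub>R w) - \<phi> x) / (1 / real (Suc n))) \<in> borel_measurable borel" for n
    by measurable
qed

lemma p_inner_measurable: "(\<lambda>t. p t \<bullet> w) \<in> borel_measurable M"
  unfolding p_def by (rule measurable_compose[OF du_measurable grad_inner_measurable])

text \<open>The subgradient inequality in the directions w and -w bounds the inner product by \<phi>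
  (du t + w) and \<phi> (du t - w).\<close>

lemma p_inner_integrable: "integrable M (\<lambda>t. p t \<bullet> w)"
proof (rule Bochner_Integration.integrable_bound[OF _ p_inner_measurable])
  have "integrable M (\<lambda>t. \<phi> (du t + 1 *\<^sub>R w))" "integrable M (\<lambda>t. \<phi> (du t + (-1) *\<^sub>R w))"
    by (rule du_add_integrable[where B = 1]; simp)+
  then show "integrable M (\<lambda>t. \<phi> (du t + w) + \<phi> (du t - w))" by simp
  show "AE t in M. norm (p t \<bullet> w) \<le> norm (\<phi> (du t + w) + \<phi> (du t - w))"
  proof (rule AE_I2)
    fix t
    show "norm (p t \<bullet> w) \<le> norm (\<phi> (du t + w) + \<phi> (du t - w))"
      using grad_le[of "du t" w] grad_le[of "du t" "- w"] nonneg[of "du t"] nonneg[of "du t + w"] nonneg[of "du t - w"]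
      by (simp add: p_def abs_le_iff)
  qed
qed

lemma u_bound: obtains R where "0 < R" "\<And>t. t \<in> {0..T} \<Longrightarrow> norm (u t) < R"
proof -
  have "bounded (u ` {0..T})" using u_continuous_on by (intro compact_imp_bounded compact_continuous_image) auto
  then show thesis using that unfolding bounded_pos_less by auto
qed

text \<open>For steps l \<le> 1 the varied curve stays in one ball, whose Lipschitz constant for F t
  gives a majorant independent of l.\<close>

lemma F_quotient_bound:
  assumes \<psi>: "\<And>t. t \<in> {0..T} \<Longrightarrow> \<bar>\<psi> t\<bar> \<le> A"
  obtains C where "0 \<le> C" "AE t in M. \<forall>l. 0 < l \<and> l \<le> 1 \<longrightarrow>
    \<bar>(F t (u t + l *\<^sub>R \<psi> t *\<^sub>R w) - F t (u t)) / l\<bar> \<le> C * b t * norm (\<psi> t *\<^sub>R w)"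
proof -
  obtain R where R: "0 < R" "\<And>t. t \<in> {0..T} \<Longrightarrow> norm (u t) < R" using u_bound by blast
  have "0 \<le> A" using \<psi>[of 0] T by simp
  then have "0 < R + A * norm w" using R(1) by (simp add: add_pos_nonneg)
  then obtain C where C: "0 \<le> C" "AE t in M. (C * b t)-lipschitz_on (ball 0 (R + A * norm w)) (F t) \<and> (\<forall>x\<in>ball 0 (R + A * norm w). \<bar>F t x\<bar> \<le> C * b t)"
    using F_lipschitz by blast
  show thesis
  proof (rule that[OF C(1)])
    show "AE t in M. \<forall>l. 0 < l \<and> l \<le> 1 \<longrightarrow>
      \<bar>(F t (u t + l *\<^sub>R \<psi> t *\<^sub>R w) - F t (u t)) / l\<bar> \<le> C * b t * norm (\<psi> t *\<^sub>R w)"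
      using C(2) AE_in_interval
    proof eventually_elim
      case (elim t)
      show ?case
      proof (intro allI impI)
        fix l :: real assume l: "0 < l \<and> l \<le> 1"
        have "norm (l *\<^sub>R \<psi> t *\<^sub>R w) = l * (\<bar>\<psi> t\<bar> * norm w)" using l by (simp add: abs_mult)
        also have "\<dots> \<le> 1 * (A * norm w)"
          using l \<psi>[OF elim(2)] by (intro mult_mono mult_right_mono) auto
        finally have "norm (l *\<^sub>R \<psi> t *\<^sub>R w) \<le> 1 * (A * norm w)" .
        then have "norm (u t + l *\<^sub>R \<psi> t *\<^sub>R w) < R + A * norm w"
          using R(2)[OF elim(2)] norm_triangle_ineq[of "u t" "l *\<^sub>R \<psi> t *\<^sub>R w"] by linarith
        moreover have "norm (u t) < R + A * norm w"
          using R(2)[OF elim(2)] mult_nonneg_nonneg[OF \<open>0 \<le> A\<close> norm_ge_zero[of w]] by linarith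
        ultimately have "dist (F t (u t + l *\<^sub>R \<psi> t *\<^sub>R w)) (F t (u t)) \<le> C * b t * dist (u t + l *\<^sub>R \<psi> t *\<^sub>R w) (u t)"
          by (intro lipschitz_onD[OF conjunct1[OF elim(1)]]) simp_all
        then have "\<bar>F t (u t + l *\<^sub>R \<psi> t *\<^sub>R w) - F t (u t)\<bar> \<le> l * (C * b t * norm (\<psi> t *\<^sub>R w))"
          using l by (simp add: dist_norm mult_ac abs_mult)
        moreover have "\<bar>x / l\<bar> \<le> y" if "\<bar>x\<bar> \<le> l * y" for x y
          using that l by (simp add: field_simps)
        ultimately show "\<bar>(F t (u t + l *\<^sub>R \<psi> t *\<^sub>R w) - F t (u t)) / l\<bar> \<le> C * b t * norm (\<psi> t *\<^sub>R w)"
          by blast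
      qed
    qed
  qed
qed

lemma F_quotient_tendsto:
  "AE t in M. (\<lambda>n. (F t (u t + (1 / real (Suc n)) *\<^sub>R w t) - F t (u t)) / (1 / real (Suc n))) \<longlonglongrightarrow> dir (F t) (u t) (w t)"
  using F_regular
proof eventually_elim
  case (elim t)
  then show ?case by (intro filterlim_compose[OF dir_tendsto step_tendsto]) simp
qed

text \<open>The Lipschitz constant of F t does not depend on the direction, so one null set serves
  every w at once.\<close>

lemma g_bound: obtains C where "0 \<le> C" "AE t in M. \<forall>w. \<bar>g w t\<bar> \<le> C * b t * norm w"
proof -
  obtain R where R: "0 < R" "\<And>t. t \<in> {0..T} \<Longrightarrow> norm (u t) < R" using u_bound by blast
  obtain C where C: "0 \<le> C" "AE t in M. (C * b t)-lipschitz_on (ball 0 R) (F t) \<and> (\<forall>x\<in>ball 0 R. \<bar>F t x\<bar> \<le> C * b t)"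
    using F_lipschitz[OF R(1)] by blast
  have "AE t in M. \<forall>w. \<bar>g w t\<bar> \<le> C * b t * norm w"
    using C(2) F_regular AE_in_interval
  proof eventually_elim
    case (elim t)
    then have Lip: "(C * b t)-lipschitz_on (ball 0 R) (F t)" and ut: "norm (u t) < R" using R(2) by auto
    show ?case
    proof
      fix w
      have lim: "((\<lambda>l. \<bar>(F t (u t + l *\<^sub>R w) - F t (u t)) / l\<bar>) \<longlongrightarrow> \<bar>g w t\<bar>) (at_right 0)"
        unfolding g_def using elim(2) by (intro tendsto_rabs dir_tendsto) simp
      have "((\<lambda>l. u t + l *\<^sub>R w) \<longlongrightarrow> u t + 0 *\<^sub>R w) (at_right 0)" by (intro tendsto_intros)
      then have "eventually (\<lambda>l. u t + l *\<^sub>R w \<in> ball 0 R) (at_right 0)"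
        using R(2)[OF elim(3)] by (intro topological_tendstoD) auto
      moreover have "eventually (\<lambda>l::real. 0 < l) (at_right 0)" by (rule eventually_at_right_less)
      ultimately have "eventually (\<lambda>l. \<bar>(F t (u t + l *\<^sub>R w) - F t (u t)) / l\<bar> \<le> C * b t * norm w) (at_right 0)"
      proof eventually_elim
        case (elim l)
        have "dist (F t (u t + l *\<^sub>R w)) (F t (u t)) \<le> C * b t * dist (u t + l *\<^sub>R w) (u t)"
          by (rule lipschitz_onD[OF Lip elim(1)]) (use ut in simp)
        then show ?case using elim(2) by (simp add: dist_norm field_simps)
      qed
      then show "\<bar>g w t\<bar> \<le> C * b t * norm w" by (rule tendsto_upperbound[OF lim]) simp
    qed
  qed
  with C(1) show thesis by (rule that)
qed

lemma g_measurable: "g w \<in> borel_measurable M"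
proof (rule borel_measurable_lebesgue_on_AE_LIMSEQ)
  show "AE t in M. (\<lambda>n. (F t (u t + (1 / real (Suc n)) *\<^sub>R w) - F t (u t)) / (1 / real (Suc n))) \<longlonglongrightarrow> g w t"
    using F_quotient_tendsto[of "\<lambda>_. w"] unfolding g_def .
  show "(\<lambda>t. (F t (u t + (1 / real (Suc n)) *\<^sub>R w) - F t (u t)) / (1 / real (Suc n))) \<in> borel_measurable M" for n
    by (intro borel_measurable_divide borel_measurable_diff superposition_measurable continuous_intros u_continuous_on) simp_all
qed simp

lemma g_integrable: "integrable M (g w)"
proof -
  obtain C where C: "0 \<le> C" "AE t in M. \<forall>w. \<bar>g w t\<bar> \<le> C * b t * norm w" using g_bound by blast
  have "integrable M (\<lambda>t. C * b t * norm w)" using b_integrable by simp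
  moreover have "AE t in M. norm (g w t) \<le> norm (C * b t * norm w)"
    using C(2)
  proof eventually_elim
    case (elim t)
    then show ?case using abs_ge_self[of "C * b t * norm w"] by (metis real_norm_def order_trans)
  qed
  ultimately show ?thesis by (rule Bochner_Integration.integrable_bound[OF _ g_measurable])
qed

text \<open>Minimality along u plus a positive step times \<psi> w, divided by the step. Both
  quotients converge under the integral; \<psi> can be taken out of the Clarke derivative because it
  is nonnegative.\<close>

lemma first_variation:
  assumes \<psi>: "\<And>r. r \<in> {0..T} \<Longrightarrow> (m has_integral \<psi> r - \<psi> 0) {0..r}" "\<psi> 0 = \<psi> T"
    "\<And>r. r \<in> {0..T} \<Longrightarrow> 0 \<le> \<psi> r" "\<And>r. r \<in> {0..T} \<Longrightarrow> \<psi> r \<le> A"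
    and m: "m \<in> borel_measurable M" "\<And>t. \<bar>m t\<bar> \<le> B"
  shows "0 \<le> (\<integral>t. m t * (p t \<bullet> w) \<partial>M) + (\<integral>t. \<psi> t * g w t \<partial>M)"
proof -
  let ?I = "action T \<phi> F"
  have mi: "m absolutely_integrable_on {0..T}"
    unfolding integrable_M_iff[symmetric]
    using m by (intro M.integrable_const_bound[of _ B]) auto
  have \<psi>_eq: "\<psi> r = integral {0..r} m + \<psi> 0" if "r \<in> {0..T}" for r
    using integral_unique[OF \<psi>(1)[OF that]] by simp
  have \<psi>_ac: "absolutely_continuous_on 0 T \<psi>"
  proof (rule absolutely_continuous_on_le[OF absolutely_continuous_on_integral[OF mi]])
    fix s t assume st: "0 \<le> s" "s \<le> t" "t \<le> T"
    then have "s \<in> {0..T}" "t \<in> {0..T}" by auto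
    from \<psi>_eq[OF this(1)] \<psi>_eq[OF this(2)]
    have "\<psi> t - \<psi> s = integral {0..t} m - integral {0..s} m" by linarith
    then show "norm (\<psi> t - \<psi> s) \<le> norm (integral {0..t} m - integral {0..s} m)" by simp
  qed
  then have \<psi>_cont: "continuous_on {0..T} \<psi>"
    using absolutely_continuous_on_imp_uniformly_continuous_on uniformly_continuous_imp_continuous by blast
  have \<psi>_der: "AE t in M. (\<psi> has_vector_derivative m t) (at t within {0..T})"
  proof -
    have "m integrable_on {0..T}" using mi by (simp add: absolutely_integrable_on_def)
    from integral_has_vector_derivative_AE[OF this]
    obtain N where N: "negligible N" "\<And>t. t \<in> {0..T} - N \<Longrightarrow>
      ((\<lambda>u. integral {0..u} m) has_vector_derivative m t) (at t within {0..T})" by blast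
    have "(\<psi> has_vector_derivative m t) (at t within {0..T})" if t: "t \<in> {0..T} - N" for t
    proof (rule has_vector_derivative_transform[OF _ \<psi>_eq])
      show "((\<lambda>r. integral {0..r} m + \<psi> 0) has_vector_derivative m t) (at t within {0..T})"
        using has_vector_derivative_add[OF N(2)[OF t] has_vector_derivative_const] by simp
    qed (use t in auto)
    then show ?thesis using N(1) unfolding AE_M_iff by blast
  qed
  define e where "e n = 1 / real (Suc n)" for n
  have e: "0 < e n" "e n \<le> 1" for n by (auto simp: e_def)
  define v where "v n t = u t + e n *\<^sub>R \<psi> t *\<^sub>R w" for n t
  have em: "(\<lambda>t. e n * m t) \<in> borel_measurable M" "\<bar>e n * m t\<bar> \<le> B" for n t
  proof -
    show "(\<lambda>t. e n * m t) \<in> borel_measurable M" using m(1) by simp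
    have "\<bar>e n * m t\<bar> \<le> 1 * \<bar>m t\<bar>" unfolding abs_mult using e[of n] by (intro mult_right_mono) auto
    then show "\<bar>e n * m t\<bar> \<le> B" using m(2)[of t] by simp
  qed
  have dv: "AE t in M. weak_deriv T (v n) t = du t + (e n * m t) *\<^sub>R w" for n
    using absolutely_continuous_on_FTC(1)[OF T u_ac] \<psi>_der AE_in_interval
  proof eventually_elim
    case (elim t)
    have "(v n has_vector_derivative du t + e n *\<^sub>R m t *\<^sub>R w) (at t within {0..T})"
      unfolding v_def
      using elim(1) has_vector_derivative_add[OF elim(1) bounded_linear.has_vector_derivative[OF bounded_linear_scaleR_right
          bounded_linear.has_vector_derivative[OF bounded_linear_scaleR_left elim(2), of w], of "e n"]]
      by simp
    from weak_deriv_eq[OF this elim(3)] show ?case by simp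
  qed
  have v_ac: "absolutely_continuous_on 0 T (v n)" for n
  proof -
    have "absolutely_continuous_on 0 T (\<lambda>t. \<psi> t *\<^sub>R (e n *\<^sub>R w))"
    proof -
      have "absolutely_continuous_on 0 T (\<lambda>t. integral {0..t} (\<lambda>r. m r *\<^sub>R (e n *\<^sub>R w)))"
        using mi by (intro absolutely_continuous_on_integral absolutely_integrable_scaleR_right) 
      then show ?thesis
      proof (rule absolutely_continuous_on_le)
        fix s t assume st: "0 \<le> s" "s \<le> t" "t \<le> T"
        have eq: "integral {0..r} (\<lambda>x. m x *\<^sub>R (e n *\<^sub>R w)) = (\<psi> r - \<psi> 0) *\<^sub>R (e n *\<^sub>R w)" if "r \<in> {0..T}" for r
          using that integral_unique[OF has_integral_scaleR_left[OF \<psi>(1)[OF that]]] by blast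
        have "s \<in> {0..T}" "t \<in> {0..T}" using st by auto
        from eq[OF this(1)] eq[OF this(2)]
        show "norm (\<psi> t *\<^sub>R e n *\<^sub>R w - \<psi> s *\<^sub>R e n *\<^sub>R w)
          \<le> norm (integral {0..t} (\<lambda>r. m r *\<^sub>R e n *\<^sub>R w) - integral {0..s} (\<lambda>r. m r *\<^sub>R e n *\<^sub>R w))"
          by (simp only: scaleR_left_diff_distrib) simp
      qed
    qed
    from absolutely_continuous_on_add[OF u_ac this]
    show ?thesis unfolding v_def by (simp add: mult.commute)
  qed
  have v_en: "integrable M (\<lambda>t. \<phi> (weak_deriv T (v n) t))"
    and v_en_eq: "energy (v n) = (\<integral>t. \<phi> (du t + (e n * m t) *\<^sub>R w) \<partial>M)" for n
  proof -
    have i: "integrable M (\<lambda>t. \<phi> (du t + (e n * m t) *\<^sub>R w))" using em by (rule du_add_integrable)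
    have dvm: "(\<lambda>t. \<phi> (weak_deriv T (v n) t)) \<in> borel_measurable M"
      using borel_measurable_integrable[OF weak_deriv_integrable[OF v_ac]] by measurable
    have ae: "AE t in M. \<phi> (du t + (e n * m t) *\<^sub>R w) = \<phi> (weak_deriv T (v n) t)"
      using dv[of n] by eventually_elim simp
    show "integrable M (\<lambda>t. \<phi> (weak_deriv T (v n) t))"
      by (rule integrable_cong_AE_imp[OF i dvm ae])
    show "energy (v n) = (\<integral>t. \<phi> (du t + (e n * m t) *\<^sub>R w) \<partial>M)"
      by (rule integral_cong_AE[OF borel_measurable_integrable[OF i] dvm ae, symmetric])
  qed
  have vW: "v n \<in> W" for n
    unfolding W_iff using v_ac[of n] v_en[of n] \<psi>(2) u_per by (auto simp: v_def)
  define Q1 where "Q1 n t = (\<phi> (du t + e n *\<^sub>R (m t *\<^sub>R w)) - \<phi> (du t)) / e n" for n t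
  define Q2 where "Q2 n t = (F t (u t + e n *\<^sub>R \<psi> t *\<^sub>R w) - F t (u t)) / e n" for n t
  have pos: "0 \<le> (\<integral>t. Q1 n t \<partial>M) + (\<integral>t. Q2 n t \<partial>M)" for n
  proof -
    have i: "integrable M (\<lambda>t. \<phi> (du t + (e n * m t) *\<^sub>R w))" using em by (rule du_add_integrable)
    have iF: "integrable M (\<lambda>t. F t (v n t))" "integrable M (\<lambda>t. F t (u t))"
      using F_integrable[OF W_continuous_on[OF vW]] F_integrable[OF u_continuous_on] by auto
    have "(\<integral>t. Q1 n t \<partial>M) = (energy (v n) - energy u) / e n"
      unfolding Q1_def v_en_eq using i du_energy by simp
    moreover have "(\<integral>t. Q2 n t \<partial>M) = ((\<integral>t. F t (v n t) \<partial>M) - (\<integral>t. F t (u t) \<partial>M)) / e n"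
      unfolding Q2_def using iF by (simp add: v_def)
    ultimately have "(\<integral>t. Q1 n t \<partial>M) + (\<integral>t. Q2 n t \<partial>M) = (?I (v n) - ?I u) / e n"
      by (simp add: action_def add_divide_distrib diff_divide_distrib)
    then show ?thesis using minimal[OF vW[of n]] e(1)[of n] by simp
  qed
  have lim1: "(\<lambda>n. \<integral>t. Q1 n t \<partial>M) \<longlonglongrightarrow> (\<integral>t. m t * (p t \<bullet> w) \<partial>M)"
  \<comment> \<open>Steps at most 1 keep the quotients between those at the steps 1 and -1, whence a
    majorant built from the variations by m and -m.\<close>
  proof (rule integral_dominated_convergence[where w = "\<lambda>t. \<phi> (du t + m t *\<^sub>R w) + \<phi> (du t + (- m t) *\<^sub>R w)"])
    show "(\<lambda>t. m t * (p t \<bullet> w)) \<in> borel_measurable M" using m(1) p_inner_measurable by measurable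
    show "Q1 n \<in> borel_measurable M" for n unfolding Q1_def using m(1) by measurable
    show "integrable M (\<lambda>t. \<phi> (du t + m t *\<^sub>R w) + \<phi> (du t + (- m t) *\<^sub>R w))"
      using m by (intro Bochner_Integration.integrable_add du_add_integrable[where B = B]) auto
    show "AE t in M. (\<lambda>n. Q1 n t) \<longlonglongrightarrow> m t * (p t \<bullet> w)"
    proof (rule AE_I2)
      fix t
      have "(\<lambda>n. Q1 n t) \<longlonglongrightarrow> grad \<phi> (du t) \<bullet> (m t *\<^sub>R w)"
        unfolding Q1_def e_def by (rule filterlim_compose[OF directional step_tendsto])
      then show "(\<lambda>n. Q1 n t) \<longlonglongrightarrow> m t * (p t \<bullet> w)" by (simp add: p_def)
    qed
    show "AE t in M. norm (Q1 n t) \<le> \<phi> (du t + m t *\<^sub>R w) + \<phi> (du t + (- m t) *\<^sub>R w)" for n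
    proof (rule AE_I2)
      fix t
      show "norm (Q1 n t) \<le> \<phi> (du t + m t *\<^sub>R w) + \<phi> (du t + (- m t) *\<^sub>R w)"
        using quotient_le[OF e, of "du t" n "m t *\<^sub>R w"] quotient_ge[OF e(1), of "du t" "m t *\<^sub>R w" n]
          nonneg[of "du t"] nonneg[of "du t + m t *\<^sub>R w"] nonneg[of "du t - m t *\<^sub>R w"]
        by (simp add: Q1_def abs_le_iff)
    qed
  qed
  have lim2: "(\<lambda>n. \<integral>t. Q2 n t \<partial>M) \<longlonglongrightarrow> (\<integral>t. \<psi> t * g w t \<partial>M)"
  proof -
    have "\<bar>\<psi> t\<bar> \<le> A" if "t \<in> {0..T}" for t using \<psi>(3,4)[OF that] by simp
    then obtain C where C: "0 \<le> C" "AE t in M. \<forall>l. 0 < l \<and> l \<le> 1 \<longrightarrow>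
      \<bar>(F t (u t + l *\<^sub>R \<psi> t *\<^sub>R w) - F t (u t)) / l\<bar> \<le> C * b t * norm (\<psi> t *\<^sub>R w)"
      using F_quotient_bound[of \<psi> A w] by blast
    have \<psi>m: "\<psi> \<in> borel_measurable M"
      using \<psi>_cont by (intro continuous_imp_measurable_on_sets_lebesgue) auto
    show ?thesis
    proof (rule integral_dominated_convergence[where w = "\<lambda>t. C * b t * (A * norm w)"])
      show "(\<lambda>t. \<psi> t * g w t) \<in> borel_measurable M" using \<psi>m g_measurable by measurable
      show "Q2 n \<in> borel_measurable M" for n
        unfolding Q2_def
        by (intro borel_measurable_divide borel_measurable_diff superposition_measurable continuous_intros u_continuous_on \<psi>_cont) simp_all
      show "integrable M (\<lambda>t. C * b t * (A * norm w))" using b_integrable by simp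
      show "AE t in M. (\<lambda>n. Q2 n t) \<longlonglongrightarrow> \<psi> t * g w t"
        using F_quotient_tendsto[of "\<lambda>t. \<psi> t *\<^sub>R w"] F_regular AE_in_interval
      proof eventually_elim
        case (elim t)
        have reg: "clarke_regular (F t)" using elim(2) by simp
        \<comment> \<open>\<open>dir_scale\<close> covers positive factors; the zeros of \<psi> are
          handled by \<open>dir_zero\<close>.\<close>
        have "dir (F t) (u t) (\<psi> t *\<^sub>R w) = \<psi> t * g w t"
          using dir_scale[OF reg, of "\<psi> t"] dir_zero[OF reg] \<psi>(3)[OF elim(3)]
          by (cases "\<psi> t = 0") (auto simp: g_def)
        then show ?case using elim(1) unfolding Q2_def e_def by simp
      qed
      show "AE t in M. norm (Q2 n t) \<le> C * b t * (A * norm w)" for n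
        using C(2) AE_in_interval
      proof eventually_elim
        case (elim t)
        have "norm (Q2 n t) \<le> C * b t * norm (\<psi> t *\<^sub>R w)" using elim(1) e[of n] unfolding Q2_def by simp
        also have "\<dots> \<le> C * b t * (A * norm w)"
          using \<psi>(3,4)[OF elim(2)] C(1) b_nonneg[OF elim(2)] by (intro mult_left_mono) (auto intro: mult_right_mono)
        finally show ?case .
      qed
    qed
  qed
  show ?thesis
    by (rule LIMSEQ_le_const[OF tendsto_add[OF lim1 lim2]]) (use pos in blast)
qed

end


section \<open>Trapezoidal test functions and their limits\<close>

definition ramp :: "real \<Rightarrow> real \<Rightarrow> real \<Rightarrow> real" where
  "ramp s h r = max 0 (min 1 ((r - s) / h))"

lemma ramp_has_integral:
  assumes "0 \<le> s" "0 < h" "0 \<le> r"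
  shows "((\<lambda>x. indicator {s..s+h} x / h) has_integral ramp s h r) {0..r}"
proof (cases "r < s")
  case True
  have "((\<lambda>x. 0 :: real) has_integral 0) {0..r}" by simp
  then have "((\<lambda>x. indicator {s..s+h} x / h) has_integral 0) {0..r}"
    by (rule has_integral_eq[rotated]) (use True in auto)
  moreover have "ramp s h r = 0" using True assms divide_nonpos_pos[of "r - s" h] by (simp add: ramp_def)
  ultimately show ?thesis by simp
next
  case False
  define e where "e = min r (s + h)"
  have e: "s \<le> e" "{s..e} \<subseteq> {0..r}" using False assms by (auto simp: e_def)
  have "((\<lambda>x. 1 / h) has_integral (e - s) / h) {s..e}"
    using has_integral_const_real[of "1 / h" s e] e(1) by simp
  then have "((\<lambda>x. if x \<in> {s..e} then 1 / h else 0) has_integral (e - s) / h) {0..r}"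
    by (subst has_integral_restrict[OF e(2)])
  then have "((\<lambda>x. indicator {s..s+h} x / h) has_integral (e - s) / h) {0..r}"
    by (rule has_integral_eq[rotated]) (auto simp: e_def indicator_def)
  moreover have "ramp s h r = (e - s) / h"
    using False assms by (auto simp: ramp_def e_def min_def max_def field_simps)
  ultimately show ?thesis by simp
qed

lemma ramp_bounds:
  assumes "0 < h"
  shows "0 \<le> ramp s h r" "ramp s h r \<le> 1" "s \<le> t \<Longrightarrow> ramp t h r \<le> ramp s h r"
    "r \<le> s \<Longrightarrow> ramp s h r = 0" "s + h \<le> r \<Longrightarrow> ramp s h r = 1"
proof -
  show "s \<le> t \<Longrightarrow> ramp t h r \<le> ramp s h r"
    using assms unfolding ramp_def by (intro max.mono min.mono divide_right_mono) auto
  show "r \<le> s \<Longrightarrow> ramp s h r = 0"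
    using assms divide_nonpos_pos[of "r - s" h] unfolding ramp_def by simp
  show "s + h \<le> r \<Longrightarrow> ramp s h r = 1"
    using assms unfolding ramp_def by (simp add: field_simps min_def)
qed (simp_all add: ramp_def)

text \<open>At r = s every ramp is 0 while the indicator is 1, hence the exclusion of that
  point.\<close>

lemma ramp_tendsto:
  assumes h: "\<And>n. 0 < h n" "h \<longlonglongrightarrow> 0" and r: "r \<noteq> s"
  shows "(\<lambda>n. ramp s (h n) r) \<longlonglongrightarrow> indicator {s..} r"
proof (cases "r < s")
  case True
  then have "ramp s (h n) r = 0" for n using h(1) by (intro ramp_bounds) auto
  then show ?thesis using True by simp
next
  case False
  then have "0 < r - s" using r by simp
  then have "eventually (\<lambda>n. h n < r - s) sequentially" by (rule order_tendstoD(2)[OF h(2)])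
  then have "eventually (\<lambda>n. ramp s (h n) r = 1) sequentially"
    by eventually_elim (use h(1) in \<open>auto intro!: ramp_bounds\<close>)
  then show ?thesis using False by (intro tendsto_eventually) (simp add: indicator_def)
qed

lemma dense_pair_sequences:
  fixes G :: "real set"
  assumes cl: "closure G = {a..b}" and st: "a \<le> s" "s < t" "t \<le> b"
  obtains x y where "\<And>n::nat. x n \<in> G" "\<And>n. y n \<in> G" "\<And>n. x n < y n" "x \<longlonglongrightarrow> s" "y \<longlonglongrightarrow> t"
proof -
  have "s \<in> closure G" "t \<in> closure G" using cl st by auto
  then obtain x y where xy: "\<And>n::nat. x n \<in> G" "x \<longlonglongrightarrow> s" "\<And>n::nat. y n \<in> G" "y \<longlonglongrightarrow> t"
    unfolding closure_sequential by blast
  have "(\<lambda>n. y n - x n) \<longlonglongrightarrow> t - s" using xy by (intro tendsto_intros)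
  then have "eventually (\<lambda>n. 0 < y n - x n) sequentially" by (rule order_tendstoD) (use st in simp)
  then obtain N where N: "\<And>n. n \<ge> N \<Longrightarrow> x n < y n" by (auto simp: eventually_sequentially)
  show thesis
  proof (rule that[of "\<lambda>n. x (n + N)" "\<lambda>n. y (n + N)"])
    show "(\<lambda>n. x (n + N)) \<longlonglongrightarrow> s" "(\<lambda>n. y (n + N)) \<longlonglongrightarrow> t"
      using xy by (auto intro: LIMSEQ_ignore_initial_segment)
  qed (use xy N in auto)
qed

lemma right_steps:
  assumes "t < (T :: real)"
  obtains h where "\<And>n::nat. 0 < h n" "\<And>n. t + h n \<le> T" "h \<longlonglongrightarrow> 0"
proof (rule that[of "\<lambda>n. (T - t) / real (Suc n)"])
  fix n
  have "(T - t) / real (Suc n) \<le> (T - t) / 1" using assms by (intro divide_left_mono) auto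
  then show "t + (T - t) / real (Suc n) \<le> T" by simp
qed (use assms LIMSEQ_Suc[OF lim_const_over_n] in auto)

lemma inner_le_dense:
  fixes x :: "'b::euclidean_space"
  assumes D: "closure D = UNIV" and le: "\<And>w. w \<in> D \<Longrightarrow> x \<bullet> w \<le> k * norm w"
  shows "x \<bullet> w \<le> k * norm w"
proof -
  have "continuous_on (closure D) (\<lambda>w. k * norm w - x \<bullet> w)" by (intro continuous_intros)
  then have "0 \<le> k * norm w - x \<bullet> w"
    by (rule continuous_ge_on_closure) (use D le in auto)
  then show ?thesis by simp
qed

context nonsmooth_minimizer
begin

lemma integral_indicator_eq:
  fixes f :: "real \<Rightarrow> real"
  assumes f: "integrable M f" and st: "0 \<le> s" "t \<le> T"
  shows "(\<integral>x. indicator {s..t} x * f x \<partial>M) = integral {s..t} f"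
    and "integrable M (\<lambda>x. indicator {s..t} x * f x)"
proof -
  have "{s..t} \<in> sets M" using st by (auto simp: sets_restrict_space_iff)
  from integrable_real_mult_indicator[OF this f]
  show i: "integrable M (\<lambda>x. indicator {s..t} x * f x)" by (simp add: mult.commute)
  have "integral {0..T} (\<lambda>x. indicator {s..t} x * f x) = integral {0..T} (\<lambda>x. if x \<in> {s..t} then f x else 0)"
    by (intro Henstock_Kurzweil_Integration.integral_cong) (simp add: indicator_def)
  also have "\<dots> = integral {s..t} f"
  proof (rule integral_unique)
    have "{s..t} \<subseteq> {0..T}" using st by auto
    moreover have "(f has_integral integral {s..t} f) {s..t}"
      using integrable_M_sub[OF f st] by (rule integrable_integral)
    ultimately show "((\<lambda>x. if x \<in> {s..t} then f x else 0) has_integral integral {s..t} f) {0..T}"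
      by (subst has_integral_restrict)
  qed
  finally show "(\<integral>x. indicator {s..t} x * f x \<partial>M) = integral {s..t} f"
    using integral_M_eq[OF i] by simp
qed

definition \<Gamma> :: "'a \<Rightarrow> real \<Rightarrow> real" where "\<Gamma> w r = integral {0..r} (g w)"

lemma integral_M_diff:
  fixes f :: "real \<Rightarrow> real"
  assumes f: "integrable M f" and st: "0 \<le> s" "s \<le> t" "t \<le> T"
  shows "integral {s..t} f = integral {0..t} f - integral {0..s} f"
  using Henstock_Kurzweil_Integration.integral_combine[OF st(1,2) integrable_M_sub[OF f order_refl st(3)]] by simp

text \<open>\<open>c0 = 1\<close>, \<open>\<sigma> = -1\<close> gives the complementary trapezoid, which is \<open>1\<close> near both endpoints.\<close>

lemma trapezoid_variation:
  assumes st: "0 \<le> s" "s < t" "t < T" and h: "0 < h" "t + h \<le> T"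
    and \<sigma>: "(c0 = 0 \<and> \<sigma> = 1) \<or> (c0 = 1 \<and> \<sigma> = - (1::real))"
  shows "0 \<le> \<sigma> * (integral {s..s+h} (\<lambda>r. p r \<bullet> w) / h - integral {t..t+h} (\<lambda>r. p r \<bullet> w) / h)
    + (\<integral>r. (c0 + \<sigma> * (ramp s h r - ramp t h r)) * g w r \<partial>M)"
proof -
  let ?m = "\<lambda>x. \<sigma> * (indicator {s..s+h} x / h - indicator {t..t+h} x / h)"
  let ?\<psi> = "\<lambda>r. c0 + \<sigma> * (ramp s h r - ramp t h r)"
  have "0 \<le> (\<integral>x. ?m x * (p x \<bullet> w) \<partial>M) + (\<integral>r. ?\<psi> r * g w r \<partial>M)"
  proof (rule first_variation[where A = 1 and B = "1 / h"])
    have r0: "ramp s h 0 = 0" "ramp t h 0 = 0" using st h by (auto intro!: ramp_bounds)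
    \<comment> \<open>Both ramps are completed by T because t + h \<le> T, so the trapezoid vanishes
      at both ends and the variation remains periodic.\<close>
    have rT: "ramp s h T = 1" "ramp t h T = 1" using st h by (auto intro!: ramp_bounds)
    show "(?m has_integral ?\<psi> r - ?\<psi> 0) {0..r}" if "r \<in> {0..T}" for r
    proof -
      have "((\<lambda>x. indicator {s..s+h} x / h) has_integral ramp s h r) {0..r}"
        "((\<lambda>x. indicator {t..t+h} x / h) has_integral ramp t h r) {0..r}"
        using st h that by (auto intro!: ramp_has_integral)
      from has_integral_mult_right[OF has_integral_diff[OF this], of \<sigma>]
      show ?thesis by (simp add: r0)
    qed
    show "?\<psi> 0 = ?\<psi> T" by (simp add: r0 rT)
    show "0 \<le> ?\<psi> r" "?\<psi> r \<le> 1" for r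
    proof -
      have "0 \<le> ramp s h r" "ramp s h r \<le> 1" "0 \<le> ramp t h r" "ramp t h r \<le> ramp s h r"
        using st h by (auto intro!: ramp_bounds)
      then show "0 \<le> ?\<psi> r" "?\<psi> r \<le> 1" using \<sigma> by auto
    qed
    have "{s..s+h} \<in> sets M" "{t..t+h} \<in> sets M" using st h by (auto simp: sets_restrict_space_iff)
    then show "?m \<in> borel_measurable M" by measurable
    \<comment> \<open>Where the two ramps overlap, their slopes cancel.\<close>
    show "\<bar>?m x\<bar> \<le> 1 / h" for x
      using \<sigma> h(1) by (auto simp: indicator_def)
  qed
  also have "(\<integral>x. ?m x * (p x \<bullet> w) \<partial>M)
    = (\<integral>x. \<sigma> / h * (indicator {s..s+h} x * (p x \<bullet> w)) - \<sigma> / h * (indicator {t..t+h} x * (p x \<bullet> w)) \<partial>M)"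
    by (rule Bochner_Integration.integral_cong) (simp_all add: algebra_simps)
  also have "\<dots> = \<sigma> / h * integral {s..s+h} (\<lambda>r. p r \<bullet> w) - \<sigma> / h * integral {t..t+h} (\<lambda>r. p r \<bullet> w)"
    using integral_indicator_eq[OF p_inner_integrable, of s "s + h" w] integral_indicator_eq[OF p_inner_integrable, of t "t + h" w] st h
    by simp
  also have "\<dots> = \<sigma> * (integral {s..s+h} (\<lambda>r. p r \<bullet> w) / h - integral {t..t+h} (\<lambda>r. p r \<bullet> w) / h)"
    by (simp add: right_diff_distrib)
  finally show ?thesis .
qed

text \<open>Off N the averages of p over the shrinking ramps converge to its values at s and t, by
  differentiation of the indefinite integral. The time T is left out because the ramps extend to the
  right of s and t.\<close>

lemma trapezoid_limit:
  obtains N where "negligible N"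
    "\<And>s t c0 \<sigma>. \<lbrakk>s \<in> {0..<T} - N; t \<in> {0..<T} - N; s < t; (c0 = 0 \<and> \<sigma> = 1) \<or> (c0 = 1 \<and> \<sigma> = - (1::real))\<rbrakk> \<Longrightarrow>
      0 \<le> \<sigma> * (p s \<bullet> w - p t \<bullet> w) + c0 * \<Gamma> w T + \<sigma> * (\<Gamma> w t - \<Gamma> w s)"
proof -
  let ?pw = "\<lambda>r. p r \<bullet> w"
  have "?pw integrable_on {0..T}" using p_inner_integrable by (rule integrable_M_sub) auto
  from integral_has_vector_derivative_AE[OF this]
  obtain N where N: "negligible N" "\<And>t. t \<in> {0..T} - N \<Longrightarrow>
    ((\<lambda>r. integral {0..r} ?pw) has_vector_derivative ?pw t) (at t within {0..T})" by blast
  show thesis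
  proof (rule that[OF N(1)])
    fix s t and c0 \<sigma> :: real
    assume st: "s \<in> {0..<T} - N" "t \<in> {0..<T} - N" "s < t" and \<sigma>: "(c0 = 0 \<and> \<sigma> = 1) \<or> (c0 = 1 \<and> \<sigma> = - (1::real))"
    obtain h where h: "\<And>n::nat. 0 < h n" "\<And>n. t + h n \<le> T" and h0: "h \<longlonglongrightarrow> 0"
      using st by (auto intro: right_steps)
    have lim1: "(\<lambda>n. integral {r..r + h n} ?pw / h n) \<longlonglongrightarrow> ?pw r" if r: "r \<in> {0..T} - N" "r \<le> t" for r
    proof -
      have hr: "r + h n \<in> {0..T}" for n using r h[of n] by auto
      have "(\<lambda>n. r + h n) \<longlonglongrightarrow> r + 0" by (intro tendsto_intros h0)
      then have "(\<lambda>n. (integral {0..r + h n} ?pw - integral {0..r} ?pw) /\<^sub>R (r + h n - r)) \<longlonglongrightarrow> ?pw r"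
        using r hr h(1) by (intro has_vector_derivative_straddle[OF N(2)[OF r(1)], of "\<lambda>_. r"]) (auto intro: less_imp_le)
      moreover have "(integral {0..r + h n} ?pw - integral {0..r} ?pw) /\<^sub>R (r + h n - r) = integral {r..r + h n} ?pw / h n" for n
        using integral_M_diff[OF p_inner_integrable, of r "r + h n" w] r hr[of n] h(1)[of n] by (simp add: field_simps)
      ultimately show ?thesis by simp
    qed
    let ?\<psi> = "\<lambda>h r. c0 + \<sigma> * (ramp s h r - ramp t h r)"
    have lim2: "(\<lambda>n. \<integral>r. ?\<psi> (h n) r * g w r \<partial>M) \<longlonglongrightarrow> (\<integral>r. (c0 + \<sigma> * indicator {s..t} r) * g w r \<partial>M)"
    proof (rule integral_dominated_convergence[where w = "\<lambda>r. 2 * \<bar>g w r\<bar>"])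
      have "{s..t} \<in> sets M" using st by (auto simp: sets_restrict_space_iff)
      then show "(\<lambda>r. (c0 + \<sigma> * indicator {s..t} r) * g w r) \<in> borel_measurable M" using g_measurable by measurable
      have "ramp a c \<in> borel_measurable M" for a c
        unfolding ramp_def divide_inverse by (intro continuous_imp_measurable_on_sets_lebesgue continuous_intros) auto
      then show "(\<lambda>r. ?\<psi> (h n) r * g w r) \<in> borel_measurable M" for n using g_measurable by measurable
      show "integrable M (\<lambda>r. 2 * \<bar>g w r\<bar>)" using g_integrable by simp
      show "AE r in M. norm (?\<psi> (h n) r * g w r) \<le> 2 * \<bar>g w r\<bar>" for n
      proof (rule AE_I2)
        fix r
        have "0 \<le> ramp s (h n) r" "ramp s (h n) r \<le> 1" "0 \<le> ramp t (h n) r" "ramp t (h n) r \<le> ramp s (h n) r"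
          using st h by (auto intro!: ramp_bounds)
        then have "\<bar>?\<psi> (h n) r\<bar> \<le> 2" using \<sigma> by auto
        then show "norm (?\<psi> (h n) r * g w r) \<le> 2 * \<bar>g w r\<bar>" by (simp add: abs_mult mult_right_mono)
      qed
      have "AE r in M. r \<notin> {s, t}" unfolding AE_M_iff by (intro exI[of _ "{s, t}"]) auto
      then show "AE r in M. (\<lambda>n. ?\<psi> (h n) r * g w r) \<longlonglongrightarrow> (c0 + \<sigma> * indicator {s..t} r) * g w r"
      proof eventually_elim
        case (elim r)
        have "(\<lambda>n. ramp s (h n) r) \<longlonglongrightarrow> indicator {s..} r" "(\<lambda>n. ramp t (h n) r) \<longlonglongrightarrow> indicator {t..} r"
          using elim by (auto intro!: ramp_tendsto h h0)
        then have "(\<lambda>n. ?\<psi> (h n) r * g w r) \<longlonglongrightarrow> (c0 + \<sigma> * (indicator {s..} r - indicator {t..} r)) * g w r"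
          by (intro tendsto_intros)
        moreover have "indicator {s..} r - indicator {t..} r = (indicator {s..t} r :: real)"
          using elim st by (auto simp: indicator_def)
        ultimately show ?case by simp
      qed
    qed
    have "0 \<le> \<sigma> * (integral {s..s + h n} ?pw / h n - integral {t..t + h n} ?pw / h n) + (\<integral>r. ?\<psi> (h n) r * g w r \<partial>M)" for n
      using st h \<sigma> by (intro trapezoid_variation) auto
    moreover have "(\<lambda>n. \<sigma> * (integral {s..s + h n} ?pw / h n - integral {t..t + h n} ?pw / h n) + (\<integral>r. ?\<psi> (h n) r * g w r \<partial>M))
      \<longlonglongrightarrow> \<sigma> * (?pw s - ?pw t) + (\<integral>r. (c0 + \<sigma> * indicator {s..t} r) * g w r \<partial>M)"
      using st by (intro tendsto_add tendsto_mult tendsto_diff tendsto_const lim1 lim2) auto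
    ultimately have "0 \<le> \<sigma> * (?pw s - ?pw t) + (\<integral>r. (c0 + \<sigma> * indicator {s..t} r) * g w r \<partial>M)"
      by (intro LIMSEQ_le_const) auto
    also have "(\<integral>r. (c0 + \<sigma> * indicator {s..t} r) * g w r \<partial>M) = (\<integral>r. c0 * g w r + \<sigma> * (indicator {s..t} r * g w r) \<partial>M)"
      by (simp add: algebra_simps)
    also have "\<dots> = c0 * \<Gamma> w T + \<sigma> * integral {s..t} (g w)"
      using integral_indicator_eq[OF g_integrable, of s t w] g_integrable[of w] integral_M_eq[OF g_integrable, of w] st
      by (simp add: \<Gamma>_def)
    also have "integral {s..t} (g w) = \<Gamma> w t - \<Gamma> w s"
      using integral_M_diff[OF g_integrable, of s t w] st by (simp add: \<Gamma>_def)
    finally show "0 \<le> \<sigma> * (p s \<bullet> w - p t \<bullet> w) + c0 * \<Gamma> w T + \<sigma> * (\<Gamma> w t - \<Gamma> w s)" by simp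
  qed
qed

lemma \<Gamma>_ac: "absolutely_continuous_on 0 T (\<Gamma> w)"
  unfolding \<Gamma>_def using g_integrable[of w] by (intro absolutely_continuous_on_integral) (simp add: integrable_M_iff)

end


context nonsmooth_minimizer
begin

text \<open>Every point of the interval has arbitrarily near open intervals inside it, and none of
  these is negligible. Density is what allows \<open>p\<close> to be extended from the good
  times.\<close>

lemma interval_minus_negligible_closure:
  assumes "negligible N"
  shows "closure ({0..<T} - N) = {0..T}"
proof
  show "closure ({0..<T} - N) \<subseteq> {0..T}" by (rule closure_minimal) auto
  show "{0..T} \<subseteq> closure ({0..<T} - N)"
  proof
    fix x assume x: "x \<in> {0..T}"
    have "\<exists>y\<in>{0..<T} - N. dist y x < e" if e: "0 < e" for e
    proof -
      let ?I = "{max 0 (x - e)<..<min T (x + e)}"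
      have "?I \<noteq> {}" using x e T by auto
      then have "\<not> negligible ?I" by (intro open_not_negligible) auto
      then obtain y where "y \<in> ?I" "y \<notin> N" using assms negligible_subset by blast
      then show ?thesis by (intro bexI[of _ y]) (auto simp: dist_real_def)
    qed
    then show "x \<in> closure ({0..<T} - N)" by (simp add: closure_approachable)
  qed
qed

theorem solves: "solves_inclusion T \<phi> F u"
proof -
  obtain D :: "'a set" where D: "countable D" "closure D = UNIV" using countable_closure_UNIV by blast
  let ?P = "\<lambda>w N. negligible N \<and> (\<forall>s t c0 \<sigma>. s \<in> {0..<T} - N \<longrightarrow> t \<in> {0..<T} - N \<longrightarrow> s < t \<longrightarrow>
      (c0 = 0 \<and> \<sigma> = 1) \<or> (c0 = 1 \<and> \<sigma> = - (1::real)) \<longrightarrow>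
      0 \<le> \<sigma> * (p s \<bullet> w - p t \<bullet> w) + c0 * \<Gamma> w T + \<sigma> * (\<Gamma> w t - \<Gamma> w s))"
  have "\<exists>N. ?P w N" for w by (rule trapezoid_limit[of w]) blast
  then have "\<forall>w\<in>D. \<exists>N. ?P w N" by blast
  then obtain Nw where Nw: "\<forall>w\<in>D. ?P w (Nw w)"
    by (rule bchoice[THEN exE])
  \<comment> \<open>The times at which the inequalities hold for all directions of D at once;
    countability of D keeps the removed set null.\<close>
  define G where "G = {0..<T} - \<Union>(Nw ` D)"
  have negl: "negligible (\<Union>(Nw ` D))"
    using Nw D(1) by (intro negligible_countable_Union) auto
  have clG: "closure G = {0..T}" unfolding G_def using negl by (rule interval_minus_negligible_closure)
  have GT: "G \<subseteq> {0..T}" using closure_subset[of G] clG by simp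
  \<comment> \<open>The first inequality comes from the trapezoid, the second from its complement,
    which measures the variation around the period from t back to s.\<close>
  have up: "(p t - p s) \<bullet> w \<le> \<Gamma> w t - \<Gamma> w s" and wrap: "(p s - p t) \<bullet> w \<le> \<Gamma> w T - (\<Gamma> w t - \<Gamma> w s)"
    if st: "s \<in> G" "t \<in> G" "s < t" and w: "w \<in> D" for s t w
  proof -
    have "s \<in> {0..<T} - Nw w" "t \<in> {0..<T} - Nw w" using st w by (auto simp: G_def)
    note * = Nw[rule_format, OF w, THEN conjunct2, rule_format, OF this st(3)]
    show "(p t - p s) \<bullet> w \<le> \<Gamma> w t - \<Gamma> w s"
      using *[of 0 1] by (simp add: inner_diff_left)
    show "(p s - p t) \<bullet> w \<le> \<Gamma> w T - (\<Gamma> w t - \<Gamma> w s)"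
      using *[of 1 "-1"] by (simp add: inner_diff_left)
  qed
  obtain C where C: "0 \<le> C" "AE t in M. \<forall>w. \<bar>g w t\<bar> \<le> C * b t * norm w" using g_bound by blast
  \<comment> \<open>A single absolutely continuous majorant, independent of the direction, which
    controls every \<Gamma> w.\<close>
  define \<beta> where "\<beta> r = integral {0..r} (\<lambda>r. C * b r)" for r
  have bi: "integrable M (\<lambda>r. C * b r)" using b_integrable by simp
  have \<beta>_ac: "absolutely_continuous_on 0 T \<beta>"
    unfolding \<beta>_def using bi unfolding integrable_M_iff by (rule absolutely_continuous_on_integral)
  have \<Gamma>_le: "\<Gamma> w t - \<Gamma> w s \<le> (\<beta> t - \<beta> s) * norm w" if st: "0 \<le> s" "s \<le> t" "t \<le> T" for s t w
  proof -
    have "(\<integral>r. indicator {s..t} r * g w r \<partial>M) \<le> (\<integral>r. norm w * (indicator {s..t} r * (C * b r)) \<partial>M)"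
    proof (rule integral_mono_AE)
      show "AE r in M. indicator {s..t} r * g w r \<le> norm w * (indicator {s..t} r * (C * b r))"
        using C(2)
      proof eventually_elim
        case (elim r)
        from elim[rule_format, of w] show ?case by (simp add: indicator_def mult.commute abs_le_iff)
      qed
    qed (use integral_indicator_eq(2)[OF g_integrable] integral_indicator_eq(2)[OF bi] st in auto)
    also have "\<dots> = norm w * integral {s..t} (\<lambda>r. C * b r)"
      using integral_indicator_eq(1)[OF bi, of s t] st by simp
    finally show ?thesis
      using integral_indicator_eq(1)[OF g_integrable, of s t w] st integral_M_diff[OF g_integrable, of s t w] integral_M_diff[OF bi st]
      by (simp add: \<Gamma>_def \<beta>_def mult.commute)
  qed
  have p_le: "norm (p t - p s) \<le> \<beta> t - \<beta> s" if st: "s \<in> G" "t \<in> G" "s \<le> t" for s t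
  proof (cases "s = t")
    case False
    then have st': "0 \<le> s" "s < t" "t \<le> T" using st GT by auto
    \<comment> \<open>The increment of p is used as its own test direction, admissible once the
      bound is extended from D by density.\<close>
    have "(p t - p s) \<bullet> (p t - p s) \<le> (\<beta> t - \<beta> s) * norm (p t - p s)"
    proof (rule inner_le_dense[OF D(2)])
      fix w assume "w \<in> D"
      then show "(p t - p s) \<bullet> w \<le> (\<beta> t - \<beta> s) * norm w"
        using order_trans[OF up[OF st(1,2) st'(2)] \<Gamma>_le[OF st'(1) st(3) st'(3)]] by blast
    qed
    then have "norm (p t - p s) * norm (p t - p s) \<le> (\<beta> t - \<beta> s) * norm (p t - p s)"
      by (simp add: power2_norm_eq_inner[symmetric] power2_eq_square)
    moreover have "0 \<le> \<beta> t - \<beta> s"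
    proof -
      have "0 \<le> integral {s..t} (\<lambda>r. C * b r)"
      proof (rule Henstock_Kurzweil_Integration.integral_nonneg[OF integrable_M_sub[OF bi st'(1,3)]])
        fix r assume "r \<in> {s..t}"
        then have "0 \<le> b r" using st' by (intro b_nonneg) auto
        then show "0 \<le> C * b r" using C(1) by simp
      qed
      then show ?thesis using integral_M_diff[OF bi st'(1) st(3) st'(3)] by (simp add: \<beta>_def)
    qed
    ultimately show ?thesis by (cases "p t = p s") auto
  qed simp
  have "uniformly_continuous_on G p"
    unfolding uniformly_continuous_on_def
  proof (intro allI impI)
    fix e :: real assume e: "0 < e"
    have "uniformly_continuous_on {0..T} \<beta>" using \<beta>_ac by (rule absolutely_continuous_on_imp_uniformly_continuous_on)
    then obtain d where d: "d > 0" "\<And>x y. x \<in> {0..T} \<Longrightarrow> y \<in> {0..T} \<Longrightarrow> dist y x < d \<Longrightarrow> dist (\<beta> y) (\<beta> x) < e"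
      unfolding uniformly_continuous_on_def using e by meson
    have "dist (p y) (p x) < e" if xy: "x \<in> G" "y \<in> G" "dist y x < d" for x y
    proof -
      have "dist (\<beta> y) (\<beta> x) < e" using d(2)[of x y] xy GT by blast
      then show ?thesis using p_le[of x y] p_le[of y x] xy
        by (cases "x \<le> y") (auto simp: dist_norm norm_minus_commute)
    qed
    then show "\<exists>d>0. \<forall>x\<in>G. \<forall>x'\<in>G. dist x' x < d \<longrightarrow> dist (p x') (p x) < e" using d(1) by blast
  qed
  then obtain P where P: "uniformly_continuous_on (closure G) P" "\<And>x. x \<in> G \<Longrightarrow> p x = P x"
    by (rule uniformly_continuous_on_extension_on_closure) blast
  have P_cont: "continuous_on {0..T} P"
    using P(1) unfolding clG by (rule uniformly_continuous_imp_continuous)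
  have \<beta>_cont: "continuous_on {0..T} \<beta>" and \<Gamma>_cont: "continuous_on {0..T} (\<Gamma> w)" for w
    using absolutely_continuous_on_imp_uniformly_continuous_on[OF \<beta>_ac]
      absolutely_continuous_on_imp_uniformly_continuous_on[OF \<Gamma>_ac] uniformly_continuous_imp_continuous by blast+
  have lim: "(\<lambda>n. f (x n)) \<longlonglongrightarrow> f s" if f: "continuous_on {0..T} f" and x: "\<And>n. x n \<in> G" "x \<longlonglongrightarrow> s" and s: "s \<in> {0..T}"
    for f :: "real \<Rightarrow> 'c::metric_space" and x s
  proof (rule continuous_on_tendsto_compose[OF f x(2) s])
    show "eventually (\<lambda>n. x n \<in> {0..T}) sequentially" using x(1) GT by (intro always_eventually) blast
  qed
  have P_ext: "norm (P t - P s) \<le> \<beta> t - \<beta> s"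
    "\<And>w. w \<in> D \<Longrightarrow> (P t - P s) \<bullet> w \<le> \<Gamma> w t - \<Gamma> w s"
    "\<And>w. w \<in> D \<Longrightarrow> (P s - P t) \<bullet> w \<le> \<Gamma> w T - (\<Gamma> w t - \<Gamma> w s)"
    if st: "0 \<le> s" "s < t" "t \<le> T" for s t
  proof -
    obtain x y where xy: "\<And>n::nat. x n \<in> G" "\<And>n. y n \<in> G" "\<And>n. x n < y n" "x \<longlonglongrightarrow> s" "y \<longlonglongrightarrow> t"
      by (rule dense_pair_sequences[OF clG st]) blast
    have sT: "s \<in> {0..T}" and tT: "t \<in> {0..T}" using st by auto
    note Px = lim[OF P_cont xy(1,4) sT] and Py = lim[OF P_cont xy(2,5) tT]
    note \<Gamma>x = lim[OF \<Gamma>_cont xy(1,4) sT] and \<Gamma>y = lim[OF \<Gamma>_cont xy(2,5) tT]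
    have "norm (P (y n) - P (x n)) \<le> \<beta> (y n) - \<beta> (x n)" for n
      using p_le[OF xy(1,2) less_imp_le[OF xy(3)], of n] unfolding P(2)[OF xy(1)] P(2)[OF xy(2)] .
    then show "norm (P t - P s) \<le> \<beta> t - \<beta> s"
      by (intro LIMSEQ_le[OF tendsto_norm[OF tendsto_diff[OF Py Px]]
            tendsto_diff[OF lim[OF \<beta>_cont xy(2,5) tT] lim[OF \<beta>_cont xy(1,4) sT]]]) blast
    fix w assume w: "w \<in> D"
    have "(P (y n) - P (x n)) \<bullet> w \<le> \<Gamma> w (y n) - \<Gamma> w (x n)" for n
      using up[OF xy(1,2,3) w, of n] unfolding P(2)[OF xy(1)] P(2)[OF xy(2)] .
    then show "(P t - P s) \<bullet> w \<le> \<Gamma> w t - \<Gamma> w s"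
      by (intro LIMSEQ_le[OF tendsto_inner[OF tendsto_diff[OF Py Px] tendsto_const] tendsto_diff[OF \<Gamma>y \<Gamma>x]]) blast
    have "(P (x n) - P (y n)) \<bullet> w \<le> \<Gamma> w T - (\<Gamma> w (y n) - \<Gamma> w (x n))" for n
      using wrap[OF xy(1,2,3) w, of n] unfolding P(2)[OF xy(1)] P(2)[OF xy(2)] .
    then show "(P s - P t) \<bullet> w \<le> \<Gamma> w T - (\<Gamma> w t - \<Gamma> w s)"
      by (intro LIMSEQ_le[OF tendsto_inner[OF tendsto_diff[OF Px Py] tendsto_const]
            tendsto_diff[OF tendsto_const tendsto_diff[OF \<Gamma>y \<Gamma>x]]]) blast
  qed
  note P_le = P_ext(1) and P_up = P_ext(2)
  \<comment> \<open>For s = 0 and t = T the complementary interval is empty: the right side is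
    \<Gamma> w 0 = 0. The inequality then extends to w = P 0 - P T.\<close>
  have "(P 0 - P T) \<bullet> w \<le> \<Gamma> w T - (\<Gamma> w T - \<Gamma> w 0)" if w: "w \<in> D" for w
    using P_ext(3)[OF order_refl T order_refl w] .
  then have "(P 0 - P T) \<bullet> w \<le> 0 * norm w" if "w \<in> D" for w using that by (simp add: \<Gamma>_def)
  then have "(P 0 - P T) \<bullet> (P 0 - P T) \<le> 0 * norm (P 0 - P T)" by (rule inner_le_dense[OF D(2)])
  then have "(P 0 - P T) \<bullet> (P 0 - P T) = 0" using inner_ge_zero[of "P 0 - P T"] by linarith
  then have P_per: "P 0 = P T" by simp
  have P_ac: "absolutely_continuous_on 0 T P"
  proof (rule absolutely_continuous_on_le[OF \<beta>_ac])
    fix s t assume "0 \<le> s" "s \<le> t" "t \<le> T"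
    then show "norm (P t - P s) \<le> norm (\<beta> t - \<beta> s)" using P_le[of s t] by (cases "s = t") auto
  qed
  have \<Gamma>_der: "AE t in M. \<forall>w\<in>D. (\<Gamma> w has_vector_derivative g w t) (at t within {0..T})"
  proof (subst AE_ball_countable[OF D(1)], rule ballI)
    fix w
    have "g w integrable_on {0..T}" by (rule integrable_M_sub[OF g_integrable]) auto
    then obtain N where N: "negligible N" "\<And>t. t \<in> {0..T} - N \<Longrightarrow>
      ((\<lambda>r. integral {0..r} (g w)) has_vector_derivative g w t) (at t within {0..T})"
      by (rule integral_has_vector_derivative_AE) blast
    have "\<Gamma> w = (\<lambda>r. integral {0..r} (g w))" by (rule ext) (simp add: \<Gamma>_def)
    then show "AE t in M. (\<Gamma> w has_vector_derivative g w t) (at t within {0..T})"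
      unfolding AE_M_iff using N by auto
  qed
  have "AE t in M. t \<noteq> T" unfolding AE_M_iff by (intro exI[of _ "{T}"]) auto
  then have incl: "AE t in M. weak_deriv T P t \<in> clarke_gradient (F t) (u t)"
    using absolutely_continuous_on_FTC(1)[OF T P_ac] \<Gamma>_der F_regular C(2) AE_in_interval
  proof eventually_elim
    case (elim t)
    have t: "0 \<le> t" "t < T" using elim(1,6) by auto
    have reg: "clarke_regular (F t)" using elim(4) by simp
    \<comment> \<open>Forward steps suffice: \<open>P_up\<close> compares increments of P and
      \<Gamma> w over {t..t + h n}, and both quotients converge to the derivatives within
      {0..T}.\<close>
    obtain h where h: "\<And>n::nat. 0 < h n" "\<And>n. t + h n \<le> T" and h0: "h \<longlonglongrightarrow> 0"
      using right_steps[OF t(2)] by blast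
    from tendsto_add[OF tendsto_const h0, of t] have th: "(\<lambda>n. t + h n) \<longlonglongrightarrow> t" by simp
    have str: "(\<lambda>n. (f (t + h n) - f t) /\<^sub>R (t + h n - t)) \<longlonglongrightarrow> d"
      if "(f has_vector_derivative d) (at t within {0..T})" for f :: "real \<Rightarrow> 'c::real_normed_vector" and d
    proof (rule has_vector_derivative_straddle[OF that, of "\<lambda>_. t"])
      show "t \<in> {0..T}" using t by simp
      fix n show "t + h n \<in> {0..T}" "t \<le> t + h n" "t < t + h n" using h[of n] t by auto
    qed (simp_all add: th)
    let ?d = "weak_deriv T P t"
    have "?d \<bullet> w \<le> dir (F t) (u t) w" if w: "w \<in> D" for w
    proof (rule LIMSEQ_le)
      show "(\<lambda>n. ((P (t + h n) - P t) /\<^sub>R (t + h n - t)) \<bullet> w) \<longlonglongrightarrow> ?d \<bullet> w"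
        by (intro tendsto_inner tendsto_const str elim(2))
      show "(\<lambda>n. (\<Gamma> w (t + h n) - \<Gamma> w t) /\<^sub>R (t + h n - t)) \<longlonglongrightarrow> dir (F t) (u t) w"
        using str[OF elim(3)[rule_format, OF w]] by (simp add: g_def)
      have "((P (t + h n) - P t) /\<^sub>R (t + h n - t)) \<bullet> w \<le> (\<Gamma> w (t + h n) - \<Gamma> w t) /\<^sub>R (t + h n - t)" for n
        using P_up[of t "t + h n" w] h[of n] t w by (simp add: mult_left_mono)
      then show "\<exists>N. \<forall>n\<ge>N. ((P (t + h n) - P t) /\<^sub>R (t + h n - t)) \<bullet> w \<le> (\<Gamma> w (t + h n) - \<Gamma> w t) /\<^sub>R (t + h n - t)"
        by blast
    qed
    note on_D = this
    have dir_le: "dir (F t) (u t) w \<le> dir (F t) (u t) w' + C * b t * norm (w - w')" for w w'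
    proof -
      have "dir (F t) (u t) (w' + (w - w')) \<le> dir (F t) (u t) w' + dir (F t) (u t) (w - w')"
        by (rule dir_add[OF reg])
      moreover have "dir (F t) (u t) (w - w') \<le> C * b t * norm (w - w')"
        using elim(5)[rule_format, of "w - w'"] unfolding g_def by (simp add: abs_le_iff)
      ultimately show ?thesis by simp
    qed
    \<comment> \<open>Subadditivity and the linear bound make the Clarke derivative Lipschitz in its
      direction, so the inequality passes from D to all directions and yields membership in the
      gradient.\<close>
    have "(C * b t)-lipschitz_on UNIV (dir (F t) (u t))"
    proof (rule lipschitz_onI)
      fix x y
      show "dist (dir (F t) (u t) x) (dir (F t) (u t) y) \<le> C * b t * dist x y"
        using dir_le[of x y] dir_le[of y x] by (auto simp: dist_norm norm_minus_commute abs_le_iff)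
    qed (use C(1) b_nonneg[OF elim(6)] in simp)
    then have "continuous_on (closure D) (dir (F t) (u t))"
      unfolding D(2) by (rule lipschitz_on_continuous_on)
    then have cont: "continuous_on (closure D) (\<lambda>w. dir (F t) (u t) w - ?d \<bullet> w)"
      by (intro continuous_intros)
    have "0 \<le> dir (F t) (u t) w - ?d \<bullet> w" for w
      by (rule continuous_ge_on_closure[OF cont]) (use on_D D(2) in auto)
    then show ?case unfolding clarke_gradient_iff[OF reg] by simp
  qed
  \<comment> \<open>Defined at every time, so that the boundary values make sense. On G the
    extension agrees with \<open>p\<close>, and injectivity of the gradient gives back
    \<open>du\<close>.\<close>
  define w where "w t = inv (grad \<phi>) (P t)" for t
  have surj: "surj (grad \<phi>)" using surj_grad by (metis surjI)
  have gw: "grad \<phi> (w t) = P t" for t unfolding w_def by (rule surj_f_inv_f[OF surj])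
  have "AE t in M. t \<in> G"
    unfolding AE_M_iff
  proof (intro exI conjI)
    show "negligible (insert T (\<Union>(Nw ` D)))" using negl by simp
  qed (auto simp: G_def)
  then have "AE t in M. w t = du t"
  proof eventually_elim
    case (elim t)
    then have "grad \<phi> (w t) = grad \<phi> (du t)" using P(2)[OF elim] gw by (simp add: p_def)
    then show ?case by (rule injD[OF inj_grad])
  qed
  then have uw: "AE t in M. (u has_vector_derivative w t) (at t within {0..T})"
    using absolutely_continuous_on_FTC(1)[OF T u_ac] by eventually_elim simp
  have "AE t in M. \<exists>x\<in>clarke_gradient (F t) (u t). ((\<lambda>t. grad \<phi> (w t)) has_vector_derivative x) (at t within {0..T})"
    using incl absolutely_continuous_on_FTC(1)[OF T P_ac]
    by eventually_elim (auto simp: gw)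
  then show ?thesis
    \<comment> \<open>As w depends on t only through P t, the equality of P at 0 and T carries over
      to w.\<close>
    unfolding solves_inclusion_def
    using uw P_ac u_per P_per by (intro exI[of _ w]) (simp add: gw w_def[of 0] w_def[of T])
qed

end


theorem theorem2p2:
  fixes T :: real
    and \<phi> :: "real ^ 'n \<Rightarrow> real"
    and F :: "real \<Rightarrow> real ^ 'n \<Rightarrow> real"
    and b d :: "real \<Rightarrow> real"
    and c :: "real ^ 'n \<Rightarrow> real"
    and \<phi>\<^sub>0 :: "real ^ 'n \<Rightarrow> ereal"
  assumes "T > 0"
    and "\<And>x. \<phi> differentiable (at x)"
    and "\<And>x. (\<lambda>t. F t x) \<in> borel_measurable (lebesgue_on {0..T})"
    and "strictly_convex \<phi>"
    and "G_function (\<lambda>x. ereal (\<phi> x))"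
    and "Delta2 (\<lambda>x. ereal (\<phi> x))"
    and "Delta2 (conjugate (\<lambda>x. ereal (\<phi> x)))"
    and "AE t in lebesgue_on {0..T}. locally_Lipschitz (F t) \<and> clarke_regular (F t)"
    and "integrable (lebesgue_on {0..T}) b"
    and "\<And>t. t \<in> {0..T} \<Longrightarrow> 0 \<le> b t"
    and "\<And>S. bounded S \<Longrightarrow> bounded (c ` S)"
    and "\<And>x. AE t in lebesgue_on {0..T}. \<forall>\<xi> \<in> clarke_gradient (F t) x.
           \<bar>F t x\<bar> + norm \<xi> \<le> c x * b t"
    and "integrable (lebesgue_on {0..T}) d"
    and "AE t in lebesgue_on {0..T}. d t \<noteq> 0"
    and "G_function \<phi>\<^sub>0"
    and "\<phi>\<^sub>0 \<lless> (\<lambda>x. ereal (\<phi> x))"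
    and "\<And>x. AE t in lebesgue_on {0..T}. \<forall>\<xi> \<in> clarke_gradient (F t) x.
           conjugate (\<lambda>x. ereal (\<phi> x)) (\<xi> /\<^sub>R d t) \<le> \<phi>\<^sub>0 x + 1"
    and "((\<lambda>x. 1 / \<phi>\<^sub>0 (2 *\<^sub>R x) * ereal (LINT t|lebesgue_on {0..T}. F t x)) \<longlongrightarrow> \<infinity>) at_infinity"
  shows "\<exists>u. is_arg_min (action T \<phi> F) (\<lambda>u. u \<in> periodic_Orlicz_Sobolev_space T (\<lambda>x. ereal (\<phi> x))) u \<and>
             solves_inclusion T \<phi> F u"
proof -
  interpret nonsmooth_problem \<phi> T F b d c \<phi>\<^sub>0
    by (unfold_locales; fact)
  obtain u where min: "u \<in> periodic_Orlicz_Sobolev_space T (\<lambda>x. ereal (\<phi> x))"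
    "\<And>v. v \<in> periodic_Orlicz_Sobolev_space T (\<lambda>x. ereal (\<phi> x)) \<Longrightarrow> action T \<phi> F u \<le> action T \<phi> F v"
    by (rule minimizer_exists) blast
  interpret nonsmooth_minimizer \<phi> T F b d c \<phi>\<^sub>0 u
    by unfold_locales (fact min)+
  have "is_arg_min (action T \<phi> F) (\<lambda>u. u \<in> periodic_Orlicz_Sobolev_space T (\<lambda>x. ereal (\<phi> x))) u"
    using min by (auto simp: is_arg_min_def not_less)
  then show ?thesis using solves by blast
qed


end
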